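(* Suppose $\alpha<\beta=1$ (i.e. $\mu=0$). Write $W(p):=\alpha(c-1)^{\alpha-1}(\lambda p+\Psi+R)^{\alpha-1}\gamma p-k(\lambda p+\Psi+R)^\alpha$. For the entry problem: (1) If $\frac{\lambda}{\gamma}\le\frac{\alpha}{k}(c-1)^{\alpha-1}$, there exists $p_1^*\in[0,\infty)$ such that the agent enters the trade when the price is at or above $p_1^*$ (the first time $P_t\in[p_1^*,\infty)$ is optimal for the entry problem), and $V_2(p)=W(p)$ for $p\ge p_1^*$, $V_2(p)=\bigl(W(p_1^* )+kR^\alpha\bigr)\frac{p}{p_1^*}-kR^\alpha$ for $p<p_1^*$. (2) If $\frac{\alpha}{k}(c-1)^{\alpha-1}<\frac{\lambda}{\gamma}<\frac{(c-1)^{\alpha-1}}{k}$, there exists a constant $C\in(0,\infty)$ independent of $\Psi$ and $R$ such that: (a) If $\Psi<CR$, there exist $0\le p_1^*<p_2^*<\infty$ such that the agent enters the trade when the price is within $[p_1^*,p_2^*]$ (the first time $P_t\in[p_1^*,p_2^*]$ is optimal for the entry problem), and $V_2(p)=W(p_2^* )$ for $p>p_2^*$, $V_2(p)=W(p)$ for $p_1^*\le p\le p_2^*$, $V_2(p)=\bigl(W(p_1^* )+kR^\alpha\bigr)\frac{p}{p_1^*}-kR^\alpha$ for $p<p_1^*$. (b) If $\Psi\ge CR$, the agent never enters the trade ($\tau=+\infty$ is optimal for the entry problem), and $V_2(p)=-kR^\alpha$. (3) If $\frac{\lambda}{\gamma}\ge\frac{(c-1)^{\alpha-1}}{k}$,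 the agent never enters the trade ($\tau=+\infty$ is optimal for the entry problem), and $V_2(p)=-kR^\alpha$. Moreover, in cases (1) and (2)(a), $p_1^*=\frac{R+\Psi}{\gamma}x_1^*$ where $x_1^*$ is the smaller solution (i.e. the smallest nonnegative solution) of $$k=\Bigl(1+\frac{\Psi}{R}\Bigr)^\alpha\,\frac{k\bigl(\frac{\lambda}{\gamma}x+1\bigr)\bigl[\frac{\lambda}{\gamma}(1-\alpha)x+1\bigr]-\alpha(c-1)^{\alpha-1}\frac{\lambda}{\gamma}(1-\alpha)x^{2}}{\bigl(\frac{\lambda}{\gamma}x+1\bigr)^{2-\alpha}},$$ and in case (2)(a) $$p_2^*=\frac{(R+\Psi)\bigl[(c-1)^{\alpha-1}-k\lambda/\gamma\bigr]}{\lambda\bigl[k\lambda/\gamma-\alpha(c-1)^{\alpha-1}\bigr]}.$$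
   Context: Setting. $(\Omega,\mathcal F,\{\mathcal F_t\},\mathbb P)$ is a filtered probability space satisfying the usual conditions and supporting a Brownian motion $B$. The asset price is a geometric Brownian motion $dP_t=P_t(\mu\,dt+\sigma\,dB_t)$, $P_0=p>0$, with $\sigma>0$, and $\beta:=1-\frac{2\mu}{\sigma^2}$; here $\beta=1$, i.e. $\mu=0$. $\mathcal T$ is the set of $\{\mathcal F_t\}$-stopping times valued in $[0,+\infty]$. Parameters: $\lambda\ge 1$, $\gamma\in(0,1]$, $\Psi\ge0$, $R>0$, $\alpha\in(0,1)$, $k>1$. The utility function is $U(x)=x^\alpha$ for $x>0$ and $U(x)=-k|x|^\alpha$ for $x\le 0$. Exit problem: for $H>0$, $V_1(p;H):=\sup_{\nu\in\mathcal T}\mathbb E[U(\gamma P_\nu-H)\mid P_0=p]$. Entry problem: $G_2(p):=\max\{V_1(p;\lambda p+\Psi+R),\,U(-R)\}$ and $V_2(p):=\sup_{\tau\in\mathcal T}\mathbb E[G_2(P_\tau)\mid P_0=p]$. On the event that a stopping time equals $+\infty$ the price is taken to be $P_\infty:=\lim_{t\to\infty}P_t=0$ (which holds a.s.), with $V_1(0;H)=U(-H)$. The constant $c>1$ is the solution of $\alpha c(c-1)^{\alpha-1}-(c-1)^\alpha-k=0$. *)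

theory Defs
  imports "HOL-Probability.Probability"
begin

section \<open>Filtered probability space and Brownian motion\<close>

text \<open>
  A filtration is indexed by \<open>[0, \<infinity>]\<close>, i.e. by the type \<^typ>\<open>ennreal\<close>, so that the library predicate
  \<^const>\<open>stopping_time\<close> at this type describes exactly the stopping times with values in
  \<open>[0, \<infinity>]\<close>. The member \<open>F \<infinity>\<close> is any \<open>\<sigma>\<close>-algebra between all the \<open>F t\<close> and \<open>M\<close>; it has no
  influence, because the condition on \<open>{\<tau> \<le> \<infinity>}\<close> is void. As in the library, only the
  \<open>\<sigma>\<close>-algebra of \<open>F t\<close> matters, not its measure.
\<close>

definition usual_filtered_space :: "'a measure \<Rightarrow> (ennreal \<Rightarrow> 'a measure) \<Rightarrow> bool" where
  "usual_filtered_space M F \<longleftrightarrow>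
     prob_space M \<and> complete_measure M \<and> filtration (space M) F \<and>
     (\<forall>t. sets (F t) \<subseteq> sets M) \<and>
     null_sets M \<subseteq> sets (F 0) \<and>
     (\<forall>t<\<infinity>. sets (F t) = (\<Inter>s\<in>{t<..}. sets (F s)))"

definition brownian_motion ::
  "'a measure \<Rightarrow> (ennreal \<Rightarrow> 'a measure) \<Rightarrow> (real \<Rightarrow> 'a \<Rightarrow> real) \<Rightarrow> bool" where
  "brownian_motion M F B \<longleftrightarrow>
     (\<forall>t\<ge>0. B t \<in> borel_measurable (F (ennreal t))) \<and>
     (AE \<omega> in M. B 0 \<omega> = 0) \<and>
     (AE \<omega> in M. continuous_on {0..} (\<lambda>t. B t \<omega>)) \<and>
     (\<forall>s t. 0 \<le> s \<and> s < t \<longrightarrow>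
        distributed M lborel (\<lambda>\<omega>. B t \<omega> - B s \<omega>) (normal_density 0 (sqrt (t - s))) \<and>
        prob_space.indep_set M (sets (F (ennreal s)))
          (sets (vimage_algebra (space M) (\<lambda>\<omega>. B t \<omega> - B s \<omega>) borel)))"

section \<open>Ito integral and geometric Brownian motion\<close>

text \<open>
  An elementary integrand on \<open>[0, t]\<close> is \<open>\<Sum>i<N. \<xi> i * 1_(s i, s (i + 1)]\<close> for a partition
  \<open>0 = s 0 \<le> \<dots> \<le> s N = t\<close> and bounded \<open>F (s i)\<close>-measurable \<open>\<xi> i\<close>.
\<close>

definition elementary_integrand ::
  "(ennreal \<Rightarrow> 'a measure) \<Rightarrow> real \<Rightarrow> nat \<Rightarrow> (nat \<Rightarrow> real) \<Rightarrow> (nat \<Rightarrow> 'a \<Rightarrow> real) \<Rightarrow> bool" where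
  "elementary_integrand F t N s \<xi> \<longleftrightarrow>
     s 0 = 0 \<and> s N = t \<and>
     (\<forall>i<N. s i \<le> s (Suc i) \<and>
        \<xi> i \<in> borel_measurable (F (ennreal (s i))) \<and>
        bounded (\<xi> i ` space (F (ennreal (s i)))))"

definition elementary_process ::
  "nat \<Rightarrow> (nat \<Rightarrow> real) \<Rightarrow> (nat \<Rightarrow> 'a \<Rightarrow> real) \<Rightarrow> real \<Rightarrow> 'a \<Rightarrow> real" where
  "elementary_process N s \<xi> u \<omega> = (\<Sum>i<N. \<xi> i \<omega> * indicator {s i<..s (Suc i)} u)"

definition elementary_integral ::
  "(real \<Rightarrow> 'a \<Rightarrow> real) \<Rightarrow> nat \<Rightarrow> (nat \<Rightarrow> real) \<Rightarrow> (nat \<Rightarrow> 'a \<Rightarrow> real) \<Rightarrow> 'a \<Rightarrow> real" where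
  "elementary_integral B N s \<xi> \<omega> = (\<Sum>i<N. \<xi> i \<omega> * (B (s (Suc i)) \<omega> - B (s i) \<omega>))"

definition tendsto_zero_in_prob :: "'a measure \<Rightarrow> (nat \<Rightarrow> 'a \<Rightarrow> ennreal) \<Rightarrow> bool" where
  "tendsto_zero_in_prob M Z \<longleftrightarrow>
     (\<forall>n. Z n \<in> borel_measurable M) \<and>
     (\<forall>\<epsilon>>0. (\<lambda>n. emeasure M {\<omega> \<in> space M. \<epsilon> < Z n \<omega>}) \<longlonglongrightarrow> 0)"

text \<open>
  \<open>has_ito_integral M F B X t I\<close> states that \<open>I\<close> is (a version of) \<open>\<integral>\<^sub>0\<^sup>t X dB\<close>: the limit in probability
  of the elementary integrals of elementary processes \<open>\<phi> n\<close> with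
  \<open>\<integral>\<^sub>0\<^sup>t (\<phi> n - X)\<^sup>2 du \<rightarrow> 0\<close> in probability.
\<close>

definition has_ito_integral ::
  "'a measure \<Rightarrow> (ennreal \<Rightarrow> 'a measure) \<Rightarrow> (real \<Rightarrow> 'a \<Rightarrow> real) \<Rightarrow> (real \<Rightarrow> 'a \<Rightarrow> real) \<Rightarrow> real \<Rightarrow>
     ('a \<Rightarrow> real) \<Rightarrow> bool" where
  "has_ito_integral M F B X t I \<longleftrightarrow>
     I \<in> borel_measurable M \<and>
     (\<exists>N s \<xi>. (\<forall>n. elementary_integrand F t (N n) (s n) (\<xi> n)) \<and>
        tendsto_zero_in_prob M
          (\<lambda>n \<omega>. \<integral>\<^sup>+u\<in>{0..t}.
             ennreal ((elementary_process (N n) (s n) (\<xi> n) u \<omega> - X u \<omega>)\<^sup>2) \<partial>lborel) \<and>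
        tendsto_zero_in_prob M
          (\<lambda>n \<omega>. ennreal \<bar>elementary_integral B (N n) (s n) (\<xi> n) \<omega> - I \<omega>\<bar>))"

text \<open>
  A continuous adapted solution of \<open>dP = P (\<mu> dt + \<sigma> dB)\<close>, \<open>P 0 = p\<close>, in integrated form:
  \<open>P t - p - \<integral>\<^sub>0\<^sup>t \<mu> P du = \<integral>\<^sub>0\<^sup>t \<sigma> P dB\<close> for every \<open>t \<ge> 0\<close>.
\<close>

definition geometric_brownian_motion ::
  "'a measure \<Rightarrow> (ennreal \<Rightarrow> 'a measure) \<Rightarrow> (real \<Rightarrow> 'a \<Rightarrow> real) \<Rightarrow> real \<Rightarrow> real \<Rightarrow> real \<Rightarrow>
     (real \<Rightarrow> 'a \<Rightarrow> real) \<Rightarrow> bool" where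
  "geometric_brownian_motion M F B \<mu> \<sigma> p P \<longleftrightarrow>
     (\<forall>t\<ge>0. P t \<in> borel_measurable (F (ennreal t))) \<and>
     (AE \<omega> in M. P 0 \<omega> = p) \<and>
     (AE \<omega> in M. continuous_on {0..} (\<lambda>t. P t \<omega>)) \<and>
     (\<forall>t\<ge>0. has_ito_integral M F B (\<lambda>u \<omega>. \<sigma> * P u \<omega>) t
        (\<lambda>\<omega>. P t \<omega> - p - (LINT u:{0..t}|lborel. \<mu> * P u \<omega>)))"

section \<open>Optimal stopping\<close>

definition stopped_at :: "(real \<Rightarrow> 'a \<Rightarrow> real) \<Rightarrow> ('a \<Rightarrow> ennreal) \<Rightarrow> 'a \<Rightarrow> real" where
  "stopped_at X \<tau> \<omega> =
     (if \<tau> \<omega> = \<infinity> then Lim at_top (\<lambda>t. X t \<omega>) else X (enn2real (\<tau> \<omega>)) \<omega>)"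

text \<open>The infimum of the empty set is \<open>\<infinity>\<close> in \<^typ>\<open>ennreal\<close>.\<close>

definition hitting_time :: "(real \<Rightarrow> 'a \<Rightarrow> real) \<Rightarrow> real set \<Rightarrow> 'a \<Rightarrow> ennreal" where
  "hitting_time X A \<omega> = Inf (ennreal ` {t. 0 \<le> t \<and> X t \<omega> \<in> A})"

definition stopping_value ::
  "'a measure \<Rightarrow> (ennreal \<Rightarrow> 'a measure) \<Rightarrow> (real \<Rightarrow> 'a \<Rightarrow> real) \<Rightarrow> (real \<Rightarrow> real) \<Rightarrow> real" where
  "stopping_value M F X g =
     (SUP \<tau>\<in>{\<tau>. stopping_time F \<tau>}. \<integral>\<omega>. g (stopped_at X \<tau> \<omega>) \<partial>M)"

text \<open>
  Integrability of all payoffs and the comparison with all competitors are stated explicitly, so that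
  optimality does not rest on the default values of non-existing integrals and suprema.
\<close>

definition optimal_stopping_time ::
  "'a measure \<Rightarrow> (ennreal \<Rightarrow> 'a measure) \<Rightarrow> (real \<Rightarrow> 'a \<Rightarrow> real) \<Rightarrow> (real \<Rightarrow> real) \<Rightarrow>
     ('a \<Rightarrow> ennreal) \<Rightarrow> bool" where
  "optimal_stopping_time M F X g \<tau> \<longleftrightarrow>
     stopping_time F \<tau> \<and>
     (\<forall>\<nu>. stopping_time F \<nu> \<longrightarrow> integrable M (\<lambda>\<omega>. g (stopped_at X \<nu> \<omega>)) \<and>
        (\<integral>\<omega>. g (stopped_at X \<nu> \<omega>) \<partial>M) \<le> (\<integral>\<omega>. g (stopped_at X \<tau> \<omega>) \<partial>M)) \<and>
     (\<integral>\<omega>. g (stopped_at X \<tau> \<omega>) \<partial>M) = stopping_value M F X g"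

section \<open>The exit and the entry problem\<close>

text \<open>
  The letter \<open>l\<close> stands for \<open>\<lambda>\<close>. The argument \<open>P\<close> is a family of processes; \<open>P p\<close> is the price started
  from \<open>P\<^sub>0 = p\<close>, so that integrals over functions of \<open>P p\<close> are the expectations given \<open>P\<^sub>0 = p\<close>.
\<close>

definition utility :: "real \<Rightarrow> real \<Rightarrow> real \<Rightarrow> real" where
  "utility \<alpha> k x = (if x > 0 then x powr \<alpha> else - k * \<bar>x\<bar> powr \<alpha>)"

text \<open>
  The second branch is \<open>V\<^sub>1(0; H) = U(-H)\<close>; its extension to negative prices is immaterial.
\<close>

definition exit_value ::
  "'a measure \<Rightarrow> (ennreal \<Rightarrow> 'a measure) \<Rightarrow> (real \<Rightarrow> real \<Rightarrow> 'a \<Rightarrow> real) \<Rightarrow>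
     real \<Rightarrow> real \<Rightarrow> real \<Rightarrow> real \<Rightarrow> real \<Rightarrow> real" where
  "exit_value M F P \<alpha> k \<gamma> p H =
     (if p > 0 then stopping_value M F (P p) (\<lambda>x. utility \<alpha> k (\<gamma> * x - H))
      else utility \<alpha> k (- H))"

definition entry_payoff ::
  "'a measure \<Rightarrow> (ennreal \<Rightarrow> 'a measure) \<Rightarrow> (real \<Rightarrow> real \<Rightarrow> 'a \<Rightarrow> real) \<Rightarrow>
     real \<Rightarrow> real \<Rightarrow> real \<Rightarrow> real \<Rightarrow> real \<Rightarrow> real \<Rightarrow> real \<Rightarrow> real" where
  "entry_payoff M F P \<alpha> k \<gamma> l \<Psi> R p =
     max (exit_value M F P \<alpha> k \<gamma> p (l * p + \<Psi> + R)) (utility \<alpha> k (- R))"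

definition entry_value ::
  "'a measure \<Rightarrow> (ennreal \<Rightarrow> 'a measure) \<Rightarrow> (real \<Rightarrow> real \<Rightarrow> 'a \<Rightarrow> real) \<Rightarrow>
     real \<Rightarrow> real \<Rightarrow> real \<Rightarrow> real \<Rightarrow> real \<Rightarrow> real \<Rightarrow> real \<Rightarrow> real" where
  "entry_value M F P \<alpha> k \<gamma> l \<Psi> R p =
     stopping_value M F (P p) (entry_payoff M F P \<alpha> k \<gamma> l \<Psi> R)"

definition optimal_entry_time ::
  "'a measure \<Rightarrow> (ennreal \<Rightarrow> 'a measure) \<Rightarrow> (real \<Rightarrow> real \<Rightarrow> 'a \<Rightarrow> real) \<Rightarrow>
     real \<Rightarrow> real \<Rightarrow> real \<Rightarrow> real \<Rightarrow> real \<Rightarrow> real \<Rightarrow> real \<Rightarrow> ('a \<Rightarrow> ennreal) \<Rightarrow> bool" where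
  "optimal_entry_time M F P \<alpha> k \<gamma> l \<Psi> R p \<tau> \<longleftrightarrow>
     optimal_stopping_time M F (P p) (entry_payoff M F P \<alpha> k \<gamma> l \<Psi> R) \<tau>"

definition W :: "real \<Rightarrow> real \<Rightarrow> real \<Rightarrow> real \<Rightarrow> real \<Rightarrow> real \<Rightarrow> real \<Rightarrow> real \<Rightarrow> real" where
  "W \<alpha> k \<gamma> c l \<Psi> R p =
     \<alpha> * (c - 1) powr (\<alpha> - 1) * (l * p + \<Psi> + R) powr (\<alpha> - 1) * \<gamma> * p
       - k * (l * p + \<Psi> + R) powr \<alpha>"

definition threshold_equation ::
  "real \<Rightarrow> real \<Rightarrow> real \<Rightarrow> real \<Rightarrow> real \<Rightarrow> real \<Rightarrow> real \<Rightarrow> real \<Rightarrow> bool" where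
  "threshold_equation \<alpha> k \<gamma> c l \<Psi> R x \<longleftrightarrow>
     k = (1 + \<Psi> / R) powr \<alpha> *
       ((k * (l / \<gamma> * x + 1) * (l / \<gamma> * (1 - \<alpha>) * x + 1)
           - \<alpha> * (c - 1) powr (\<alpha> - 1) * (l / \<gamma>) * (1 - \<alpha>) * x\<^sup>2)
         / (l / \<gamma> * x + 1) powr (2 - \<alpha>))"

definition smallest_threshold_root ::
  "real \<Rightarrow> real \<Rightarrow> real \<Rightarrow> real \<Rightarrow> real \<Rightarrow> real \<Rightarrow> real \<Rightarrow> real \<Rightarrow> bool" where
  "smallest_threshold_root \<alpha> k \<gamma> c l \<Psi> R x \<longleftrightarrow>
     0 \<le> x \<and> threshold_equation \<alpha> k \<gamma> c l \<Psi> R x \<and>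
     (\<forall>y\<ge>0. threshold_equation \<alpha> k \<gamma> c l \<Psi> R y \<longrightarrow> x \<le> y)"

end

theory Submission
  imports Defs
begin

text \<open>
  For \<open>\<mu> = 0\<close> the price is the martingale \<open>p exp (\<sigma> B\<^sub>t - \<sigma>\<^sup>2 t / 2)\<close>: by Lenglart's inequality the Euler scheme
  of the stochastic equation converges in probability to the given solution, by an explicit second
  moment computation it also converges to the exponential martingale, and a discrete Gronwall argument
  shows that both limits agree. Hence the price is positive, tends to \<open>0\<close> (the exponential martingale
  with half the volatility is bounded), and \<open>E P\<^sub>\<tau> \<le> p\<close> for every stopping time, with equality if the
  price is bounded up to \<open>\<tau>\<close>.

  A payoff below an affine function \<open>a + b x\<close> with \<open>b \<ge> 0\<close> therefore has value at most \<open>a + b p\<close>. In the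
  exit problem the right affine function is the tangent from \<open>(0, U (- H))\<close> to the utility, which touches
  at \<open>\<gamma> x = c H\<close>; at \<open>H = \<lambda> p + \<Psi> + R\<close> the price is always below this point, so the exit value is \<open>W\<close>. In
  the entry problem it is a tangent of \<open>W\<close>: at \<open>p\<close> itself, at the contact point of the tangent from
  \<open>(0, - k R\<^sup>\<alpha>)\<close>, or at the maximum of \<open>W\<close>. The intercept \<open>W p - p W' p\<close> increases where \<open>W\<close> is concave, and
  the threshold equation says that it equals \<open>- k R\<^sup>\<alpha>\<close>.
\<close>

section \<open>Brownian increments and exponential martingales\<close>

text \<open>The price is only given as an adapted continuous solution of an equation whose integral
  is a limit in probability. Finiteness of its moments is not part of the data, so the isometry
  cannot be applied to it directly; this is why the comparison with the exponential martingale runs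
  through probabilities and truncated second moments. Its outcome concerns almost all paths only,
  and completeness together with the null sets in \<open>F 0\<close> transfers measurability to
  \<open>stopped_at\<close> and to hitting times. The equation for \<open>c\<close> says that, for
  \<open>H = 1\<close>, the tangent to the utility at \<open>c\<close> passes through
  \<open>(0, - k)\<close>. The constant \<open>C\<close> comes from homogeneity: with
  \<open>D = \<Psi> + R\<close> the maximum of \<open>W\<close> is \<open>D powr \<alpha>\<close>
  times its value at \<open>D = 1\<close>, so comparing it with \<open>- k * R powr \<alpha>\<close>
  involves \<open>\<Psi> / R\<close> only. The three cases are three shapes of \<open>W\<close>:
  concave on the whole half-line with tangent intercepts rising to \<open>0\<close>; increasing and
  concave up to an interior maximum and decreasing afterwards; decreasing from the origin
  on.\<close>

lemma (in complete_measure) measurable_AE_cong: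
  fixes f g :: "'a \<Rightarrow> real"
  assumes f: "f \<in> borel_measurable M" and AE: "AE \<omega> in M. f \<omega> = g \<omega>"
  shows "g \<in> borel_measurable M"
proof (rule measurableI)
  fix A :: "real set" assume A: "A \<in> sets borel"
  show "g -` A \<inter> space M \<in> sets M"
    by (rule in_sets_AE[OF _ measurable_sets[OF f A]]) (use AE in auto)
qed simp

lemma (in complete_measure) integrable_AE_cong:
  fixes f g :: "'a \<Rightarrow> real"
  assumes f: "integrable M f" and AE: "AE \<omega> in M. f \<omega> = g \<omega>"
  shows "integrable M g"
  using f AE measurable_AE_cong[OF _ AE] integrable_cong_AE[of f M g] by auto

text \<open>Completing the square: exponential tilting of a centred Gaussian only shifts its mean,
  by \<open>r * \<sigma>\<^sup>2\<close>, so exponential moments of increments are read off from a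
  normalised density.\<close>

lemma exp_times_normal_density:
  assumes "\<sigma> > 0"
  shows "exp (r * x) * normal_density 0 \<sigma> x = exp (r\<^sup>2 * \<sigma>\<^sup>2 / 2) * normal_density (r * \<sigma>\<^sup>2) \<sigma> x"
proof -
  have "r * x + (- (x - 0)\<^sup>2 / (2 * \<sigma>\<^sup>2)) = r\<^sup>2 * \<sigma>\<^sup>2 / 2 + (- (x - r * \<sigma>\<^sup>2)\<^sup>2 / (2 * \<sigma>\<^sup>2))"
    using assms by (simp add: field_simps power2_eq_square)
  then have "exp (r * x) * exp (- (x - 0)\<^sup>2 / (2 * \<sigma>\<^sup>2)) = exp (r\<^sup>2 * \<sigma>\<^sup>2 / 2) * exp (- (x - r * \<sigma>\<^sup>2)\<^sup>2 / (2 * \<sigma>\<^sup>2))"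
    by (metis exp_add)
  then show ?thesis
    unfolding normal_density_def by (simp add: field_simps)
qed

locale brownian_space =
  fixes M :: "'a measure" and F :: "ennreal \<Rightarrow> 'a measure" and B :: "real \<Rightarrow> 'a \<Rightarrow> real"
  assumes usual: "usual_filtered_space M F"
    and bm: "brownian_motion M F B"
begin

sublocale prob_space M
  using usual by (simp add: usual_filtered_space_def)

sublocale complete_measure M
  using usual by (simp add: usual_filtered_space_def)

sublocale filtration "space M" F
  using usual by (simp add: usual_filtered_space_def)

lemma sets_F_subset: "sets (F t) \<subseteq> sets M"
  using usual by (simp add: usual_filtered_space_def)

lemma null_sets_in_F: "N \<in> null_sets M \<Longrightarrow> N \<in> sets (F t)"
proof -
  assume N: "N \<in> null_sets M"
  have "null_sets M \<subseteq> sets (F 0)"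
    using usual unfolding usual_filtered_space_def by (elim conjE)
  then show ?thesis
    using N sets_F_mono[of 0 t] by (meson subsetD zero_le)
qed

lemma F_measurable_mono:
  "f \<in> measurable (F s) N \<Longrightarrow> s \<le> t \<Longrightarrow> f \<in> measurable (F t) N"
  using sets_F_mono[of s t] by (auto simp: measurable_def space_F)

lemma F_measurable: "f \<in> measurable (F s) N \<Longrightarrow> f \<in> measurable M N"
  using sets_F_subset[of s] by (auto simp: measurable_def space_F)

text \<open>Both differences are null sets, and \<open>F 0\<close> contains all of these. Hitting
  times need this, because their events have a countable description along regular paths
  only.\<close>

lemma sets_F_AE_cong:
  assumes A: "A \<in> sets (F t)" and AE: "AE \<omega> in M. \<omega> \<in> A \<longleftrightarrow> \<omega> \<in> C" and C: "C \<subseteq> space M"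
  shows "C \<in> sets (F t)"
proof -
  have N: "{\<omega> \<in> space M. \<not> (\<omega> \<in> A \<longleftrightarrow> \<omega> \<in> C)} \<in> null_sets M"
    using AE by (simp add: AE_iff_null_sets)
  have "A - C \<in> null_sets M" "C - A \<in> null_sets M"
    using A C sets_F_subset[of t] sets.sets_into_space[of A M]
    by (auto intro!: complete2[OF _ N])
  then have "A - C \<in> sets (F t)" "C - A \<in> sets (F t)"
    by (auto intro: null_sets_in_F)
  then have "(A - (A - C)) \<union> (C - A) \<in> sets (F t)"
    using A by auto
  also have "(A - (A - C)) \<union> (C - A) = C" by auto
  finally show ?thesis .
qed

lemma AE_B_continuous: "AE \<omega> in M. continuous_on {0..} (\<lambda>t. B t \<omega>)"
  using bm by (simp add: brownian_motion_def)

lemma AE_B_0: "AE \<omega> in M. B 0 \<omega> = 0"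
  using bm by (simp add: brownian_motion_def)

lemma B_F_measurable: "0 \<le> t \<Longrightarrow> B t \<in> borel_measurable (F (ennreal t))"
  using bm by (simp add: brownian_motion_def)

lemma B_measurable: "0 \<le> t \<Longrightarrow> B t \<in> borel_measurable M"
  using B_F_measurable F_measurable by blast

lemma increment_distributed:
  "0 \<le> s \<Longrightarrow> s < t \<Longrightarrow>
     distributed M lborel (\<lambda>\<omega>. B t \<omega> - B s \<omega>) (normal_density 0 (sqrt (t - s)))"
  using bm by (simp add: brownian_motion_def)

text \<open>The sigma-algebras generated by the two variables lie inside the two that are
  independent by the definition of Brownian motion. A general \<open>h\<close> is kept because
  squares, exponentials and Taylor remainders of increments all occur.\<close>

lemma increment_indep_var:
  assumes st: "0 \<le> s" "s < t" and Z: "Z \<in> borel_measurable (F (ennreal s))"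
    and h: "h \<in> borel_measurable borel"
  shows "indep_var borel Z borel (\<lambda>\<omega>. h (B t \<omega> - B s \<omega>) :: real)"
proof -
  have BM: "(\<lambda>\<omega>. B t \<omega> - B s \<omega>) \<in> borel_measurable M"
    using st by (auto intro!: borel_measurable_diff B_measurable)
  have ind: "indep_set (sets (F (ennreal s)))
          (sets (vimage_algebra (space M) (\<lambda>\<omega>. B t \<omega> - B s \<omega>) borel))"
    using bm st by (simp add: brownian_motion_def)
  have 1: "sigma_sets (space M) {Z -` A \<inter> space M |A. A \<in> sets borel} \<subseteq> sets (F (ennreal s))"
    using measurable_sets[OF Z] by (intro sets.sigma_sets_subset[of _ "F (ennreal s)", simplified space_F]) (auto simp: space_F)
  have 2: "sigma_sets (space M) {(\<lambda>\<omega>. h (B t \<omega> - B s \<omega>)) -` A \<inter> space M |A. A \<in> sets borel}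
      \<subseteq> sets (vimage_algebra (space M) (\<lambda>\<omega>. B t \<omega> - B s \<omega>) borel)"
  proof (rule sets.sigma_sets_subset[of _ "vimage_algebra (space M) (\<lambda>\<omega>. B t \<omega> - B s \<omega>) borel", simplified])
    show "{(\<lambda>\<omega>. h (B t \<omega> - B s \<omega>)) -` A \<inter> space M |A. A \<in> sets borel}
      \<subseteq> sets (vimage_algebra (space M) (\<lambda>\<omega>. B t \<omega> - B s \<omega>) borel)"
    proof safe
      fix A :: "real set" assume A: "A \<in> sets borel"
      have "h -` A \<in> sets borel"
        using measurable_sets[OF h A] by simp
      then have "(\<lambda>\<omega>. B t \<omega> - B s \<omega>) -` (h -` A) \<inter> space M \<in> sets (vimage_algebra (space M) (\<lambda>\<omega>. B t \<omega> - B s \<omega>) borel)"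
        by (rule in_vimage_algebra)
      then show "(\<lambda>\<omega>. h (B t \<omega> - B s \<omega>)) -` A \<inter> space M \<in> sets (vimage_algebra (space M) (\<lambda>\<omega>. B t \<omega> - B s \<omega>) borel)"
        by (simp add: vimage_def)
    qed
  qed
  have 3: "indep_set (sigma_sets (space M) {Z -` A \<inter> space M |A. A \<in> sets borel})
        (sigma_sets (space M) {(\<lambda>\<omega>. h (B t \<omega> - B s \<omega>)) -` A \<inter> space M |A. A \<in> sets borel})"
    using ind 1 2 unfolding indep_set_def
    by (elim indep_sets_mono_sets) (auto split: bool.split)
  have hB: "(\<lambda>\<omega>. h (B t \<omega> - B s \<omega>)) \<in> borel_measurable M"
    using measurable_compose[OF BM h] .
  show ?thesis
    unfolding indep_var_eq using 3 hB F_measurable[OF Z] by auto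
qed

lemma increment_product:
  assumes st: "0 \<le> s" "s \<le> t" and Z: "Z \<in> borel_measurable (F (ennreal s))" "integrable M Z"
    and h: "h \<in> borel_measurable borel" "integrable M (\<lambda>\<omega>. h (B t \<omega> - B s \<omega>))"
  shows "integrable M (\<lambda>\<omega>. Z \<omega> * h (B t \<omega> - B s \<omega>) :: real)"
    and "expectation (\<lambda>\<omega>. Z \<omega> * h (B t \<omega> - B s \<omega>)) = expectation Z * expectation (\<lambda>\<omega>. h (B t \<omega> - B s \<omega>))"
proof -
  have "integrable M (\<lambda>\<omega>. Z \<omega> * h (B t \<omega> - B s \<omega>) :: real) \<and> expectation (\<lambda>\<omega>. Z \<omega> * h (B t \<omega> - B s \<omega>)) = expectation Z * expectation (\<lambda>\<omega>. h (B t \<omega> - B s \<omega>))"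
  proof (cases "s = t")
    \<comment> \<open>Independence is given for \<open>s < t\<close> only; at \<open>s = t\<close>
      the second factor is the constant \<open>h 0\<close>.\<close>
    case True then show ?thesis using Z by (simp add: prob_space)
  next
    case False
    then have "indep_var borel Z borel (\<lambda>\<omega>. h (B t \<omega> - B s \<omega>) :: real)"
      using st Z h by (intro increment_indep_var) auto
    then show ?thesis
      using indep_var_integrable[of Z "\<lambda>\<omega>. h (B t \<omega> - B s \<omega>)"]
        indep_var_lebesgue_integral[of Z "\<lambda>\<omega>. h (B t \<omega> - B s \<omega>)"] Z h by auto
  qed
  then show "integrable M (\<lambda>\<omega>. Z \<omega> * h (B t \<omega> - B s \<omega>) :: real)"
    "expectation (\<lambda>\<omega>. Z \<omega> * h (B t \<omega> - B s \<omega>)) = expectation Z * expectation (\<lambda>\<omega>. h (B t \<omega> - B s \<omega>))"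
    by auto
qed

text \<open>The mixed moment comes from the mean of the tilted Gaussian. It supplies the cross term
  in \<open>exp_mart_remainder_moments\<close>, and at \<open>r = 0\<close> it is the mean of the
  increment.\<close>

lemma increment_moments:
  assumes st: "0 \<le> s" "s \<le> t"
  shows "has_bochner_integral M (\<lambda>\<omega>. exp (r * (B t \<omega> - B s \<omega>))) (exp (r\<^sup>2 * (t - s) / 2))"
    and "has_bochner_integral M (\<lambda>\<omega>. (B t \<omega> - B s \<omega>) * exp (r * (B t \<omega> - B s \<omega>))) (r * (t - s) * exp (r\<^sup>2 * (t - s) / 2))"
    and "has_bochner_integral M (\<lambda>\<omega>. (B t \<omega> - B s \<omega>)\<^sup>2) (t - s)"
proof -
  have "has_bochner_integral M (\<lambda>\<omega>. exp (r * (B t \<omega> - B s \<omega>))) (exp (r\<^sup>2 * (t - s) / 2)) \<and>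
    has_bochner_integral M (\<lambda>\<omega>. (B t \<omega> - B s \<omega>) * exp (r * (B t \<omega> - B s \<omega>))) (r * (t - s) * exp (r\<^sup>2 * (t - s) / 2)) \<and>
    has_bochner_integral M (\<lambda>\<omega>. (B t \<omega> - B s \<omega>)\<^sup>2) (t - s)"
  proof (cases "s = t")
    case True then show ?thesis
      by (simp add: has_bochner_integral_iff prob_space)
  next
    case False
    define v where "v = sqrt (t - s)"
    have v: "v > 0" "v\<^sup>2 = t - s" using False st by (auto simp: v_def)
    have D: "distributed M lborel (\<lambda>\<omega>. B t \<omega> - B s \<omega>) (normal_density 0 v)"
      unfolding v_def using False st by (intro increment_distributed) auto
    have transfer: "has_bochner_integral M (\<lambda>\<omega>. g (B t \<omega> - B s \<omega>)) i"
      if g: "g \<in> borel_measurable borel" and i: "has_bochner_integral lborel (\<lambda>x. normal_density 0 v x * g x) i" for g :: "real \<Rightarrow> real" and i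
      using distributed_integrable[OF D, of g] distributed_integral[OF D, of g] g i
      by (auto simp: has_bochner_integral_iff)
    have e: "normal_density 0 v x * exp (r * x) = exp (r\<^sup>2 * v\<^sup>2 / 2) * normal_density (r * v\<^sup>2) v x" for x
      using exp_times_normal_density[of v r x] v by (simp add: mult.commute)
    have "has_bochner_integral lborel (\<lambda>x. exp (r\<^sup>2 * v\<^sup>2 / 2) * normal_density (r * v\<^sup>2) v x) (exp (r\<^sup>2 * v\<^sup>2 / 2) * 1)"
      using v by (intro has_bochner_integral_mult_right) (auto simp: has_bochner_integral_iff)
    then have 1: "has_bochner_integral M (\<lambda>\<omega>. exp (r * (B t \<omega> - B s \<omega>))) (exp (r\<^sup>2 * (t - s) / 2))"
      by (intro transfer) (auto simp: e v)
    have "has_bochner_integral lborel (\<lambda>x. exp (r\<^sup>2 * v\<^sup>2 / 2) * (normal_density (r * v\<^sup>2) v x * x)) (exp (r\<^sup>2 * v\<^sup>2 / 2) * (r * v\<^sup>2))"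
      using v by (intro has_bochner_integral_mult_right normal_moment_nz_1)
    moreover have "normal_density 0 v x * (x * exp (r * x)) = exp (r\<^sup>2 * v\<^sup>2 / 2) * (normal_density (r * v\<^sup>2) v x * x)" for x
      using arg_cong[OF e[of x], of "\<lambda>y. y * x"] by (simp add: mult_ac)
    ultimately have "has_bochner_integral lborel (\<lambda>x. normal_density 0 v x * (x * exp (r * x))) (exp (r\<^sup>2 * v\<^sup>2 / 2) * (r * v\<^sup>2))"
      by (simp only:)
    from transfer[OF _ this] have 2: "has_bochner_integral M (\<lambda>\<omega>. (B t \<omega> - B s \<omega>) * exp (r * (B t \<omega> - B s \<omega>))) (r * (t - s) * exp (r\<^sup>2 * (t - s) / 2))"
      by (simp add: v mult_ac)
    have "has_bochner_integral lborel (\<lambda>x. normal_density 0 v x * x\<^sup>2) (v\<^sup>2)"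
      using normal_moment_even[of v 0 1] v by (simp add: fact_numeral diff_divide_distrib)
    then have 3: "has_bochner_integral M (\<lambda>\<omega>. (B t \<omega> - B s \<omega>)\<^sup>2) (t - s)"
      using v by (intro transfer) auto
    show ?thesis using 1 2 3 by auto
  qed
  then show "has_bochner_integral M (\<lambda>\<omega>. exp (r * (B t \<omega> - B s \<omega>))) (exp (r\<^sup>2 * (t - s) / 2))"
    "has_bochner_integral M (\<lambda>\<omega>. (B t \<omega> - B s \<omega>) * exp (r * (B t \<omega> - B s \<omega>))) (r * (t - s) * exp (r\<^sup>2 * (t - s) / 2))"
    "has_bochner_integral M (\<lambda>\<omega>. (B t \<omega> - B s \<omega>)\<^sup>2) (t - s)"
    by auto
qed

lemma increment_mean:
  assumes "0 \<le> s" "s \<le> t"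
  shows "has_bochner_integral M (\<lambda>\<omega>. B t \<omega> - B s \<omega>) 0"
  using increment_moments(2)[OF assms, of 0] by simp

text \<open>The stochastic exponential of \<open>r * B\<close>. The volatility is a parameter
  because three values occur: \<open>\<sigma>\<close> for the price, \<open>2 * \<sigma>\<close> for
  its second moment and \<open>\<sigma> / 2\<close> for its decay.\<close>

definition exp_mart :: "real \<Rightarrow> real \<Rightarrow> 'a \<Rightarrow> real" where
  "exp_mart r t \<omega> = exp (r * B t \<omega> - r\<^sup>2 * t / 2)"

lemma exp_mart_pos: "exp_mart r t \<omega> > 0"
  by (simp add: exp_mart_def)

lemma exp_mart_F_measurable: "0 \<le> t \<Longrightarrow> exp_mart r t \<in> borel_measurable (F (ennreal t))"
  unfolding exp_mart_def using B_F_measurable[of t] by measurable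

lemma exp_mart_measurable: "0 \<le> t \<Longrightarrow> exp_mart r t \<in> borel_measurable M"
  using exp_mart_F_measurable F_measurable by blast

lemma exp_mart_step:
  "exp_mart r t \<omega> = exp_mart r s \<omega> * (exp (r * (B t \<omega> - B s \<omega>)) * exp (- (r\<^sup>2 * (t - s) / 2)))"
  by (simp add: exp_mart_def exp_add[symmetric] algebra_simps diff_divide_distrib)

lemma exp_mart_expectation: "0 \<le> t \<Longrightarrow> has_bochner_integral M (exp_mart r t) 1"
proof -
  assume t: "0 \<le> t"
  have *: "has_bochner_integral M (\<lambda>\<omega>. exp (r * (B t \<omega> - B 0 \<omega>)) * exp (- (r\<^sup>2 * t / 2))) (exp (r\<^sup>2 * (t-0) / 2) *  exp (- (r\<^sup>2 * t / 2)))"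
    using t by (intro has_bochner_integral_mult_left increment_moments) auto
  have "has_bochner_integral M (exp_mart r t) (exp (r\<^sup>2 * (t-0) / 2) *  exp (- (r\<^sup>2 * t / 2)))"
    by (rule has_bochner_integralI_AE[OF *])
      (use exp_mart_measurable[OF t] AE_B_0 in \<open>auto simp: exp_mart_def exp_add[symmetric]\<close>)
  then show ?thesis by (simp add: exp_add[symmetric])
qed

text \<open>The martingale property tested on events of the past, which is all that optional
  stopping needs: the factor after time \<open>s\<close> is independent of \<open>A\<close> and has
  mean one.\<close>

lemma exp_mart_indicator:
  assumes st: "0 \<le> s" "s \<le> t" and A: "A \<in> sets (F (ennreal s))"
  shows "integrable M (\<lambda>\<omega>. exp_mart r t \<omega> * indicator A \<omega>)"
    "expectation (\<lambda>\<omega>. exp_mart r t \<omega> * indicator A \<omega>) = expectation (\<lambda>\<omega>. exp_mart r s \<omega> * indicator A \<omega>)"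
proof -
  have AM: "A \<in> sets M" using A sets_F_subset by auto
  have Z: "(\<lambda>\<omega>. exp_mart r s \<omega> * indicator A \<omega>) \<in> borel_measurable (F (ennreal s))"
    using exp_mart_F_measurable[OF st(1), of r] A by measurable
  have Zi: "integrable M (\<lambda>\<omega>. exp_mart r s \<omega> * indicator A \<omega>)"
    using exp_mart_expectation[OF st(1), of r] AM
    by (intro integrable_mult_indicator[where 'b=real, simplified, simplified mult.commute]) (auto simp: has_bochner_integral_iff mult.commute)
  have h: "has_bochner_integral M (\<lambda>\<omega>. (\<lambda>x. exp (r * x) * exp (- (r\<^sup>2 * (t - s) / 2))) (B t \<omega> - B s \<omega>)) (exp (r\<^sup>2 * (t-s) / 2) *  exp (- (r\<^sup>2 * (t-s) / 2)))"
    using st by (intro has_bochner_integral_mult_left increment_moments) auto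
  have "(\<lambda>\<omega>. exp_mart r t \<omega> * indicator A \<omega>) = (\<lambda>\<omega>. (exp_mart r s \<omega> * indicator A \<omega>) * (\<lambda>x. exp (r * x) * exp (- (r\<^sup>2 * (t - s) / 2))) (B t \<omega> - B s \<omega>))"
    by (auto simp: exp_mart_step[of r t _ s])
  moreover note increment_product[OF st Z Zi, of "\<lambda>x. exp (r * x) * exp (- (r\<^sup>2 * (t - s) / 2))"]
  ultimately show "integrable M (\<lambda>\<omega>. exp_mart r t \<omega> * indicator A \<omega>)"
    "expectation (\<lambda>\<omega>. exp_mart r t \<omega> * indicator A \<omega>) = expectation (\<lambda>\<omega>. exp_mart r s \<omega> * indicator A \<omega>)"
    using h by (auto simp: has_bochner_integral_iff exp_add[symmetric])
qed

end

section \<open>Elementary integrals\<close>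

lemma partition_mono:
  fixes t :: "nat \<Rightarrow> real"
  assumes "\<And>i. i < n \<Longrightarrow> t i \<le> t (Suc i)" "i \<le> j" "j \<le> n"
  shows "t i \<le> t j"
  using assms(2,3) by (induction j rule: dec_induct) (auto intro: order_trans[OF _ assms(1)])

lemma square_integrable_mult:
  fixes f g :: "'a \<Rightarrow> real"
  assumes "f \<in> borel_measurable M" "g \<in> borel_measurable M"
    "integrable M (\<lambda>x. (f x)\<^sup>2)" "integrable M (\<lambda>x. (g x)\<^sup>2)"
  shows "integrable M (\<lambda>x. f x * g x)"
proof (rule Bochner_Integration.integrable_bound)
  show "integrable M (\<lambda>x. (f x)\<^sup>2 + (g x)\<^sup>2)" using assms by auto
  show "AE x in M. norm (f x * g x) \<le> norm ((f x)\<^sup>2 + (g x)\<^sup>2)"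
  proof (rule AE_I2)
    fix x
    have "0 \<le> (\<bar>f x\<bar> - \<bar>g x\<bar>)\<^sup>2" "0 \<le> \<bar>f x * g x\<bar>" by auto
    then have "\<bar>f x * g x\<bar> \<le> (f x)\<^sup>2 + (g x)\<^sup>2"
      unfolding power2_diff abs_mult by (simp only: power2_abs)
    then show "norm (f x * g x) \<le> norm ((f x)\<^sup>2 + (g x)\<^sup>2)" by simp
  qed
qed (use assms in measurable)

lemma (in prob_space) square_integrable_integrable:
  assumes "f \<in> borel_measurable M" "integrable M (\<lambda>x. (f x)\<^sup>2)"
  shows "integrable M (f :: _ \<Rightarrow> real)"
  using square_integrable_mult[of f M "\<lambda>_. 1"] assms by simp

lemma (in prob_space) prob_gt_le_second_moment:
  fixes f :: "'a \<Rightarrow> real"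
  assumes "f \<in> borel_measurable M" "integrable M (\<lambda>\<omega>. (f \<omega>)\<^sup>2)" "\<epsilon> > 0"
  shows "prob {\<omega> \<in> space M. \<bar>f \<omega>\<bar> > \<epsilon>} \<le> expectation (\<lambda>\<omega>. (f \<omega>)\<^sup>2) / \<epsilon>\<^sup>2"
proof -
  have "prob {\<omega> \<in> space M. \<bar>f \<omega>\<bar> > \<epsilon>} \<le> prob {\<omega> \<in> space M. \<bar>f \<omega>\<bar> \<ge> \<epsilon>}"
    using assms(1) by (intro finite_measure_mono) auto
  also have "\<dots> \<le> expectation (\<lambda>\<omega>. (f \<omega>)\<^sup>2) / \<epsilon>\<^sup>2"
    using assms by (intro second_moment_method) auto
  finally show ?thesis .
qed

text \<open>Orders the union of two partitions, or any finite set of times, into one strictly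
  increasing grid; \<open>lenglart\<close> needs cells of positive length.\<close>

lemma finite_set_enumeration:
  fixes A :: "real set"
  assumes "finite A" "A \<noteq> {}"
  obtains r :: "nat \<Rightarrow> real" and m where "r ` {..m} = A" "\<And>i. i < m \<Longrightarrow> r i < r (Suc i)"
    "r 0 = Min A" "r m = Max A"
proof -
  define xs where "xs = sorted_list_of_set A"
  have xs: "sorted_wrt (<) xs" "set xs = A" using assms unfolding xs_def by auto
  have "xs \<noteq> []" using xs assms by auto
  then have len: "length xs > 0" by simp
  define m where "m = length xs - 1"
  have lt: "xs ! i < xs ! j" if "i < j" "j \<le> m" for i j
    using sorted_wrt_nth_less[OF xs(1) that(1)] that len unfolding m_def by auto
  have im: "(\<lambda>i. xs ! i) ` {..m} = A"
  proof -
    have "{..m} = {0..<length xs}" using len unfolding m_def by (cases xs) auto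
    then show ?thesis using xs(2) by (auto simp: set_conv_nth)
  qed
  have le: "xs ! i \<le> xs ! j" if "i \<le> j" "j \<le> m" for i j
    using lt[of i j] that by (cases "i = j") auto
  show ?thesis
  proof
    show "(\<lambda>i. xs ! i) ` {..m} = A" by (rule im)
    show "xs ! i < xs ! Suc i" if "i < m" for i using lt that by auto
    show "xs ! 0 = Min A"
      using le by (intro Min_eqI[symmetric]) (auto simp: assms im[symmetric])
    show "xs ! m = Max A"
      using le by (intro Max_eqI[symmetric]) (auto simp: assms im[symmetric])
  qed
qed

section \<open>Sums of adapted coefficients times functions of Brownian increments\<close>

context brownian_space
begin

text \<open>When the square of a partial sum is expanded, the cross term contains the centred factor
  \<open>z m\<close>, which is independent of all that is known at \<open>t m\<close>, so it
  integrates to zero. With \<open>h\<close> the identity this is the Ito isometry; with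
  \<open>h\<close> the remainder of the exponential it controls the Euler scheme of
  \<open>exp_mart\<close>.\<close>

lemma orthogonal_increments:
  fixes t :: "nat \<Rightarrow> real" and a :: "nat \<Rightarrow> 'a \<Rightarrow> real" and h :: "nat \<Rightarrow> real \<Rightarrow> real"
  defines "z \<equiv> \<lambda>i \<omega>. h i (B (t (Suc i)) \<omega> - B (t i) \<omega>)"
  assumes t: "0 \<le> t 0" "\<And>i. i < n \<Longrightarrow> t i \<le> t (Suc i)"
    and a: "\<And>i. i < n \<Longrightarrow> a i \<in> borel_measurable (F (ennreal (t i)))"
      "\<And>i. i < n \<Longrightarrow> integrable M (\<lambda>\<omega>. (a i \<omega>)\<^sup>2)"
    and h: "\<And>i. i < n \<Longrightarrow> h i \<in> borel_measurable borel"
      "\<And>i. i < n \<Longrightarrow> integrable M (\<lambda>\<omega>. (z i \<omega>)\<^sup>2)"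
      "\<And>i. i < n \<Longrightarrow> expectation (z i) = 0"
  shows "(\<lambda>\<omega>. \<Sum>i<n. a i \<omega> * z i \<omega>) \<in> borel_measurable (F (ennreal (t n)))"
    "integrable M (\<lambda>\<omega>. (\<Sum>i<n. a i \<omega> * z i \<omega>)\<^sup>2)"
    "expectation (\<lambda>\<omega>. (\<Sum>i<n. a i \<omega> * z i \<omega>)\<^sup>2)
       = (\<Sum>i<n. expectation (\<lambda>\<omega>. (a i \<omega>)\<^sup>2) * expectation (\<lambda>\<omega>. (z i \<omega>)\<^sup>2))"
proof -
  have "(\<lambda>\<omega>. \<Sum>i<m. a i \<omega> * z i \<omega>) \<in> borel_measurable (F (ennreal (t m))) \<and>
    integrable M (\<lambda>\<omega>. (\<Sum>i<m. a i \<omega> * z i \<omega>)\<^sup>2) \<and>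
    expectation (\<lambda>\<omega>. (\<Sum>i<m. a i \<omega> * z i \<omega>)\<^sup>2)
       = (\<Sum>i<m. expectation (\<lambda>\<omega>. (a i \<omega>)\<^sup>2) * expectation (\<lambda>\<omega>. (z i \<omega>)\<^sup>2))" if "m \<le> n" for m
    using that
  proof (induction m)
    case 0 show ?case by simp
  next
    case (Suc m)
    define Y where "Y = (\<lambda>\<omega>. \<Sum>i<m. a i \<omega> * z i \<omega>)"
    have m: "m < n" using Suc by simp
    have Y: "Y \<in> borel_measurable (F (ennreal (t m)))" "integrable M (\<lambda>\<omega>. (Y \<omega>)\<^sup>2)"
      "expectation (\<lambda>\<omega>. (Y \<omega>)\<^sup>2) = (\<Sum>i<m. expectation (\<lambda>\<omega>. (a i \<omega>)\<^sup>2) * expectation (\<lambda>\<omega>. (z i \<omega>)\<^sup>2))"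
      using Suc unfolding Y_def by auto
    have tm: "0 \<le> t m" "t m \<le> t (Suc m)" using partition_mono[of n t 0 m] t m by auto
    have am: "a m \<in> borel_measurable (F (ennreal (t m)))" using a m by auto
    have zF: "z m \<in> borel_measurable (F (ennreal (t (Suc m))))"
    proof -
      have "B (t m) \<in> borel_measurable (F (ennreal (t (Suc m))))"
        using F_measurable_mono[OF B_F_measurable[OF tm(1)], of "ennreal (t (Suc m))"] tm by (simp add: ennreal_leI)
      moreover have "B (t (Suc m)) \<in> borel_measurable (F (ennreal (t (Suc m))))"
        using B_F_measurable[of "t (Suc m)"] tm by simp
      ultimately show ?thesis
        unfolding z_def by (intro measurable_compose[OF _ h(1)[OF m]]) simp
    qed
    have YM: "Y \<in> borel_measurable M" "a m \<in> borel_measurable M" "z m \<in> borel_measurable M"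
      using Y am zF F_measurable by blast+
    have zi: "integrable M (z m)"
      using square_integrable_integrable[OF YM(3) h(2)[OF m]] .
    have "(\<lambda>\<omega>. Y \<omega> * a m \<omega>) \<in> borel_measurable (F (ennreal (t m)))"
      using Y am by simp
    from increment_product[OF tm this square_integrable_mult[OF YM(1,2) Y(2) a(2)[OF m]] h(1)[OF m]]
    have c1: "integrable M (\<lambda>\<omega>. Y \<omega> * a m \<omega> * z m \<omega>)" "expectation (\<lambda>\<omega>. Y \<omega> * a m \<omega> * z m \<omega>) = 0"
      using zi h(3)[OF m] by (auto simp: z_def)
    have "(\<lambda>\<omega>. (a m \<omega>)\<^sup>2) \<in> borel_measurable (F (ennreal (t m)))"
      using am by simp
    from increment_product[OF tm this a(2)[OF m], of "\<lambda>x. (h m x)\<^sup>2"]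
    have c2: "integrable M (\<lambda>\<omega>. (a m \<omega>)\<^sup>2 * (z m \<omega>)\<^sup>2)"
      "expectation (\<lambda>\<omega>. (a m \<omega>)\<^sup>2 * (z m \<omega>)\<^sup>2) = expectation (\<lambda>\<omega>. (a m \<omega>)\<^sup>2) * expectation (\<lambda>\<omega>. (z m \<omega>)\<^sup>2)"
      using h(2)[OF m] h(1)[OF m] by (auto simp: z_def)
    have eq: "(\<lambda>\<omega>. (\<Sum>i<Suc m. a i \<omega> * z i \<omega>)\<^sup>2) = (\<lambda>\<omega>. (Y \<omega>)\<^sup>2 + 2 * (Y \<omega> * a m \<omega> * z m \<omega>) + (a m \<omega>)\<^sup>2 * (z m \<omega>)\<^sup>2)"
      by (auto simp: Y_def power2_eq_square algebra_simps)
    have "Y \<in> borel_measurable (F (ennreal (t (Suc m))))" "a m \<in> borel_measurable (F (ennreal (t (Suc m))))"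
      using F_measurable_mono[OF Y(1)] F_measurable_mono[OF am] tm by (auto simp: ennreal_leI)
    then have "(\<lambda>\<omega>. Y \<omega> + a m \<omega> * z m \<omega>) \<in> borel_measurable (F (ennreal (t (Suc m))))"
      using zF by simp
    then show ?case
      unfolding eq using c1 c2 Y(2,3) by (simp add: Y_def)
  qed
  from this[of n] show "(\<lambda>\<omega>. \<Sum>i<n. a i \<omega> * z i \<omega>) \<in> borel_measurable (F (ennreal (t n)))"
    "integrable M (\<lambda>\<omega>. (\<Sum>i<n. a i \<omega> * z i \<omega>)\<^sup>2)"
    "expectation (\<lambda>\<omega>. (\<Sum>i<n. a i \<omega> * z i \<omega>)\<^sup>2)
       = (\<Sum>i<n. expectation (\<lambda>\<omega>. (a i \<omega>)\<^sup>2) * expectation (\<lambda>\<omega>. (z i \<omega>)\<^sup>2))" by auto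
qed

lemma ito_isometry:
  fixes t :: "nat \<Rightarrow> real" and a :: "nat \<Rightarrow> 'a \<Rightarrow> real"
  assumes t: "0 \<le> t 0" "\<And>i. i < n \<Longrightarrow> t i \<le> t (Suc i)"
    and a: "\<And>i. i < n \<Longrightarrow> a i \<in> borel_measurable (F (ennreal (t i)))"
      "\<And>i. i < n \<Longrightarrow> integrable M (\<lambda>\<omega>. (a i \<omega>)\<^sup>2)"
  shows "(\<lambda>\<omega>. \<Sum>i<n. a i \<omega> * (B (t (Suc i)) \<omega> - B (t i) \<omega>)) \<in> borel_measurable M"
    "integrable M (\<lambda>\<omega>. (\<Sum>i<n. a i \<omega> * (B (t (Suc i)) \<omega> - B (t i) \<omega>))\<^sup>2)"
    "expectation (\<lambda>\<omega>. (\<Sum>i<n. a i \<omega> * (B (t (Suc i)) \<omega> - B (t i) \<omega>))\<^sup>2)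
       = (\<Sum>i<n. expectation (\<lambda>\<omega>. (a i \<omega>)\<^sup>2) * (t (Suc i) - t i))"
proof -
  have 0: "0 \<le> t i" "t i \<le> t (Suc i)" if "i < n" for i
    using partition_mono[of n t 0 i] t that by auto
  have "integrable M (\<lambda>\<omega>. (B (t (Suc i)) \<omega> - B (t i) \<omega>)\<^sup>2)"
    "expectation (\<lambda>\<omega>. (B (t (Suc i)) \<omega> - B (t i) \<omega>)\<^sup>2) = t (Suc i) - t i"
    "expectation (\<lambda>\<omega>. B (t (Suc i)) \<omega> - B (t i) \<omega>) = 0" if "i < n" for i
    using increment_moments(3)[OF 0[OF that]] increment_mean[OF 0[OF that]] by (auto simp: has_bochner_integral_iff)
  note * = this
  have "(\<lambda>x. x) \<in> borel_measurable (borel::real measure)" by simp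
  note ** = orthogonal_increments[of t n a "\<lambda>_ x. x", OF t a this *(1) *(3)]
  show "(\<lambda>\<omega>. \<Sum>i<n. a i \<omega> * (B (t (Suc i)) \<omega> - B (t i) \<omega>)) \<in> borel_measurable M"
    using **(1) F_measurable by blast
  show "integrable M (\<lambda>\<omega>. (\<Sum>i<n. a i \<omega> * (B (t (Suc i)) \<omega> - B (t i) \<omega>))\<^sup>2)"
    using ** by blast
  show "expectation (\<lambda>\<omega>. (\<Sum>i<n. a i \<omega> * (B (t (Suc i)) \<omega> - B (t i) \<omega>))\<^sup>2)
       = (\<Sum>i<n. expectation (\<lambda>\<omega>. (a i \<omega>)\<^sup>2) * (t (Suc i) - t i))"
    using **(3) *(2) by simp
qed

text \<open>The integrand is switched off as soon as its accumulated square exceeds \<open>\<delta>\<close>.\<close>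

lemma lenglart:
  fixes t :: "nat \<Rightarrow> real" and \<psi> :: "nat \<Rightarrow> 'a \<Rightarrow> real"
  assumes t: "0 \<le> t 0" "\<And>i. i < n \<Longrightarrow> t i < t (Suc i)"
    and \<psi>: "\<And>i. i < n \<Longrightarrow> \<psi> i \<in> borel_measurable (F (ennreal (t i)))"
    and \<epsilon>: "\<epsilon> > 0" and \<delta>: "\<delta> \<ge> 0"
  shows "prob {\<omega> \<in> space M. \<bar>\<Sum>i<n. \<psi> i \<omega> * (B (t (Suc i)) \<omega> - B (t i) \<omega>)\<bar> > \<epsilon>}
    \<le> prob {\<omega> \<in> space M. (\<Sum>i<n. (\<psi> i \<omega>)\<^sup>2 * (t (Suc i) - t i)) > \<delta>} + \<delta> / \<epsilon>\<^sup>2"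
proof -
  define Q where "Q m \<omega> = (\<Sum>i<m. (\<psi> i \<omega>)\<^sup>2 * (t (Suc i) - t i))" for m \<omega>
  \<comment> \<open>The test already counts the cell about to be entered: \<open>Q (Suc i)\<close>
    involves coefficients up to \<open>\<psi> i\<close> only, hence is known at time
    \<open>t i\<close>, and the squares that survive never add up to more than
    \<open>\<delta>\<close>.\<close>
  define a where "a i \<omega> = (if Q (Suc i) \<omega> \<le> \<delta> then \<psi> i \<omega> else 0)" for i \<omega>
  have tle: "t i \<le> t (Suc i)" if "i < n" for i using t(2)[OF that] by simp
  have t0: "0 \<le> t i" if "i \<le> n" for i using partition_mono[of n t 0 i] tle t that by auto
  have \<psi>_meas: "\<psi> i \<in> borel_measurable (F (ennreal (t j)))" if "i \<le> j" "j < n" for i j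
    using F_measurable_mono[OF \<psi>] that partition_mono[of n t i j] tle by (auto simp: ennreal_leI)
  have Q_meas: "Q (Suc m) \<in> borel_measurable (F (ennreal (t m)))" if "m < n" for m
    unfolding Q_def using \<psi>_meas that
    by (intro borel_measurable_sum borel_measurable_times borel_measurable_power) auto
  have a_meas: "a i \<in> borel_measurable (F (ennreal (t i)))" if "i < n" for i
    unfolding a_def using Q_meas[OF that] \<psi>[OF that] by measurable
  have Q_mono: "Q i \<omega> \<le> Q j \<omega>" if "i \<le> j" "j \<le> n" for i j \<omega>
    unfolding Q_def using that tle by (intro sum_mono2) auto
  have a_sum: "(\<Sum>i<m. (a i \<omega>)\<^sup>2 * (t (Suc i) - t i)) \<le> \<delta>" if "m \<le> n" for m \<omega>
    using that
  proof (induction m)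
    case (Suc m)
    show ?case
    proof (cases "Q (Suc m) \<omega> \<le> \<delta>")
      case True
      have "Q (Suc i) \<omega> \<le> \<delta>" if "i < Suc m" for i
        using Q_mono[of "Suc i" "Suc m" \<omega>] that True Suc.prems by auto
      then have "(\<Sum>i<Suc m. (a i \<omega>)\<^sup>2 * (t (Suc i) - t i)) = Q (Suc m) \<omega>"
        unfolding Q_def a_def by (intro sum.cong) (auto simp: Q_def)
      then show ?thesis using True by simp
    next
      case False
      then have "a m \<omega> = 0" by (simp add: a_def)
      then show ?thesis using Suc by simp
    qed
  qed (use \<delta> in simp)
  \<comment> \<open>Unlike \<open>\<psi>\<close>, the truncated coefficients are bounded, because
    each cell has positive length; their square integrability rests on this.\<close>
  have a_bound: "(a i \<omega>)\<^sup>2 \<le> \<delta> / (t (Suc i) - t i)" if "i < n" for i \<omega>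
  proof -
    have "(a i \<omega>)\<^sup>2 * (t (Suc i) - t i) \<le> (\<Sum>i<n. (a i \<omega>)\<^sup>2 * (t (Suc i) - t i))"
      using that tle by (intro member_le_sum) auto
    also have "\<dots> \<le> \<delta>" using a_sum by simp
    finally show ?thesis using t(2)[OF that] by (simp add: field_simps)
  qed
  have a_int: "integrable M (\<lambda>\<omega>. (a i \<omega>)\<^sup>2)" if "i < n" for i
    using a_bound[OF that] F_measurable[OF a_meas[OF that]]
    by (intro integrable_const_bound[where B="\<delta> / (t (Suc i) - t i)"]) auto
  define Z where "Z \<omega> = (\<Sum>i<n. a i \<omega> * (B (t (Suc i)) \<omega> - B (t i) \<omega>))" for \<omega>
  have "expectation (\<lambda>\<omega>. (Z \<omega>)\<^sup>2) = (\<Sum>i<n. expectation (\<lambda>\<omega>. (a i \<omega>)\<^sup>2 * (t (Suc i) - t i)))"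
    unfolding Z_def by (subst ito_isometry(3)) (use t(1) tle a_meas a_int in auto)
  also have "\<dots> = expectation (\<lambda>\<omega>. \<Sum>i<n. (a i \<omega>)\<^sup>2 * (t (Suc i) - t i))"
    using a_int by (intro Bochner_Integration.integral_sum[symmetric]) auto
  also have "\<dots> \<le> expectation (\<lambda>\<omega>. \<delta>)"
    using a_int a_sum by (intro integral_mono Bochner_Integration.integrable_sum) auto
  finally have EZ: "expectation (\<lambda>\<omega>. (Z \<omega>)\<^sup>2) \<le> \<delta>" by (simp add: prob_space)
  have ZM: "Z \<in> borel_measurable M" "integrable M (\<lambda>\<omega>. (Z \<omega>)\<^sup>2)"
    unfolding Z_def using ito_isometry(1,2)[of t n a] t(1) tle a_meas a_int by auto
  have QM: "Q n \<in> borel_measurable M"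
    unfolding Q_def using F_measurable[OF \<psi>] by (intro borel_measurable_sum borel_measurable_times borel_measurable_power) auto
  \<comment> \<open>As long as the total \<open>Q n\<close> is at most \<open>\<delta>\<close>,
    nothing has been switched off and the two sums agree.\<close>
  have sub: "{\<omega> \<in> space M. \<bar>\<Sum>i<n. \<psi> i \<omega> * (B (t (Suc i)) \<omega> - B (t i) \<omega>)\<bar> > \<epsilon>} \<subseteq>
     {\<omega> \<in> space M. Q n \<omega> > \<delta>} \<union> {\<omega> \<in> space M. \<bar>Z \<omega>\<bar> > \<epsilon>}"
  proof safe
    fix \<omega> assume \<omega>: "\<epsilon> < \<bar>\<Sum>i<n. \<psi> i \<omega> * (B (t (Suc i)) \<omega> - B (t i) \<omega>)\<bar>" "\<not> \<epsilon> < \<bar>Z \<omega>\<bar>"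
    show "\<delta> < Q n \<omega>"
    proof (rule ccontr)
      assume "\<not> \<delta> < Q n \<omega>"
      then have "a i \<omega> = \<psi> i \<omega>" if "i < n" for i
        using Q_mono[of "Suc i" n \<omega>] that unfolding a_def by auto
      then show False using \<omega> by (simp add: Z_def)
    qed
  qed
  have "prob {\<omega> \<in> space M. \<bar>\<Sum>i<n. \<psi> i \<omega> * (B (t (Suc i)) \<omega> - B (t i) \<omega>)\<bar> > \<epsilon>} \<le>
     prob ({\<omega> \<in> space M. Q n \<omega> > \<delta>} \<union> {\<omega> \<in> space M. \<bar>Z \<omega>\<bar> > \<epsilon>})"
    using sub QM ZM by (intro finite_measure_mono) auto
  also have "\<dots> \<le> prob {\<omega> \<in> space M. Q n \<omega> > \<delta>} + prob {\<omega> \<in> space M. \<bar>Z \<omega>\<bar> > \<epsilon>}"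
    using QM ZM by (intro measure_Un_le) auto
  also have "prob {\<omega> \<in> space M. \<bar>Z \<omega>\<bar> > \<epsilon>} \<le> expectation (\<lambda>\<omega>. (Z \<omega>)\<^sup>2) / \<epsilon>\<^sup>2"
    by (rule prob_gt_le_second_moment[OF ZM \<epsilon>])
  also have "\<dots> \<le> \<delta> / \<epsilon>\<^sup>2" using EZ by (simp add: divide_right_mono)
  finally show ?thesis by (simp add: Q_def)
qed

end

section \<open>Refining partitions\<close>

lemma strict_partition_less:
  fixes r :: "nat \<Rightarrow> real"
  assumes "\<And>i. i < n \<Longrightarrow> r i < r (Suc i)" "i \<le> n" "j \<le> n"
  shows "r i < r j \<longleftrightarrow> i < j"
proof -
  have *: "r i < r j" if "i < j" "j \<le> n" for i j
    using that by (induction rule: strict_inc_induct)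
      (auto intro: assms(1) order.strict_trans[OF assms(1)])
  show ?thesis
    using *[of i j] *[of j i] assms(2,3) by (cases i j rule: linorder_cases) auto
qed

lemma nn_integral_step_function:
  fixes r c :: "nat \<Rightarrow> real"
  assumes r: "\<And>i. i < m \<Longrightarrow> r i < r (Suc i)" "r 0 = 0" "r m = t"
    and c: "\<And>i. i < m \<Longrightarrow> 0 \<le> c i"
    and f: "\<And>i u. i < m \<Longrightarrow> r i < u \<Longrightarrow> u \<le> r (Suc i) \<Longrightarrow> f u = ennreal (c i)"
  shows "(\<integral>\<^sup>+u\<in>{0..t}. f u \<partial>lborel) = ennreal (\<Sum>i<m. c i * (r (Suc i) - r i))"
proof -
  note lt = strict_partition_less[of m r, OF r(1)]
  have le: "r i \<le> r j \<longleftrightarrow> i \<le> j" if "i \<le> m" "j \<le> m" for i j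
    using lt[of j i] that by (auto simp: not_less[symmetric])
  \<comment> \<open>The point \<open>0\<close> lies in no cell, since the cells are open on the
    left. It has to be excluded here and is recovered below as a null set.\<close>
  have step: "f u * indicator {0..t} u = (\<Sum>i<m. ennreal (c i) * indicator {r i<..r (Suc i)} u)" if "u \<noteq> 0" for u
  proof (cases "u \<in> {0<..t}")
    case True
    have "\<exists>j<k. r j < u \<and> u \<le> r (Suc j)" if "u \<le> r k" "k \<le> m" for k
      using that
    proof (induction k)
      case 0 then show ?case using True r by auto
    next
      case (Suc k) then show ?case by (cases "u \<le> r k") (auto simp: less_Suc_eq)
    qed
    from this[of m] True obtain j where j: "j < m" "r j < u" "u \<le> r (Suc j)"
      using r by auto
    have z: "indicator {r i<..r (Suc i)} u = (0::ennreal)" if "i < m" "i \<noteq> j" for i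
    proof (rule ccontr)
      assume "indicator {r i<..r (Suc i)} u \<noteq> (0::ennreal)"
      then have *: "r i < u" "u \<le> r (Suc i)" by (auto simp: indicator_def split: if_splits)
      have "r i < r (Suc j)" "r j < r (Suc i)" using * j by auto
      then show False using lt[of i "Suc j"] lt[of j "Suc i"] that j by auto
    qed
    have "(\<Sum>i<m. ennreal (c i) * indicator {r i<..r (Suc i)} u) = (\<Sum>i<m. if i = j then ennreal (c j) else 0)"
      using z j by (intro sum.cong) auto
    also have "\<dots> = ennreal (c j)" using j by simp
    finally show ?thesis using f[OF j] True by auto
  next
    case False
    then have u: "u < 0 \<or> t < u" using that by auto
    have notin: "u \<notin> {r i<..r (Suc i)}" if "i < m" for i
      using u le[of 0 i] le[of "Suc i" m] that r by auto
    have "u \<notin> {0..t}" using u by auto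
    then have "f u * indicator {0..t} u = 0" by (simp only: indicator_simps mult_zero_right not_False_eq_True)
    moreover have "(\<Sum>i<m. ennreal (c i) * indicator {r i<..r (Suc i)} u) = 0"
    proof (intro sum.neutral ballI)
      fix i assume "i \<in> {..<m}"
      then have "u \<notin> {r i<..r (Suc i)}" using notin[of i] by simp
      then show "ennreal (c i) * indicator {r i<..r (Suc i)} u = 0"
        by (simp only: indicator_simps mult_zero_right not_False_eq_True)
    qed
    ultimately show ?thesis by (simp only:)
  qed
  have "(\<integral>\<^sup>+u\<in>{0..t}. f u \<partial>lborel) = (\<integral>\<^sup>+u. (\<Sum>i<m. ennreal (c i) * indicator {r i<..r (Suc i)} u) \<partial>lborel)"
    by (rule nn_integral_cong_AE, rule AE_mp[OF AE_lborel_singleton[of 0]]) (rule AE_I2, rule impI, rule step)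
  also have "\<dots> = (\<Sum>i<m. ennreal (c i) * emeasure lborel {r i<..r (Suc i)})"
    by (subst nn_integral_sum) (auto simp: nn_integral_cmult_indicator simp del: sum_mult_indicator)
  also have "\<dots> = (\<Sum>i<m. ennreal (c i * (r (Suc i) - r i)))"
    using c r(1) by (intro sum.cong) (auto simp: ennreal_mult less_imp_le)
  also have "\<dots> = ennreal (\<Sum>i<m. c i * (r (Suc i) - r i))"
    using c r(1) by (intro sum_ennreal) (auto simp: less_imp_le)
  finally show ?thesis .
qed

text \<open>No partition point lies inside a cell of the finer grid, so the process is constant
  there. Cells are closed on the right, hence the right end point represents the cell.\<close>

lemma elementary_process_refine:
  assumes r: "\<And>j. j < m \<Longrightarrow> r j < r (Suc j)" and sub: "s ` {..N} \<subseteq> r ` {..m}"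
    and j: "j < m" "r j < u" "u \<le> r (Suc j)"
  shows "elementary_process N s \<xi> u \<omega> = elementary_process N s \<xi> (r (Suc j)) \<omega>"
proof -
  note lt = strict_partition_less[of m r, OF r]
  have *: "s i < u \<longleftrightarrow> s i < r (Suc j)" if i: "i \<le> N" for i
  proof -
    have "s i \<in> r ` {..m}" using i sub by blast
    then obtain a where a: "a \<le> m" "s i = r a" by auto
    show ?thesis
      using lt[of a "Suc j"] lt[of j a] a j r[of j] by (auto simp: not_less)
  qed
  have "indicator {s i<..s (Suc i)} u = (indicator {s i<..s (Suc i)} (r (Suc j)) :: real)" if "i < N" for i
    using *[of i] *[of "Suc i"] that by (auto simp: indicator_def not_less[symmetric])
  then show ?thesis
    unfolding elementary_process_def by (intro sum.cong) auto
qed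

text \<open>Every increment of the coarse partition telescopes over the fine cells that it contains.
  For this the indicator of \<open>{s i<..s (Suc i)}\<close> is written as a difference of two lower
  sets, each of which selects an initial segment of cells.\<close>

lemma elementary_integral_refine:
  assumes r: "\<And>j. j < m \<Longrightarrow> r j < r (Suc j)" and sub: "s ` {..N} \<subseteq> r ` {..m}"
    and s: "\<And>i. i < N \<Longrightarrow> s i \<le> s (Suc i)"
  shows "elementary_integral B N s \<xi> \<omega> =
    (\<Sum>j<m. elementary_process N s \<xi> (r (Suc j)) \<omega> * (B (r (Suc j)) \<omega> - B (r j) \<omega>))"
proof -
  note lt = strict_partition_less[of m r, OF r]
  define \<Delta> where "\<Delta> j = B (r (Suc j)) \<omega> - B (r j) \<omega>" for j
  have tele: "(\<Sum>j<m. indicator {..s i} (r (Suc j)) * \<Delta> j) = B (s i) \<omega> - B (r 0) \<omega>" if i: "i \<le> N" for i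
  proof -
    have "s i \<in> r ` {..m}" using i sub by blast
    then obtain a where a: "a \<le> m" "s i = r a" by auto
    have "r (Suc j) \<le> r a \<longleftrightarrow> j < a" if "j < m" for j
      using lt[of a "Suc j"] a that by (auto simp: not_less[symmetric])
    then have "(\<Sum>j<m. indicator {..s i} (r (Suc j)) * \<Delta> j) = (\<Sum>j<a. \<Delta> j)"
      using a by (intro sum.mono_neutral_cong_right) (auto simp: indicator_def)
    also have "\<dots> = B (s i) \<omega> - B (r 0) \<omega>"
      unfolding \<Delta>_def a(2) by (rule sum_lessThan_telescope)
    finally show ?thesis .
  qed
  have "(\<Sum>j<m. elementary_process N s \<xi> (r (Suc j)) \<omega> * \<Delta> j) =
     (\<Sum>j<m. \<Sum>i<N. \<xi> i \<omega> * (indicator {s i<..s (Suc i)} (r (Suc j)) * \<Delta> j))"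
    unfolding elementary_process_def sum_distrib_right mult.assoc by (rule refl)
  also have "\<dots> = (\<Sum>i<N. \<xi> i \<omega> * (\<Sum>j<m. indicator {s i<..s (Suc i)} (r (Suc j)) * \<Delta> j))"
    by (subst sum.swap) (simp only: sum_distrib_left)
  also have "\<dots> = (\<Sum>i<N. \<xi> i \<omega> * (B (s (Suc i)) \<omega> - B (s i) \<omega>))"
  proof (intro sum.cong refl arg_cong2[where f="(*)"])
    fix i assume "i \<in> {..<N}"
    then have i: "i < N" by simp
    have "indicator {s i<..s (Suc i)} x = (indicator {..s (Suc i)} x - indicator {..s i} x :: real)" for x
      using s[OF i] by (auto simp: indicator_def)
    then have "(\<Sum>j<m. indicator {s i<..s (Suc i)} (r (Suc j)) * \<Delta> j) =
       (\<Sum>j<m. indicator {..s (Suc i)} (r (Suc j)) * \<Delta> j) - (\<Sum>j<m. indicator {..s i} (r (Suc j)) * \<Delta> j)"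
      by (simp add: left_diff_distrib sum_subtractf)
    also have "\<dots> = B (s (Suc i)) \<omega> - B (s i) \<omega>"
      using tele[of i] tele[of "Suc i"] i by simp
    finally show "(\<Sum>j<m. indicator {s i<..s (Suc i)} (r (Suc j)) * \<Delta> j) = B (s (Suc i)) \<omega> - B (s i) \<omega>" .
  qed
  finally show ?thesis by (simp add: elementary_integral_def \<Delta>_def)
qed

lemma (in prob_space) AE_eventually_prob_tendsto:
  assumes G: "\<And>n. G n \<in> sets M" and ev: "AE \<omega> in M. eventually (\<lambda>n. \<omega> \<in> G n) sequentially"
  shows "(\<lambda>n. prob (G n)) \<longlonglongrightarrow> 1"
proof -
  have "(\<lambda>n. \<integral>\<omega>. indicator (G n) \<omega> \<partial>M) \<longlonglongrightarrow> (\<integral>\<omega>. (1::real) \<partial>M)"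
  proof (rule integral_dominated_convergence[where w="\<lambda>_. 1"])
    show "AE \<omega> in M. (\<lambda>n. indicator (G n) \<omega> :: real) \<longlonglongrightarrow> 1"
      using ev by eventually_elim (auto intro!: tendsto_eventually elim: eventually_mono)
  qed (use G in \<open>auto simp: indicator_def\<close>)
  then show ?thesis using G by (simp add: prob_space)
qed

context brownian_space
begin

text \<open>Predictability: a coefficient contributes on the cell ending at \<open>r (Suc j)\<close>
  only if its starting time lies strictly before that end point and therefore, being a grid point,
  not after \<open>r j\<close>.\<close>

lemma elementary_process_F_measurable:
  assumes r: "\<And>j. j < m \<Longrightarrow> r j < r (Suc j)" and sub: "s ` {..N} \<subseteq> r ` {..m}" and j: "j < m"
    and \<xi>: "\<And>i. i < N \<Longrightarrow> \<xi> i \<in> borel_measurable (F (ennreal (s i)))"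
  shows "elementary_process N s \<xi> (r (Suc j)) \<in> borel_measurable (F (ennreal (r j)))"
proof -
  note lt = strict_partition_less[of m r, OF r]
  have "(\<lambda>\<omega>. \<xi> i \<omega> * indicator {s i<..s (Suc i)} (r (Suc j))) \<in> borel_measurable (F (ennreal (r j)))" if "i < N" for i
  proof (cases "s i < r (Suc j)")
    case True
    have "s i \<in> r ` {..m}" using that sub by auto
    then obtain a where a: "a \<le> m" "s i = r a" by auto
    then have "a \<le> j" using True lt[of a "Suc j"] j by auto
    then have "s i \<le> r j" using lt[of j a] a j by (auto simp: not_less[symmetric])
    then have "\<xi> i \<in> borel_measurable (F (ennreal (r j)))"
      using F_measurable_mono[OF \<xi>[OF that]] by (simp add: ennreal_leI)
    then show ?thesis by simp
  qed simp
  then show ?thesis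
    unfolding elementary_process_def[abs_def] by (intro borel_measurable_sum) auto
qed

text \<open>On the common refinement the difference of the two integrals is a single discrete sum,
  whose accumulated square is the integrated squared distance of the integrands. The coefficients
  may be unbounded, as one of the two processes will be the price frozen on a grid.\<close>

lemma elementary_lenglart:
  assumes E1: "s1 0 = 0" "s1 N1 = t" "\<And>i. i < N1 \<Longrightarrow> s1 i \<le> s1 (Suc i)"
      "\<And>i. i < N1 \<Longrightarrow> \<xi>1 i \<in> borel_measurable (F (ennreal (s1 i)))"
    and E2: "s2 0 = 0" "s2 N2 = t" "\<And>i. i < N2 \<Longrightarrow> s2 i \<le> s2 (Suc i)"
      "\<And>i. i < N2 \<Longrightarrow> \<xi>2 i \<in> borel_measurable (F (ennreal (s2 i)))"
    and \<epsilon>: "\<epsilon> > 0" and \<delta>: "\<delta> \<ge> 0"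
  shows "prob {\<omega> \<in> space M. \<bar>elementary_integral B N1 s1 \<xi>1 \<omega> - elementary_integral B N2 s2 \<xi>2 \<omega>\<bar> > \<epsilon>}
    \<le> prob {\<omega> \<in> space M. (\<integral>\<^sup>+u\<in>{0..t}. ennreal ((elementary_process N1 s1 \<xi>1 u \<omega>
            - elementary_process N2 s2 \<xi>2 u \<omega>)\<^sup>2) \<partial>lborel) > ennreal \<delta>} + \<delta> / \<epsilon>\<^sup>2"
proof -
  define A where "A = s1 ` {..N1} \<union> s2 ` {..N2}"
  have A: "finite A" "A \<noteq> {}" unfolding A_def by auto
  have range: "0 \<le> x" "x \<le> t" if "x \<in> A" for x
  proof -
    have "0 \<le> s1 i \<and> s1 i \<le> t" if "i \<le> N1" for i
      using partition_mono[of N1 s1 0 i, OF E1(3)] partition_mono[of N1 s1 i N1, OF E1(3)] that E1(1,2) by auto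
    moreover have "0 \<le> s2 i \<and> s2 i \<le> t" if "i \<le> N2" for i
      using partition_mono[of N2 s2 0 i, OF E2(3)] partition_mono[of N2 s2 i N2, OF E2(3)] that E2(1,2) by auto
    ultimately show "0 \<le> x" "x \<le> t" using that unfolding A_def by auto
  qed
  obtain r m where r: "r ` {..m} = A" "\<And>i. i < m \<Longrightarrow> r i < r (Suc i)" "r 0 = Min A" "r m = Max A"
    using finite_set_enumeration[OF A] by metis
  have "0 \<in> A" "t \<in> A" unfolding A_def using E1(1,2) by (auto intro!: image_eqI)
  then have "Min A = 0" "Max A = t" using A range by (auto intro!: Min_eqI Max_eqI)
  then have r0: "r 0 = 0" "r m = t" using r by auto
  have sub1: "s1 ` {..N1} \<subseteq> r ` {..m}" and sub2: "s2 ` {..N2} \<subseteq> r ` {..m}"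
    unfolding r(1) A_def by auto
  define \<psi> where "\<psi> j \<omega> = elementary_process N1 s1 \<xi>1 (r (Suc j)) \<omega> - elementary_process N2 s2 \<xi>2 (r (Suc j)) \<omega>" for j \<omega>
  have \<psi>: "\<psi> j \<in> borel_measurable (F (ennreal (r j)))" if "j < m" for j
    unfolding \<psi>_def
    using elementary_process_F_measurable[OF r(2) sub1 that E1(4)] elementary_process_F_measurable[OF r(2) sub2 that E2(4)]
    by (intro borel_measurable_diff) auto
  have i1: "elementary_integral B N1 s1 \<xi>1 \<omega> = (\<Sum>j<m. elementary_process N1 s1 \<xi>1 (r (Suc j)) \<omega> * (B (r (Suc j)) \<omega> - B (r j) \<omega>))" for \<omega>
    by (rule elementary_integral_refine) (use r(2) sub1 E1(3) in auto)
  have i2: "elementary_integral B N2 s2 \<xi>2 \<omega> = (\<Sum>j<m. elementary_process N2 s2 \<xi>2 (r (Suc j)) \<omega> * (B (r (Suc j)) \<omega> - B (r j) \<omega>))" for \<omega>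
    by (rule elementary_integral_refine) (use r(2) sub2 E2(3) in auto)
  have 1: "elementary_integral B N1 s1 \<xi>1 \<omega> - elementary_integral B N2 s2 \<xi>2 \<omega> =
     (\<Sum>j<m. \<psi> j \<omega> * (B (r (Suc j)) \<omega> - B (r j) \<omega>))" for \<omega>
    unfolding i1 i2 \<psi>_def by (simp only: left_diff_distrib sum_subtractf)
  have 2: "(\<integral>\<^sup>+u\<in>{0..t}. ennreal ((elementary_process N1 s1 \<xi>1 u \<omega> - elementary_process N2 s2 \<xi>2 u \<omega>)\<^sup>2) \<partial>lborel) =
     ennreal (\<Sum>j<m. (\<psi> j \<omega>)\<^sup>2 * (r (Suc j) - r j))" for \<omega>
  proof (rule nn_integral_step_function[OF r(2) r0])
    fix j u assume j: "j < m" "r j < u" "u \<le> r (Suc j)"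
    show "ennreal ((elementary_process N1 s1 \<xi>1 u \<omega> - elementary_process N2 s2 \<xi>2 u \<omega>)\<^sup>2) = ennreal ((\<psi> j \<omega>)\<^sup>2)"
      using elementary_process_refine[of m r s1 N1 j u \<xi>1 \<omega>] elementary_process_refine[of m r s2 N2 j u \<xi>2 \<omega>]
        r(2) sub1 sub2 j by (simp add: \<psi>_def)
  qed auto
  have 3: "(\<Sum>j<m. (\<psi> j \<omega>)\<^sup>2 * (r (Suc j) - r j)) \<ge> 0" for \<omega>
    using r(2) by (intro sum_nonneg) (auto simp: less_imp_le)
  show ?thesis
    unfolding 1 2 using lenglart[of r m \<psi> \<epsilon> \<delta>] r(2) r0 \<psi> \<epsilon> \<delta> 3
    by (simp add: ennreal_less_iff)
qed

end

section \<open>The driftless price is an exponential martingale\<close>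

lemma partition_interval:
  fixes r :: "nat \<Rightarrow> real"
  assumes "r 0 < u" "u \<le> r m"
  obtains j where "j < m" "r j < u" "u \<le> r (Suc j)"
proof -
  have "\<exists>j<m. r j < u \<and> u \<le> r (Suc j)"
    using assms
  proof (induction m)
    case (Suc m) then show ?case by (cases "u \<le> r m") (auto simp: less_Suc_eq)
  qed simp
  then show ?thesis using that by auto
qed

lemma elementary_process_eq:
  assumes r: "\<And>i. i < m \<Longrightarrow> r i < r (Suc i)" and i: "i < m" "r i < u" "u \<le> r (Suc i)"
  shows "elementary_process m r \<xi> u \<omega> = \<xi> i \<omega>"
proof -
  note lt = strict_partition_less[of m r, OF r]
  have z: "u \<notin> {r l<..r (Suc l)}" if "l < m" "l \<noteq> i" for l
  proof
    assume "u \<in> {r l<..r (Suc l)}"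
    then have "r l < r (Suc i)" "r i < r (Suc l)" using i by auto
    then show False using lt[of l "Suc i"] lt[of i "Suc l"] that i by auto
  qed
  have "elementary_process m r \<xi> u \<omega> = (\<Sum>l<m. if l = i then \<xi> i \<omega> else 0)"
    unfolding elementary_process_def
  proof (intro sum.cong refl)
    fix l assume "l \<in> {..<m}"
    then show "\<xi> l \<omega> * indicator {r l<..r (Suc l)} u = (if l = i then \<xi> i \<omega> else 0)"
      using z[of l] i by (cases "l = i") auto
  qed
  then show ?thesis using i by simp
qed

lemma discrete_gronwall:
  fixes u :: "nat \<Rightarrow> real"
  assumes u: "\<And>j. j \<le> n \<Longrightarrow> u j \<le> c + a * (\<Sum>i<j. u i)" and a: "0 \<le> a" and j: "j \<le> n"
  shows "u j \<le> c * (1 + a) ^ j"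
proof -
  \<comment> \<open>The induction is on the right-hand side of the hypothesis, which grows by a
    factor of at most \<open>1 + a\<close> per step.\<close>
  have "c + a * (\<Sum>i<j. u i) \<le> c * (1 + a) ^ j"
    using j
  proof (induction j)
    case (Suc j)
    have "c + a * (\<Sum>i<Suc j. u i) \<le> c + a * (\<Sum>i<j. u i) + a * (c + a * (\<Sum>i<j. u i))"
      using mult_left_mono[OF u[of j] a] Suc.prems by (simp add: algebra_simps)
    also have "\<dots> = (1 + a) * (c + a * (\<Sum>i<j. u i))" by (simp add: algebra_simps)
    also have "\<dots> \<le> (1 + a) * (c * (1 + a) ^ j)"
      using Suc a by (intro mult_left_mono) auto
    finally show ?case by (simp add: algebra_simps)
  qed simp
  then show ?thesis using u[OF j] by simp
qed

lemma exp_remainder_le: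
  fixes x :: real
  assumes "0 \<le> x" "x \<le> 1"
  shows "exp x - 1 - x \<le> x\<^sup>2"
  using exp_bound[OF assms] by simp

definition grid :: "real \<Rightarrow> nat \<Rightarrow> nat \<Rightarrow> real" where
  "grid T n i = real i * T / real n"

lemma grid_simps:
  assumes "T > 0" "n > 0"
  shows "grid T n 0 = 0" "grid T n n = T" "grid T n i < grid T n (Suc i)"
    "grid T n (Suc i) - grid T n i = T / n" "0 \<le> grid T n i" "i \<le> j \<Longrightarrow> grid T n i \<le> grid T n j"
  using assms by (auto simp: grid_def field_simps)

text \<open>The square of a sum is at most twice the sum of the squares. In the application
  \<open>x\<close> is the true integrand, \<open>\<phi>\<close> an elementary approximation of it
  and \<open>\<psi>\<close> its values frozen on a grid, which is why the bound \<open>b\<close> is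
  not requested at time \<open>0\<close>.\<close>

lemma nn_integral_square_le:
  fixes \<phi> \<psi> x :: "real \<Rightarrow> real"
  assumes \<phi>: "\<phi> \<in> borel_measurable borel" and x: "continuous_on {0..t} x" and t: "0 \<le> t"
    and b: "\<And>u. 0 < u \<Longrightarrow> u \<le> t \<Longrightarrow> \<bar>x u - \<psi> u\<bar> \<le> b"
  shows "(\<integral>\<^sup>+u\<in>{0..t}. ennreal ((\<phi> u - \<psi> u)\<^sup>2) \<partial>lborel)
    \<le> 2 * (\<integral>\<^sup>+u\<in>{0..t}. ennreal ((\<phi> u - x u)\<^sup>2) \<partial>lborel) + ennreal (2 * b\<^sup>2 * t)"
proof -
  \<comment> \<open>Continuity is known on \<open>{0..t}\<close> only; cutting \<open>x\<close> off
    outside makes it Borel measurable.\<close>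
  define x' where "x' u = indicator {0..t} u *\<^sub>R x u" for u
  have x': "x' \<in> borel_measurable borel"
    unfolding x'_def[abs_def] using x by (intro borel_measurable_continuous_on_indicator) auto
  have eq: "ennreal ((\<phi> u - x u)\<^sup>2) * indicator {0..t} u = ennreal ((\<phi> u - x' u)\<^sup>2) * indicator {0..t} u" for u
    by (auto simp: x'_def indicator_def)
  have pw: "ennreal ((\<phi> u - \<psi> u)\<^sup>2) * indicator {0..t} u \<le>
     2 * (ennreal ((\<phi> u - x' u)\<^sup>2) * indicator {0..t} u) + ennreal (2 * b\<^sup>2) * indicator {0..t} u"
    if "u \<noteq> 0" for u
  proof (cases "u \<in> {0..t}")
    case True
    then have u: "0 < u" "u \<le> t" using that by auto
    have xx: "x' u = x u" using True by (simp add: x'_def)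
    have b2: "(x u - \<psi> u)\<^sup>2 \<le> b\<^sup>2" using b[OF u] by (metis abs_ge_zero power2_abs power_mono)
    have "0 \<le> ((\<phi> u - x u) - (x u - \<psi> u))\<^sup>2" by simp
    also have "\<dots> = 2 * (\<phi> u - x u)\<^sup>2 + 2 * (x u - \<psi> u)\<^sup>2 - (\<phi> u - \<psi> u)\<^sup>2"
      by (simp add: power2_eq_square algebra_simps)
    finally have "(\<phi> u - \<psi> u)\<^sup>2 \<le> 2 * (\<phi> u - x u)\<^sup>2 + 2 * b\<^sup>2" using b2 by simp
    then have "ennreal ((\<phi> u - \<psi> u)\<^sup>2) \<le> ennreal (2 * (\<phi> u - x u)\<^sup>2 + 2 * b\<^sup>2)" by (rule ennreal_leI)
    also have "\<dots> = 2 * ennreal ((\<phi> u - x u)\<^sup>2) + ennreal (2 * b\<^sup>2)"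
      by (simp add: ennreal_plus ennreal_mult)
    finally show ?thesis using True xx by simp
  qed simp
  have "(\<integral>\<^sup>+u\<in>{0..t}. ennreal ((\<phi> u - \<psi> u)\<^sup>2) \<partial>lborel) \<le>
    (\<integral>\<^sup>+u. 2 * (ennreal ((\<phi> u - x' u)\<^sup>2) * indicator {0..t} u) + ennreal (2 * b\<^sup>2) * indicator {0..t} u \<partial>lborel)"
    by (rule nn_integral_mono_AE, rule AE_mp[OF AE_lborel_singleton[of 0]]) (rule AE_I2, rule impI, rule pw)
  also have "\<dots> = 2 * (\<integral>\<^sup>+u. ennreal ((\<phi> u - x' u)\<^sup>2) * indicator {0..t} u \<partial>lborel) + ennreal (2 * b\<^sup>2) * ennreal t"
    using x' \<phi> t by (subst nn_integral_add) (auto simp: nn_integral_cmult nn_integral_cmult_indicator)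
  also have "ennreal (2 * b\<^sup>2) * ennreal t = ennreal (2 * b\<^sup>2 * t)"
    using t by (simp add: ennreal_mult)
  finally show ?thesis unfolding eq .
qed

text \<open>Carries almost sure statements about countably many times over to all times. Since
  \<open>u\<close> is approached from the left, the right end point of a cell is covered as
  well.\<close>

lemma continuous_approx_rational:
  fixes x :: "real \<Rightarrow> real"
  assumes c: "continuous_on {0..} x" and "0 \<le> s" "s < u"
    and q: "\<And>q. q \<in> \<rat> \<Longrightarrow> s < q \<Longrightarrow> q < u \<Longrightarrow> \<bar>x q - y\<bar> \<le> \<kappa>"
  shows "\<bar>x u - y\<bar> \<le> \<kappa>"
proof (rule ccontr)
  assume "\<not> ?thesis"
  then have e: "\<bar>x u - y\<bar> - \<kappa> > 0" by simp
  have u: "u \<in> {0..}" using assms(2,3) by simp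
  obtain d where d: "d > 0" "\<And>v. v \<in> {0..} \<Longrightarrow> dist v u < d \<Longrightarrow> dist (x v) (x u) < \<bar>x u - y\<bar> - \<kappa>"
    using c[unfolded continuous_on_iff, rule_format, OF u e] by blast
  obtain q where q': "q \<in> \<rat>" "max s (u - d) < q" "q < u"
    using Rats_dense_in_real[of "max s (u - d)" u] assms d by auto
  have "dist (x q) (x u) < \<bar>x u - y\<bar> - \<kappa>" using q' assms by (intro d) (auto simp: dist_real_def)
  moreover have "\<bar>x q - y\<bar> \<le> \<kappa>" using q' by (intro q) auto
  ultimately show False by (auto simp: dist_real_def)
qed

section \<open>The Euler scheme of the exponential martingale\<close>

context brownian_space
begin

abbreviation euler_sum :: "real \<Rightarrow> (real \<Rightarrow> 'a \<Rightarrow> real) \<Rightarrow> (nat \<Rightarrow> real) \<Rightarrow> nat \<Rightarrow> 'a \<Rightarrow> real" where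
  "euler_sum r Y t j \<omega> \<equiv> \<Sum>i<j. r * Y (t i) \<omega> * (B (t (Suc i)) \<omega> - B (t i) \<omega>)"

text \<open>Turns second moments into means at doubled volatility; applied to half the volatility,
  it turns boundedness into exponential decay of the price.\<close>

lemma exp_mart_square: "(exp_mart r t \<omega>)\<^sup>2 = exp_mart (2 * r) t \<omega> * exp (r\<^sup>2 * t)"
  by (simp add: exp_mart_def exp_add[symmetric] power2_eq_square algebra_simps)

lemma exp_mart_square_expectation:
  "0 \<le> t \<Longrightarrow> has_bochner_integral M (\<lambda>\<omega>. (exp_mart r t \<omega>)\<^sup>2) (exp (r\<^sup>2 * t))"
proof -
  assume t: "0 \<le> t"
  have "has_bochner_integral M (\<lambda>\<omega>. exp_mart (2 * r) t \<omega> * exp (r\<^sup>2 * t)) (1 * exp (r\<^sup>2 * t))"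
    by (intro has_bochner_integral_mult_left exp_mart_expectation t)
  then show ?thesis by (simp add: exp_mart_square)
qed

lemma exp_mart_0: "AE \<omega> in M. exp_mart r 0 \<omega> = 1"
  using AE_B_0 by eventually_elim (simp add: exp_mart_def)

text \<open>\<open>z\<close> is what the relative growth of \<open>exp_mart\<close> over one step
  leaves after subtracting its linear part \<open>r * x\<close>. Its variance is of second order in
  the step length, so \<open>n\<close> of them still add up to order \<open>1 / n\<close>.\<close>

lemma exp_mart_remainder_moments:
  fixes r s t :: real
  assumes st: "0 \<le> s" "s \<le> t"
  defines "z \<equiv> \<lambda>x. exp (r * x) * exp (- (r\<^sup>2 * (t - s) / 2)) - 1 - r * x"
  shows "has_bochner_integral M (\<lambda>\<omega>. z (B t \<omega> - B s \<omega>)) 0"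
    "has_bochner_integral M (\<lambda>\<omega>. (z (B t \<omega> - B s \<omega>))\<^sup>2) (exp (r\<^sup>2 * (t - s)) - 1 - r\<^sup>2 * (t - s))"
proof -
  define d where "d = t - s"
  define \<Delta> where "\<Delta> \<omega> = B t \<omega> - B s \<omega>" for \<omega>
  define e where "e = exp (- (r\<^sup>2 * d / 2))"
  have 1: "has_bochner_integral M (\<lambda>\<omega>. exp (r * \<Delta> \<omega>) * e) (exp (r\<^sup>2 * d / 2) * e)"
    unfolding \<Delta>_def d_def by (intro has_bochner_integral_mult_left increment_moments st)
  have 2: "has_bochner_integral M (\<lambda>\<omega>. r * \<Delta> \<omega>) (r * 0)"
    unfolding \<Delta>_def by (intro has_bochner_integral_mult_right increment_mean st)
  have 3: "has_bochner_integral M (\<lambda>\<omega>. exp ((2 * r) * \<Delta> \<omega>) * e\<^sup>2) (exp ((2 * r)\<^sup>2 * d / 2) * e\<^sup>2)"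
    unfolding \<Delta>_def d_def by (intro has_bochner_integral_mult_left increment_moments st)
  have 4: "has_bochner_integral M (\<lambda>\<omega>. r\<^sup>2 * (\<Delta> \<omega>)\<^sup>2) (r\<^sup>2 * d)"
    unfolding \<Delta>_def d_def by (intro has_bochner_integral_mult_right increment_moments st)
  have 5: "has_bochner_integral M (\<lambda>\<omega>. (\<Delta> \<omega> * exp (r * \<Delta> \<omega>)) * (2 * r * e)) ((r * d * exp (r\<^sup>2 * d / 2)) * (2 * r * e))"
    unfolding \<Delta>_def d_def by (intro has_bochner_integral_mult_left increment_moments st)
  have c: "has_bochner_integral M (\<lambda>\<omega>. 1 :: real) 1"
    by (simp add: has_bochner_integral_iff prob_space)
  have e1: "exp (r\<^sup>2 * d / 2) * e = 1" by (simp add: e_def exp_add[symmetric])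
  have e2: "exp ((2 * r)\<^sup>2 * d / 2) * e\<^sup>2 = exp (r\<^sup>2 * d)"
    by (simp add: e_def exp_add[symmetric] power2_eq_square algebra_simps)
  have "has_bochner_integral M (\<lambda>\<omega>. exp (r * \<Delta> \<omega>) * e - 1 - r * \<Delta> \<omega>) (exp (r\<^sup>2 * d / 2) * e - 1 - r * 0)"
    by (intro has_bochner_integral_diff 1 2 c)
  then show "has_bochner_integral M (\<lambda>\<omega>. z (B t \<omega> - B s \<omega>)) 0"
    unfolding z_def \<Delta>_def[symmetric] d_def[symmetric] e_def[symmetric] by (simp add: e1)
  have "has_bochner_integral M (\<lambda>\<omega>. exp ((2 * r) * \<Delta> \<omega>) * e\<^sup>2 + 1 + r\<^sup>2 * (\<Delta> \<omega>)\<^sup>2 - 2 * (exp (r * \<Delta> \<omega>) * e)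
       - (\<Delta> \<omega> * exp (r * \<Delta> \<omega>)) * (2 * r * e) + 2 * (r * \<Delta> \<omega>))
     (exp ((2 * r)\<^sup>2 * d / 2) * e\<^sup>2 + 1 + r\<^sup>2 * d - 2 * (exp (r\<^sup>2 * d / 2) * e)
       - (r * d * exp (r\<^sup>2 * d / 2)) * (2 * r * e) + 2 * (r * 0))"
    by (intro has_bochner_integral_diff has_bochner_integral_add has_bochner_integral_mult_right 1 2 3 4 5 c)
  also have "(\<lambda>\<omega>. exp ((2 * r) * \<Delta> \<omega>) * e\<^sup>2 + 1 + r\<^sup>2 * (\<Delta> \<omega>)\<^sup>2 - 2 * (exp (r * \<Delta> \<omega>) * e)
       - (\<Delta> \<omega> * exp (r * \<Delta> \<omega>)) * (2 * r * e) + 2 * (r * \<Delta> \<omega>)) = (\<lambda>\<omega>. (exp (r * \<Delta> \<omega>) * e - 1 - r * \<Delta> \<omega>)\<^sup>2)"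
  proof
    fix \<omega>
    have "exp ((2 * r) * \<Delta> \<omega>) = exp (r * \<Delta> \<omega>) * exp (r * \<Delta> \<omega>)" by (simp add: exp_add[symmetric])
    then show "exp ((2 * r) * \<Delta> \<omega>) * e\<^sup>2 + 1 + r\<^sup>2 * (\<Delta> \<omega>)\<^sup>2 - 2 * (exp (r * \<Delta> \<omega>) * e)
       - (\<Delta> \<omega> * exp (r * \<Delta> \<omega>)) * (2 * r * e) + 2 * (r * \<Delta> \<omega>) = (exp (r * \<Delta> \<omega>) * e - 1 - r * \<Delta> \<omega>)\<^sup>2"
      by (simp add: power2_eq_square algebra_simps)
  qed
  also have "(exp ((2 * r)\<^sup>2 * d / 2) * e\<^sup>2 + 1 + r\<^sup>2 * d - 2 * (exp (r\<^sup>2 * d / 2) * e)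
       - (r * d * exp (r\<^sup>2 * d / 2)) * (2 * r * e) + 2 * (r * 0)) = exp (r\<^sup>2 * d) - 1 - r\<^sup>2 * d"
  proof -
    have "(r * d * exp (r\<^sup>2 * d / 2)) * (2 * r * e) = 2 * r\<^sup>2 * d * (exp (r\<^sup>2 * d / 2) * e)"
      by (simp add: power2_eq_square)
    then show ?thesis unfolding e2 by (simp only: e1)
  qed
  finally show "has_bochner_integral M (\<lambda>\<omega>. (z (B t \<omega> - B s \<omega>))\<^sup>2) (exp (r\<^sup>2 * (t - s)) - 1 - r\<^sup>2 * (t - s))"
    unfolding z_def \<Delta>_def[symmetric] d_def[symmetric] e_def[symmetric] .
qed

text \<open>The error telescopes into one-step remainders weighted by the value of the martingale at
  the start of the step. These are orthogonal, so there are at most \<open>n\<close> variances, each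
  at most \<open>exp (r\<^sup>2 * T) * (r\<^sup>2 * T / n)\<^sup>2\<close>, and Chebyshev's
  inequality finishes.\<close>

lemma exp_mart_euler_error:
  assumes T: "T > 0" and n: "n > 0" "r\<^sup>2 * T / n \<le> 1" and j: "j \<le> n" and \<delta>: "\<delta> > 0"
  shows "prob {\<omega> \<in> space M. \<bar>exp_mart r (grid T n j) \<omega> - 1 - euler_sum r (exp_mart r) (grid T n) j \<omega>\<bar> > \<delta>}
    \<le> (exp (r\<^sup>2 * T) * (r\<^sup>2 * T)\<^sup>2 / \<delta>\<^sup>2) / n"
proof -
  define t where "t = grid T n"
  note g = grid_simps[OF T n(1), folded t_def]
  define z where "z x = exp (r * x) * exp (- (r\<^sup>2 * (T / n) / 2)) - 1 - r * x" for x
  define Z where "Z \<omega> = (\<Sum>i<j. exp_mart r (t i) \<omega> * z (B (t (Suc i)) \<omega> - B (t i) \<omega>))" for \<omega>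
  have zm: "z \<in> borel_measurable borel" unfolding z_def by measurable
  have z1: "has_bochner_integral M (\<lambda>\<omega>. z (B (t (Suc i)) \<omega> - B (t i) \<omega>)) 0"
    and z2: "has_bochner_integral M (\<lambda>\<omega>. (z (B (t (Suc i)) \<omega> - B (t i) \<omega>))\<^sup>2) (exp (r\<^sup>2 * (T / n)) - 1 - r\<^sup>2 * (T / n))" for i
    using exp_mart_remainder_moments[of "t i" "t (Suc i)" r] g(3)[of i] g(5)[of i]
    by (auto simp: z_def g(4))
  have Zorth: "Z \<in> borel_measurable M" "integrable M (\<lambda>\<omega>. (Z \<omega>)\<^sup>2)"
    "expectation (\<lambda>\<omega>. (Z \<omega>)\<^sup>2) = (\<Sum>i<j. exp (r\<^sup>2 * t i) * (exp (r\<^sup>2 * (T / n)) - 1 - r\<^sup>2 * (T / n)))"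
  proof -
    have a: "exp_mart r (t i) \<in> borel_measurable (F (ennreal (t i)))"
      "integrable M (\<lambda>\<omega>. (exp_mart r (t i) \<omega>)\<^sup>2)" "expectation (\<lambda>\<omega>. (exp_mart r (t i) \<omega>)\<^sup>2) = exp (r\<^sup>2 * t i)" for i
      using exp_mart_F_measurable[OF g(5)] exp_mart_square_expectation[OF g(5)] by (auto simp: has_bochner_integral_iff)
    note o = orthogonal_increments[of t j "\<lambda>i. exp_mart r (t i)" "\<lambda>_. z"]
    show "Z \<in> borel_measurable M"
      unfolding Z_def using F_measurable[OF o(1)] a z1 z2 zm g by (auto simp: has_bochner_integral_iff less_imp_le)
    show "integrable M (\<lambda>\<omega>. (Z \<omega>)\<^sup>2)"
      unfolding Z_def using o(2) a z1 z2 zm g by (auto simp: has_bochner_integral_iff less_imp_le)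
    show "expectation (\<lambda>\<omega>. (Z \<omega>)\<^sup>2) = (\<Sum>i<j. exp (r\<^sup>2 * t i) * (exp (r\<^sup>2 * (T / n)) - 1 - r\<^sup>2 * (T / n)))"
      unfolding Z_def using o(3) a z1 z2 zm g by (auto simp: has_bochner_integral_iff less_imp_le)
  qed
  have x: "0 \<le> r\<^sup>2 * (T / n)" "r\<^sup>2 * (T / n) \<le> 1" using n T by auto
  have "expectation (\<lambda>\<omega>. (Z \<omega>)\<^sup>2) \<le> (\<Sum>i<j. exp (r\<^sup>2 * T) * (r\<^sup>2 * (T / n))\<^sup>2)"
    unfolding Zorth(3)
  proof (intro sum_mono mult_mono)
    fix i assume "i \<in> {..<j}"
    then have "t i \<le> T" using g(6)[of i n] g(2) j by auto
    then show "exp (r\<^sup>2 * t i) \<le> exp (r\<^sup>2 * T)" by (simp add: mult_left_mono)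
    show "exp (r\<^sup>2 * (T / n)) - 1 - r\<^sup>2 * (T / n) \<le> (r\<^sup>2 * (T / n))\<^sup>2" by (rule exp_remainder_le[OF x])
    show "0 \<le> exp (r\<^sup>2 * (T / n)) - 1 - r\<^sup>2 * (T / n)" using exp_ge_add_one_self[of "r\<^sup>2 * (T / n)"] by linarith
  qed auto
  also have "\<dots> \<le> real n * (exp (r\<^sup>2 * T) * (r\<^sup>2 * (T / n))\<^sup>2)"
    using j by (simp add: mult_right_mono)
  also have "\<dots> = (exp (r\<^sup>2 * T) * (r\<^sup>2 * T)\<^sup>2) / n"
    using n by (simp add: power2_eq_square field_simps)
  finally have EZ: "expectation (\<lambda>\<omega>. (Z \<omega>)\<^sup>2) \<le> (exp (r\<^sup>2 * T) * (r\<^sup>2 * T)\<^sup>2) / n" .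
  have Z_eq: "exp_mart r (t j) \<omega> - exp_mart r (t 0) \<omega> - euler_sum r (exp_mart r) t j \<omega> = Z \<omega>" for \<omega>
  proof -
    have "exp_mart r (t j) \<omega> - exp_mart r (t 0) \<omega> = (\<Sum>i<j. exp_mart r (t (Suc i)) \<omega> - exp_mart r (t i) \<omega>)"
      by (rule sum_lessThan_telescope[symmetric])
    also have "\<dots> = (\<Sum>i<j. exp_mart r (t i) \<omega> * (exp (r * (B (t (Suc i)) \<omega> - B (t i) \<omega>)) * exp (- (r\<^sup>2 * (T / n) / 2)) - 1))"
    proof (intro sum.cong refl)
      fix i
      have "exp_mart r (t (Suc i)) \<omega> = exp_mart r (t i) \<omega> * (exp (r * (B (t (Suc i)) \<omega> - B (t i) \<omega>)) * exp (- (r\<^sup>2 * (T / n) / 2)))"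
        using exp_mart_step[of r "t (Suc i)" \<omega> "t i"] unfolding g(4) .
      then show "exp_mart r (t (Suc i)) \<omega> - exp_mart r (t i) \<omega> = exp_mart r (t i) \<omega> * (exp (r * (B (t (Suc i)) \<omega> - B (t i) \<omega>)) * exp (- (r\<^sup>2 * (T / n) / 2)) - 1)"
        by (simp only: right_diff_distrib mult_1_right)
    qed
    finally show ?thesis
      unfolding Z_def z_def by (simp only: sum_subtractf[symmetric]) (intro sum.cong refl, simp add: algebra_simps)
  qed
  have "AE \<omega> in M. \<omega> \<in> {\<omega> \<in> space M. \<bar>exp_mart r (t j) \<omega> - 1 - euler_sum r (exp_mart r) t j \<omega>\<bar> > \<delta>} \<longrightarrow> \<omega> \<in> {\<omega> \<in> space M. \<bar>Z \<omega>\<bar> > \<delta>}"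
    using exp_mart_0[of r]
  proof eventually_elim
    fix \<omega> assume "exp_mart r 0 \<omega> = 1"
    then show "\<omega> \<in> {\<omega> \<in> space M. \<bar>exp_mart r (t j) \<omega> - 1 - euler_sum r (exp_mart r) t j \<omega>\<bar> > \<delta>} \<longrightarrow> \<omega> \<in> {\<omega> \<in> space M. \<bar>Z \<omega>\<bar> > \<delta>}"
      using Z_eq[of \<omega>] by (simp add: g(1))
  qed
  then have "prob {\<omega> \<in> space M. \<bar>exp_mart r (t j) \<omega> - 1 - euler_sum r (exp_mart r) t j \<omega>\<bar> > \<delta>} \<le> prob {\<omega> \<in> space M. \<bar>Z \<omega>\<bar> > \<delta>}"
    using Zorth(1) by (intro finite_measure_mono_AE) auto
  also have "\<dots> \<le> expectation (\<lambda>\<omega>. (Z \<omega>)\<^sup>2) / \<delta>\<^sup>2"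
    by (rule prob_gt_le_second_moment[OF Zorth(1,2) \<delta>])
  also have "\<dots> \<le> ((exp (r\<^sup>2 * T) * (r\<^sup>2 * T)\<^sup>2) / n) / \<delta>\<^sup>2"
    using EZ by (rule divide_right_mono) simp
  finally show ?thesis by (simp add: t_def mult.commute)
qed

end

lemma (in prob_space) tendsto_zero_in_prob_measure:
  assumes "tendsto_zero_in_prob M Z" "\<epsilon> > 0"
  shows "(\<lambda>n. measure M {\<omega> \<in> space M. \<epsilon> < Z n \<omega>}) \<longlonglongrightarrow> 0"
proof -
  have "(\<lambda>n. emeasure M {\<omega> \<in> space M. \<epsilon> < Z n \<omega>}) \<longlonglongrightarrow> 0"
    using assms by (auto simp: tendsto_zero_in_prob_def)
  then have "(\<lambda>n. ennreal (measure M {\<omega> \<in> space M. \<epsilon> < Z n \<omega>})) \<longlonglongrightarrow> ennreal 0"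
    by (simp add: emeasure_eq_measure)
  then show ?thesis by (rule tendsto_ennrealD) auto
qed

section \<open>Identification of the price with the exponential martingale\<close>

locale driftless_price = brownian_space M F B
  for M :: "'a measure" and F B +
  fixes \<sigma> p :: real and X :: "real \<Rightarrow> 'a \<Rightarrow> real"
  assumes gbm: "geometric_brownian_motion M F B 0 \<sigma> p X" and \<sigma>_pos: "\<sigma> > 0" and p_pos: "p > 0"
begin

lemma X_F_measurable: "0 \<le> t \<Longrightarrow> X t \<in> borel_measurable (F (ennreal t))"
  using gbm by (simp add: geometric_brownian_motion_def)

lemma X_measurable: "0 \<le> t \<Longrightarrow> X t \<in> borel_measurable M"
  using X_F_measurable F_measurable by blast

lemma AE_X_continuous: "AE \<omega> in M. continuous_on {0..} (\<lambda>t. X t \<omega>)"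
  using gbm by (simp add: geometric_brownian_motion_def)

lemma AE_X_0: "AE \<omega> in M. X 0 \<omega> = p"
  using gbm by (simp add: geometric_brownian_motion_def)

lemma X_ito: "0 \<le> t \<Longrightarrow> has_ito_integral M F B (\<lambda>u \<omega>. \<sigma> * X u \<omega>) t (\<lambda>\<omega>. X t \<omega> - p)"
  using gbm by (simp add: geometric_brownian_motion_def set_lebesgue_integral_def)

text \<open>The integrand \<open>\<sigma> * X\<close> is approximated twice: by the elementary
  integrands from the definition of the integral, and by its values frozen at grid points, which on
  \<open>G\<close> are off by at most \<open>\<sigma> * \<kappa>\<close>. Lenglart's inequality
  compares the two elementary integrals.\<close>

lemma X_euler_error_step:
  assumes T: "T > 0" and n: "n > 0" and j: "j \<le> n" and \<delta>: "\<delta> > 0" "\<delta>' > 0"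
    and \<kappa>: "2 * (\<sigma> * \<kappa>)\<^sup>2 * T \<le> \<delta>' / 2" and G: "G \<in> sets M"
    and osc: "AE \<omega> in M. \<omega> \<in> G \<longrightarrow>
      (\<forall>i<n. \<forall>u. grid T n i < u \<and> u \<le> grid T n (Suc i) \<longrightarrow> \<bar>X u \<omega> - X (grid T n i) \<omega>\<bar> \<le> \<kappa>)"
  shows "prob {\<omega> \<in> space M. \<bar>X (grid T n j) \<omega> - p - euler_sum \<sigma> X (grid T n) j \<omega>\<bar> > \<delta>}
    \<le> prob (space M - G) + 4 * \<delta>' / \<delta>\<^sup>2"
proof -
  define s where "s = grid T n"
  note g = grid_simps[OF T n, folded s_def]
  define t where "t = s j"
  have t: "0 \<le> t" "t \<le> T" using g(5)[of j] g(6)[OF j] g(2) by (auto simp: t_def)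
  define J where "J = elementary_integral B j s (\<lambda>i \<omega>. \<sigma> * X (s i) \<omega>)"
  define \<psi> where "\<psi> = elementary_process j s (\<lambda>i \<omega>. \<sigma> * X (s i) \<omega>)"
  obtain N r \<xi> where E: "\<And>m. elementary_integrand F t (N m) (r m) (\<xi> m)"
    and Z1: "tendsto_zero_in_prob M (\<lambda>m \<omega>. \<integral>\<^sup>+u\<in>{0..t}.
             ennreal ((elementary_process (N m) (r m) (\<xi> m) u \<omega> - \<sigma> * X u \<omega>)\<^sup>2) \<partial>lborel)"
    and Z2: "tendsto_zero_in_prob M (\<lambda>m \<omega>. ennreal \<bar>elementary_integral B (N m) (r m) (\<xi> m) \<omega> - (X t \<omega> - p)\<bar>)"
    using X_ito[OF t(1)] unfolding has_ito_integral_def by auto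
  define I where "I m = elementary_integral B (N m) (r m) (\<xi> m)" for m
  define \<phi> where "\<phi> m = elementary_process (N m) (r m) (\<xi> m)" for m
  \<comment> \<open>Half of \<open>\<delta>\<close> is spent on replacing \<open>X t - p\<close> by
    an elementary integral; the other half is the level in Lenglart's inequality, whence the term
    \<open>\<delta>' / (\<delta> / 2)\<^sup>2\<close>.\<close>
  define a where "a m = prob {\<omega> \<in> space M. ennreal (\<delta> / 2) < ennreal \<bar>I m \<omega> - (X t \<omega> - p)\<bar>}" for m
  \<comment> \<open>\<open>nn_integral_square_le\<close> doubles \<open>\<delta>' / 4\<close> into
    half of the budget \<open>\<delta>'\<close>; freezing the price uses the other half.\<close>
  define b where "b m = prob {\<omega> \<in> space M. ennreal (\<delta>' / 4) < (\<integral>\<^sup>+u\<in>{0..t}. ennreal ((\<phi> m u \<omega> - \<sigma> * X u \<omega>)\<^sup>2) \<partial>lborel)}" for m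
  have a_lim: "a \<longlonglongrightarrow> 0" unfolding a_def[abs_def] I_def
    using tendsto_zero_in_prob_measure[OF Z2] \<delta> by (simp add: ennreal_zero_less_divide)
  have b_lim: "b \<longlonglongrightarrow> 0" unfolding b_def[abs_def] \<phi>_def
    using tendsto_zero_in_prob_measure[OF Z1] \<delta> by simp
  have am: "{\<omega> \<in> space M. ennreal (\<delta> / 2) < ennreal \<bar>I m \<omega> - (X t \<omega> - p)\<bar>} \<in> sets M" for m
  proof -
    have "(\<lambda>\<omega>. ennreal \<bar>I m \<omega> - (X t \<omega> - p)\<bar>) \<in> borel_measurable M"
      using Z2 unfolding tendsto_zero_in_prob_def I_def by blast
    then show ?thesis by measurable
  qed
  have bm': "{\<omega> \<in> space M. ennreal (\<delta>' / 4) < (\<integral>\<^sup>+u\<in>{0..t}. ennreal ((\<phi> m u \<omega> - \<sigma> * X u \<omega>)\<^sup>2) \<partial>lborel)} \<in> sets M" for m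
  proof -
    have "(\<lambda>\<omega>. \<integral>\<^sup>+u\<in>{0..t}. ennreal ((\<phi> m u \<omega> - \<sigma> * X u \<omega>)\<^sup>2) \<partial>lborel) \<in> borel_measurable M"
      using Z1 unfolding tendsto_zero_in_prob_def \<phi>_def by blast
    then show ?thesis by (intro borel_measurable_less borel_measurable_const)
  qed
  have sX: "(\<lambda>\<omega>. \<sigma> * X (s i) \<omega>) \<in> borel_measurable (F (ennreal (s i)))" for i
    using X_F_measurable[OF g(5)[of i]] by simp
  have IM: "I m \<in> borel_measurable M" for m
  proof -
    have r: "r m 0 = 0" "\<And>i. i < N m \<Longrightarrow> r m i \<le> r m (Suc i)"
      "\<And>i. i < N m \<Longrightarrow> \<xi> m i \<in> borel_measurable (F (ennreal (r m i)))"
      using E[of m] by (auto simp: elementary_integrand_def)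
    have "0 \<le> r m i" if "i \<le> N m" for i
      using partition_mono[of "N m" "r m" 0 i] r that by auto
    then show ?thesis
      unfolding I_def elementary_integral_def[abs_def] using F_measurable[OF r(3)]
      by (intro borel_measurable_sum borel_measurable_times borel_measurable_diff B_measurable) auto
  qed
  have JM: "J \<in> borel_measurable M"
    unfolding J_def elementary_integral_def[abs_def] using X_measurable[OF g(5)]
    by (intro borel_measurable_sum borel_measurable_times borel_measurable_diff B_measurable g(5)) auto
  have XM: "X t \<in> borel_measurable M" using X_measurable t by simp
  have \<psi>_eq: "\<psi> u \<omega> = \<sigma> * X (s i) \<omega>" if "i < j" "s i < u" "u \<le> s (Suc i)" for i u \<omega>
    unfolding \<psi>_def using elementary_process_eq[of j s i u] g(3) that by simp
  have bound: "prob {\<omega> \<in> space M. \<bar>X t \<omega> - p - J \<omega>\<bar> > \<delta>} \<le> a m + b m + (prob (space M - G) + 4 * \<delta>' / \<delta>\<^sup>2)" for m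
  proof -
    have "{\<omega> \<in> space M. \<bar>X t \<omega> - p - J \<omega>\<bar> > \<delta>} \<subseteq>
       {\<omega> \<in> space M. ennreal (\<delta> / 2) < ennreal \<bar>I m \<omega> - (X t \<omega> - p)\<bar>} \<union> {\<omega> \<in> space M. \<bar>I m \<omega> - J \<omega>\<bar> > \<delta> / 2}"
    proof
      fix \<omega> assume \<omega>: "\<omega> \<in> {\<omega> \<in> space M. \<bar>X t \<omega> - p - J \<omega>\<bar> > \<delta>}"
      have "\<bar>X t \<omega> - p - J \<omega>\<bar> \<le> \<bar>I m \<omega> - (X t \<omega> - p)\<bar> + \<bar>I m \<omega> - J \<omega>\<bar>" by arith
      then have "\<delta> / 2 < \<bar>I m \<omega> - (X t \<omega> - p)\<bar> \<or> \<delta> / 2 < \<bar>I m \<omega> - J \<omega>\<bar>" using \<omega> by auto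
      then show "\<omega> \<in> {\<omega> \<in> space M. ennreal (\<delta> / 2) < ennreal \<bar>I m \<omega> - (X t \<omega> - p)\<bar>} \<union> {\<omega> \<in> space M. \<bar>I m \<omega> - J \<omega>\<bar> > \<delta> / 2}"
        using \<omega> \<delta> by (auto simp: ennreal_less_iff)
    qed
    then have "prob {\<omega> \<in> space M. \<bar>X t \<omega> - p - J \<omega>\<bar> > \<delta>} \<le> prob (
       {\<omega> \<in> space M. ennreal (\<delta> / 2) < ennreal \<bar>I m \<omega> - (X t \<omega> - p)\<bar>} \<union> {\<omega> \<in> space M. \<bar>I m \<omega> - J \<omega>\<bar> > \<delta> / 2})"
      using am IM JM by (intro finite_measure_mono) auto
    also have "\<dots> \<le> a m + prob {\<omega> \<in> space M. \<bar>I m \<omega> - J \<omega>\<bar> > \<delta> / 2}"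
      unfolding a_def using am IM JM by (intro measure_Un_le) auto
    also have "prob {\<omega> \<in> space M. \<bar>I m \<omega> - J \<omega>\<bar> > \<delta> / 2} \<le>
       prob {\<omega> \<in> space M. (\<integral>\<^sup>+u\<in>{0..t}. ennreal ((\<phi> m u \<omega> - \<psi> u \<omega>)\<^sup>2) \<partial>lborel) > ennreal \<delta>'} + \<delta>' / (\<delta> / 2)\<^sup>2"
      unfolding I_def J_def \<phi>_def \<psi>_def
      by (rule elementary_lenglart) (use E[of m] sX g \<delta> in \<open>auto simp: elementary_integrand_def t_def less_imp_le\<close>)
    also have "prob {\<omega> \<in> space M. (\<integral>\<^sup>+u\<in>{0..t}. ennreal ((\<phi> m u \<omega> - \<psi> u \<omega>)\<^sup>2) \<partial>lborel) > ennreal \<delta>'} \<le>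
       prob ({\<omega> \<in> space M. ennreal (\<delta>' / 4) < (\<integral>\<^sup>+u\<in>{0..t}. ennreal ((\<phi> m u \<omega> - \<sigma> * X u \<omega>)\<^sup>2) \<partial>lborel)} \<union> (space M - G))"
    proof (rule finite_measure_mono_AE)
      show "AE \<omega> in M. \<omega> \<in> {\<omega> \<in> space M. (\<integral>\<^sup>+u\<in>{0..t}. ennreal ((\<phi> m u \<omega> - \<psi> u \<omega>)\<^sup>2) \<partial>lborel) > ennreal \<delta>'} \<longrightarrow>
        \<omega> \<in> {\<omega> \<in> space M. ennreal (\<delta>' / 4) < (\<integral>\<^sup>+u\<in>{0..t}. ennreal ((\<phi> m u \<omega> - \<sigma> * X u \<omega>)\<^sup>2) \<partial>lborel)} \<union> (space M - G)"
        using osc AE_X_continuous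
      proof (eventually_elim, intro impI)
        fix \<omega>
        assume o: "\<omega> \<in> G \<longrightarrow> (\<forall>i<n. \<forall>u. grid T n i < u \<and> u \<le> grid T n (Suc i) \<longrightarrow> \<bar>X u \<omega> - X (grid T n i) \<omega>\<bar> \<le> \<kappa>)"
          and c: "continuous_on {0..} (\<lambda>t. X t \<omega>)"
          and \<omega>: "\<omega> \<in> {\<omega> \<in> space M. (\<integral>\<^sup>+u\<in>{0..t}. ennreal ((\<phi> m u \<omega> - \<psi> u \<omega>)\<^sup>2) \<partial>lborel) > ennreal \<delta>'}"
        show "\<omega> \<in> {\<omega> \<in> space M. ennreal (\<delta>' / 4) < (\<integral>\<^sup>+u\<in>{0..t}. ennreal ((\<phi> m u \<omega> - \<sigma> * X u \<omega>)\<^sup>2) \<partial>lborel)} \<union> (space M - G)"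
        proof (rule ccontr)
          assume "\<not> ?thesis"
          then have \<omega>G: "\<omega> \<in> G" and le: "(\<integral>\<^sup>+u\<in>{0..t}. ennreal ((\<phi> m u \<omega> - \<sigma> * X u \<omega>)\<^sup>2) \<partial>lborel) \<le> ennreal (\<delta>' / 4)"
            using \<omega> by (auto simp: not_less)
          have "(\<integral>\<^sup>+u\<in>{0..t}. ennreal ((\<phi> m u \<omega> - \<psi> u \<omega>)\<^sup>2) \<partial>lborel)
            \<le> 2 * (\<integral>\<^sup>+u\<in>{0..t}. ennreal ((\<phi> m u \<omega> - \<sigma> * X u \<omega>)\<^sup>2) \<partial>lborel) + ennreal (2 * (\<sigma> * \<kappa>)\<^sup>2 * t)"
          proof (rule nn_integral_square_le)
            show "(\<lambda>u. \<phi> m u \<omega>) \<in> borel_measurable borel"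
              unfolding \<phi>_def elementary_process_def by measurable
            show "continuous_on {0..t} (\<lambda>u. \<sigma> * X u \<omega>)"
              using continuous_on_subset[OF c] by (intro continuous_on_mult continuous_on_const) auto
            fix u assume u: "0 < u" "u \<le> t"
            obtain i where i: "i < j" "s i < u" "u \<le> s (Suc i)"
              using partition_interval[of s u j] u g(1) by (auto simp: t_def)
            have "\<bar>X u \<omega> - X (s i) \<omega>\<bar> \<le> \<kappa>"
              using o \<omega>G i j unfolding s_def by auto
            then have "\<sigma> * \<bar>X u \<omega> - X (s i) \<omega>\<bar> \<le> \<sigma> * \<kappa>"
              using \<sigma>_pos by simp
            then show "\<bar>\<sigma> * X u \<omega> - \<psi> u \<omega>\<bar> \<le> \<sigma> * \<kappa>"
              using \<sigma>_pos unfolding \<psi>_eq[OF i] right_diff_distrib[symmetric] abs_mult by simp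
          qed (use t in auto)
          also have "\<dots> \<le> 2 * ennreal (\<delta>' / 4) + ennreal (\<delta>' / 2)"
          proof (intro add_mono mult_left_mono le ennreal_leI)
            have "2 * (\<sigma> * \<kappa>)\<^sup>2 * t \<le> 2 * (\<sigma> * \<kappa>)\<^sup>2 * T" using t by (intro mult_left_mono) auto
            then show "2 * (\<sigma> * \<kappa>)\<^sup>2 * t \<le> \<delta>' / 2" using \<kappa> by simp
          qed auto
          also have "\<dots> = ennreal (2 * (\<delta>' / 4) + \<delta>' / 2)"
          proof -
            have "2 * ennreal (\<delta>' / 4) = ennreal (2 * (\<delta>' / 4))"
              using \<delta> by (subst ennreal_mult) auto
            then show ?thesis using \<delta> by (simp add: ennreal_plus[symmetric] del: ennreal_plus)
          qed
          also have "\<dots> = ennreal \<delta>'" by simp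
          finally show False using \<omega> by auto
        qed
      qed
    qed (use bm' G in auto)
    also have "\<dots> \<le> b m + prob (space M - G)"
      unfolding b_def using bm' G by (intro measure_Un_le) auto
    finally show ?thesis by (simp add: power2_eq_square algebra_simps)
  qed
  \<comment> \<open>The left side of \<open>bound\<close> does not depend on \<open>m\<close>, so
    letting \<open>m\<close> tend to infinity removes \<open>a\<close> and \<open>b\<close>.\<close>
  have "(\<lambda>m. a m + b m + (prob (space M - G) + 4 * \<delta>' / \<delta>\<^sup>2)) \<longlonglongrightarrow> 0 + 0 + (prob (space M - G) + 4 * \<delta>' / \<delta>\<^sup>2)"
    by (intro tendsto_intros a_lim b_lim)
  from LIMSEQ_le_const[OF this] bound
  have "prob {\<omega> \<in> space M. \<bar>X t \<omega> - p - J \<omega>\<bar> > \<delta>} \<le> prob (space M - G) + 4 * \<delta>' / \<delta>\<^sup>2" by auto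
  then show ?thesis by (simp add: t_def J_def s_def elementary_integral_def)
qed

lemma X_euler_error:
  assumes T: "T > 0" and \<delta>: "\<delta> > 0" and \<eta>: "\<eta> > 0"
  shows "\<forall>\<^sub>F n in sequentially. \<forall>j\<le>n. prob {\<omega> \<in> space M. \<bar>X (grid T n j) \<omega> - p - euler_sum \<sigma> X (grid T n) j \<omega>\<bar> > \<delta>} \<le> \<eta>"
proof -
  \<comment> \<open>Makes the Lenglart term equal to \<open>\<eta> / 2\<close>. The choice of
    \<open>\<kappa>\<close> below turns the freezing error
    \<open>2 * (\<sigma> * \<kappa>)\<^sup>2 * T\<close> into \<open>\<delta>' / 2\<close>.\<close>
  define \<delta>' where "\<delta>' = \<eta> * \<delta>\<^sup>2 / 8"
  have \<delta>': "\<delta>' > 0" "4 * \<delta>' / \<delta>\<^sup>2 = \<eta> / 2" using \<delta> \<eta> by (auto simp: \<delta>'_def)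
  define \<kappa> where "\<kappa> = sqrt (\<delta>' / (4 * (\<sigma>\<^sup>2 * T)))"
  have st: "\<sigma>\<^sup>2 * T > 0" using \<sigma>_pos T by simp
  have \<kappa>: "\<kappa> > 0" using \<delta>' st by (simp add: \<kappa>_def)
  have "\<kappa>\<^sup>2 = \<delta>' / (4 * (\<sigma>\<^sup>2 * T))" using \<delta>' st by (simp add: \<kappa>_def)
  then have \<kappa>2: "2 * (\<sigma> * \<kappa>)\<^sup>2 * T \<le> \<delta>' / 2"
    using \<sigma>_pos T by (simp add: power_mult_distrib field_simps)
  \<comment> \<open>Only rational times enter, so that \<open>G n\<close> is an event; by continuity
    \<open>osc\<close> extends the bound to all times of a cell.\<close>
  define G where "G n = {\<omega> \<in> space M. \<forall>i\<in>{..<n}. \<forall>q\<in>\<rat> \<inter> {grid T n i<..<grid T n (Suc i)}. \<bar>X q \<omega> - X (grid T n i) \<omega>\<bar> \<le> \<kappa>}" for n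
  have grid0: "0 \<le> grid T n i" for n i using T by (simp add: grid_def)
  have GM: "G n \<in> sets M" for n
  proof -
    have *: "countable (\<rat> \<inter> {grid T n i<..<grid T n (Suc i)})" for i
      using countable_rat by blast
    have "X q \<in> borel_measurable M" if "q \<in> \<rat> \<inter> {grid T n i<..<grid T n (Suc i)}" for q i
      using that grid0[of n i] by (intro X_measurable) auto
    moreover have "X (grid T n i) \<in> borel_measurable M" for i using grid0 by (intro X_measurable) auto
    ultimately have "{\<omega> \<in> space M. \<forall>q\<in>\<rat> \<inter> {grid T n i<..<grid T n (Suc i)}. \<bar>X q \<omega> - X (grid T n i) \<omega>\<bar> \<le> \<kappa>} \<in> sets M" for i
      by (intro sets.sets_Collect_countable_All' *) measurable
    then show ?thesis unfolding G_def by (rule sets.sets_Collect_countable_All') (rule countable_finite, rule finite_lessThan)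
  qed
  have osc: "AE \<omega> in M. \<omega> \<in> G n \<longrightarrow>
      (\<forall>i<n. \<forall>u. grid T n i < u \<and> u \<le> grid T n (Suc i) \<longrightarrow> \<bar>X u \<omega> - X (grid T n i) \<omega>\<bar> \<le> \<kappa>)" for n
    using AE_X_continuous
  proof (eventually_elim, intro impI allI)
    fix \<omega> i u assume c: "continuous_on {0..} (\<lambda>t. X t \<omega>)" and \<omega>: "\<omega> \<in> G n" and i: "i < n"
      and u: "grid T n i < u \<and> u \<le> grid T n (Suc i)"
    show "\<bar>X u \<omega> - X (grid T n i) \<omega>\<bar> \<le> \<kappa>"
      by (rule continuous_approx_rational[OF c grid0[of n i]]) (use \<omega> i u in \<open>auto simp: G_def\<close>)
  qed
  \<comment> \<open>A continuous path is uniformly continuous on \<open>{0..T}\<close> and hence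
    passes the oscillation test on all sufficiently fine grids.\<close>
  have ev: "AE \<omega> in M. eventually (\<lambda>n. \<omega> \<in> G n) sequentially"
    using AE_X_continuous AE_space
  proof eventually_elim
    fix \<omega> assume c: "continuous_on {0..} (\<lambda>t. X t \<omega>)" and \<omega>: "\<omega> \<in> space M"
    have "uniformly_continuous_on {0..T} (\<lambda>t. X t \<omega>)"
      using continuous_on_subset[OF c, of "{0..T}"] by (intro compact_uniformly_continuous) auto
    then obtain d where d: "d > 0" "\<And>u v. u \<in> {0..T} \<Longrightarrow> v \<in> {0..T} \<Longrightarrow> dist u v < d \<Longrightarrow> dist (X u \<omega>) (X v \<omega>) < \<kappa>"
      using \<kappa> unfolding uniformly_continuous_on_def by metis
    have "\<forall>\<^sub>F n in sequentially. real n > T / d"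
      using filterlim_real_sequentially by (simp add: filterlim_at_top_dense)
    then show "eventually (\<lambda>n. \<omega> \<in> G n) sequentially"
    proof eventually_elim
      fix n assume n: "real n > T / d"
      then have "n > 0" using T d by (cases n) (auto simp: field_simps)
      note g = grid_simps[OF T this]
      have Tn: "T / n < d" using n d T \<open>n > 0\<close> by (simp add: field_simps)
      have "\<bar>X q \<omega> - X (grid T n i) \<omega>\<bar> \<le> \<kappa>" if i: "i < n" and q: "grid T n i < q" "q < grid T n (Suc i)" for i q
      proof -
        have "grid T n (Suc i) \<le> T" "grid T n i \<le> T" using g(6)[of "Suc i" n] g(6)[of i n] i g(2) by auto
        then have "dist (X q \<omega>) (X (grid T n i) \<omega>) < \<kappa>"
          using q g(5)[of i] g(4)[of i] Tn by (intro d(2)) (auto simp: dist_real_def)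
        then show ?thesis by (simp add: dist_real_def)
      qed
      then show "\<omega> \<in> G n" using \<omega> by (auto simp: G_def)
    qed
  qed
  have "(\<lambda>n. prob (G n)) \<longlonglongrightarrow> 1" by (rule AE_eventually_prob_tendsto[OF GM ev])
  then have "\<forall>\<^sub>F n in sequentially. 1 - \<eta> / 2 < prob (G n)"
    using \<eta> by (intro order_tendstoD) auto
  moreover have "\<forall>\<^sub>F n in sequentially. n > (0::nat)" by (rule eventually_gt_at_top)
  ultimately show ?thesis
  proof eventually_elim
    fix n assume n: "1 - \<eta> / 2 < prob (G n)" "0 < n"
    then have "prob (space M - G n) \<le> \<eta> / 2" using prob_compl[OF GM[of n]] by simp
    then show "\<forall>j\<le>n. prob {\<omega> \<in> space M. \<bar>X (grid T n j) \<omega> - p - euler_sum \<sigma> X (grid T n) j \<omega>\<bar> > \<delta>} \<le> \<eta>"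
      using X_euler_error_step[OF T n(2) _ \<delta> \<delta>'(1) \<kappa>2 GM osc] unfolding \<delta>'(2)
      by (intro allI impI) (rule order_trans, assumption, linarith)
  qed
qed

definition deviation :: "real \<Rightarrow> 'a \<Rightarrow> real" where
  "deviation t \<omega> = X t \<omega> - p * exp_mart \<sigma> t \<omega>"

lemma deviation_F_measurable: "0 \<le> t \<Longrightarrow> deviation t \<in> borel_measurable (F (ennreal t))"
  unfolding deviation_def[abs_def] using X_F_measurable exp_mart_F_measurable by auto

lemma deviation_measurable: "0 \<le> t \<Longrightarrow> deviation t \<in> borel_measurable M"
  using deviation_F_measurable F_measurable by blast

lemma AE_deviation_continuous: "AE \<omega> in M. continuous_on {0..} (\<lambda>t. deviation t \<omega>)"
  using AE_X_continuous AE_B_continuous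
  by eventually_elim (auto simp: deviation_def exp_mart_def intro!: continuous_intros)

text \<open>The scheme is linear in the process and the two initial values cancel, so the difference
  satisfies the homogeneous scheme up to the two errors already bounded.\<close>

lemma deviation_euler_error:
  assumes T: "T > 0" and \<delta>: "\<delta> > 0" and \<eta>: "\<eta> > 0"
  shows "\<forall>\<^sub>F n in sequentially. \<forall>j\<le>n. prob {\<omega> \<in> space M. \<bar>deviation (grid T n j) \<omega> - euler_sum \<sigma> deviation (grid T n) j \<omega>\<bar> > \<delta>} \<le> \<eta>"
proof -
  \<comment> \<open>The numerator of \<open>exp_mart_euler_error\<close> at level
    \<open>\<delta> / (2 * p)\<close>: that error is multiplied by \<open>p\<close> and may use half
    of \<open>\<delta>\<close>.\<close>
  define C where "C = exp (\<sigma>\<^sup>2 * T) * (\<sigma>\<^sup>2 * T)\<^sup>2 / (\<delta> / (2 * p))\<^sup>2"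
  have "\<forall>\<^sub>F n in sequentially. real n > 2 * C / \<eta>" "\<forall>\<^sub>F n in sequentially. real n > \<sigma>\<^sup>2 * T"
    "\<forall>\<^sub>F n in sequentially. n > (0::nat)"
    using filterlim_real_sequentially eventually_gt_at_top by (simp_all add: filterlim_at_top_dense)
  moreover note X_euler_error[OF T half_gt_zero[OF \<delta>] half_gt_zero[OF \<eta>]]
  ultimately show ?thesis
  proof eventually_elim
    fix n assume n: "real n > 2 * C / \<eta>" "real n > \<sigma>\<^sup>2 * T" "n > 0"
      and eX: "\<forall>j\<le>n. prob {\<omega> \<in> space M. \<bar>X (grid T n j) \<omega> - p - euler_sum \<sigma> X (grid T n) j \<omega>\<bar> > \<delta> / 2} \<le> \<eta> / 2"
    define t where "t = grid T n"
    note g = grid_simps[OF T n(3), folded t_def]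
    have Cn: "C / n \<le> \<eta> / 2" using n \<eta> by (simp add: field_simps)
    have "\<sigma>\<^sup>2 * T / n \<le> 1" using n by simp
    note eS = exp_mart_euler_error[OF T n(3) this, of _ "\<delta> / (2 * p)", folded C_def t_def]
    note eX' = eX[folded t_def]
    show "\<forall>j\<le>n. prob {\<omega> \<in> space M. \<bar>deviation (grid T n j) \<omega> - euler_sum \<sigma> deviation (grid T n) j \<omega>\<bar> > \<delta>} \<le> \<eta>"
      unfolding t_def[symmetric]
    proof (intro allI impI)
      fix j assume j: "j \<le> n"
      define x where "x \<omega> = X (t j) \<omega> - p - euler_sum \<sigma> X t j \<omega>" for \<omega>
      define y where "y \<omega> = exp_mart \<sigma> (t j) \<omega> - 1 - euler_sum \<sigma> (exp_mart \<sigma>) t j \<omega>" for \<omega>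
      have xM: "x \<in> borel_measurable M" and yM: "y \<in> borel_measurable M"
        unfolding x_def[abs_def] y_def[abs_def]
        by (intro borel_measurable_sum borel_measurable_times borel_measurable_diff
            borel_measurable_const X_measurable exp_mart_measurable B_measurable g(5))+
      have eq: "deviation (t j) \<omega> - euler_sum \<sigma> deviation t j \<omega> = x \<omega> - p * y \<omega>" for \<omega>
      proof -
        have "euler_sum \<sigma> deviation t j \<omega> =
          euler_sum \<sigma> X t j \<omega> -
          p * euler_sum \<sigma> (exp_mart \<sigma>) t j \<omega>"
          unfolding sum_distrib_left sum_subtractf[symmetric] deviation_def
          by (intro sum.cong refl) (simp add: algebra_simps)
        then show ?thesis by (simp add: deviation_def x_def y_def algebra_simps)
      qed
      have "{\<omega> \<in> space M. \<bar>x \<omega> - p * y \<omega>\<bar> > \<delta>} \<subseteq> {\<omega> \<in> space M. \<bar>x \<omega>\<bar> > \<delta> / 2} \<union> {\<omega> \<in> space M. \<bar>y \<omega>\<bar> > \<delta> / (2 * p)}"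
      proof
        fix \<omega> assume \<omega>: "\<omega> \<in> {\<omega> \<in> space M. \<bar>x \<omega> - p * y \<omega>\<bar> > \<delta>}"
        have "\<bar>x \<omega> - p * y \<omega>\<bar> \<le> \<bar>x \<omega>\<bar> + p * \<bar>y \<omega>\<bar>"
          using abs_triangle_ineq4[of "x \<omega>" "p * y \<omega>"] p_pos by (simp add: abs_mult)
        then have "\<bar>x \<omega>\<bar> > \<delta> / 2 \<or> p * \<bar>y \<omega>\<bar> > \<delta> / 2" using \<omega> by auto
        then show "\<omega> \<in> {\<omega> \<in> space M. \<bar>x \<omega>\<bar> > \<delta> / 2} \<union> {\<omega> \<in> space M. \<bar>y \<omega>\<bar> > \<delta> / (2 * p)}"
          using \<omega> p_pos by (auto simp: field_simps)
      qed
      then have "prob {\<omega> \<in> space M. \<bar>x \<omega> - p * y \<omega>\<bar> > \<delta>} \<le> prob ({\<omega> \<in> space M. \<bar>x \<omega>\<bar> > \<delta> / 2} \<union> {\<omega> \<in> space M. \<bar>y \<omega>\<bar> > \<delta> / (2 * p)})"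
        using xM yM by (intro finite_measure_mono) auto
      also have "\<dots> \<le> prob {\<omega> \<in> space M. \<bar>x \<omega>\<bar> > \<delta> / 2} + prob {\<omega> \<in> space M. \<bar>y \<omega>\<bar> > \<delta> / (2 * p)}"
        using xM yM by (intro measure_Un_le) auto
      also have "prob {\<omega> \<in> space M. \<bar>x \<omega>\<bar> > \<delta> / 2} \<le> \<eta> / 2"
        unfolding x_def using eX' j by blast
      also have "prob {\<omega> \<in> space M. \<bar>y \<omega>\<bar> > \<delta> / (2 * p)} \<le> \<eta> / 2"
        unfolding y_def by (rule order_trans[OF eS Cn]) (use j \<delta> p_pos in auto)
      finally show "prob {\<omega> \<in> space M. \<bar>deviation (t j) \<omega> - euler_sum \<sigma> deviation t j \<omega>\<bar> > \<delta>} \<le> \<eta>"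
        unfolding eq by simp
    qed
  qed
qed

text \<open>
  Gronwall's argument in discrete time: switching off the Euler scheme once the deviation exceeds
  \<open>K\<close> makes it square integrable.
\<close>

lemma truncated_deviation_small:
  assumes T: "T > 0" and K: "K > 0" and \<epsilon>: "\<epsilon> > 0"
  obtains n where "n > 0"
    "expectation (\<lambda>\<omega>. (if \<forall>i\<le>n. \<bar>deviation (grid T n i) \<omega>\<bar> \<le> K then (deviation T \<omega>)\<^sup>2 else 0)) \<le> \<epsilon>"
proof -
  \<comment> \<open>Gronwall's inequality costs at most the factor
    \<open>exp (2 * \<sigma>\<^sup>2 * T)\<close>, which is divided out in advance.\<close>
  define c where "c = \<epsilon> * exp (- (2 * \<sigma>\<^sup>2 * T))"
  have c: "c > 0" using \<epsilon> by (simp add: c_def)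
  \<comment> \<open>\<open>c\<close> is split evenly: \<open>2 * \<delta>\<^sup>2\<close> pays for
    an error of the scheme of at most \<open>\<delta>\<close>, and \<open>K\<^sup>2 * \<eta>\<close>
    for the event of a larger error, where only the truncation bound is available.\<close>
  define \<delta> where "\<delta> = sqrt (c / 4)"
  define \<eta> where "\<eta> = c / (2 * K\<^sup>2)"
  have \<delta>: "\<delta> > 0" "2 * \<delta>\<^sup>2 = c / 2" and \<eta>: "\<eta> > 0" "K\<^sup>2 * \<eta> = c / 2"
    using c K by (auto simp: \<delta>_def \<eta>_def)
  have "\<forall>\<^sub>F n in sequentially. n > (0::nat)" by (rule eventually_gt_at_top)
  with deviation_euler_error[OF T \<delta>(1) \<eta>(1)]
  have "\<forall>\<^sub>F n in sequentially. n > 0 \<and> (\<forall>j\<le>n. prob {\<omega> \<in> space M. \<bar>deviation (grid T n j) \<omega> - euler_sum \<sigma> deviation (grid T n) j \<omega>\<bar> > \<delta>} \<le> \<eta>)"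
    by eventually_elim auto
  then obtain n where n: "n > 0" and err: "\<forall>j\<le>n. prob {\<omega> \<in> space M. \<bar>deviation (grid T n j) \<omega> - euler_sum \<sigma> deviation (grid T n) j \<omega>\<bar> > \<delta>} \<le> \<eta>"
    using eventually_happens' sequentially_bot by blast
  define t where "t = grid T n"
  note g = grid_simps[OF T n, folded t_def]
  define D where "D i \<omega> = deviation (t i) \<omega>" for i \<omega>
  \<comment> \<open>The test includes the current index, which bounds \<open>a\<close> by
    \<open>K\<close>, and looks no further, which keeps \<open>a\<close> adapted.\<close>
  define a where "a i \<omega> = (if \<forall>l\<le>i. \<bar>D l \<omega>\<bar> \<le> K then D i \<omega> else 0)" for i \<omega>
  define Z where "Z j \<omega> = (\<Sum>i<j. \<sigma> * a i \<omega> * (B (t (Suc i)) \<omega> - B (t i) \<omega>))" for j \<omega>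
  define e where "e j \<omega> = D j \<omega> - (\<Sum>i<j. \<sigma> * D i \<omega> * (B (t (Suc i)) \<omega> - B (t i) \<omega>))" for j \<omega>
  define u where "u j = expectation (\<lambda>\<omega>. (a j \<omega>)\<^sup>2)" for j
  have DF: "D i \<in> borel_measurable (F (ennreal (t j)))" if "i \<le> j" for i j
    unfolding D_def[abs_def]
    by (rule F_measurable_mono[OF deviation_F_measurable[OF g(5)]]) (use g(6)[OF that] in \<open>simp add: ennreal_leI\<close>)
  have DM: "D i \<in> borel_measurable M" for i using DF[of i i] F_measurable by blast
  have aF: "a j \<in> borel_measurable (F (ennreal (t j)))" for j
  proof -
    have "a j \<omega> = (\<Prod>l\<le>j. indicator {-K..K} (D l \<omega>)) * D j \<omega>" for \<omega>
    proof (cases "\<forall>l\<le>j. \<bar>D l \<omega>\<bar> \<le> K")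
      case True
      then have "(\<Prod>l\<le>j. indicator {-K..K} (D l \<omega>) :: real) = 1"
        by (intro prod.neutral) (auto simp: indicator_def abs_le_iff)
      then show ?thesis using True by (simp add: a_def)
    next
      case False
      then obtain l where l: "l \<le> j" "\<not> \<bar>D l \<omega>\<bar> \<le> K" by auto
      then have "indicator {-K..K} (D l \<omega>) = (0::real)" by (auto simp: indicator_def abs_le_iff)
      then have "(\<Prod>l\<le>j. indicator {-K..K} (D l \<omega>) :: real) = 0" using l by (intro prod_zero) auto
      then show ?thesis using False by (auto simp: a_def)
    qed
    moreover have "(\<lambda>\<omega>. indicator {-K..K} (D l \<omega>) :: real) \<in> borel_measurable (F (ennreal (t j)))" if "l \<le> j" for l
      by (rule measurable_compose[OF DF[OF that]]) simp
    ultimately show ?thesis using DF[of j j] by (auto intro!: borel_measurable_times borel_measurable_prod cong: measurable_cong)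
  qed
  have aM: "a j \<in> borel_measurable M" for j using aF F_measurable by blast
  have a_bound: "(a j \<omega>)\<^sup>2 \<le> K\<^sup>2" for j \<omega>
  proof -
    have "\<bar>a j \<omega>\<bar> \<le> K" using K by (auto simp: a_def)
    from power_mono[OF this, of 2] show ?thesis by simp
  qed
  have aI: "integrable M (\<lambda>\<omega>. (a j \<omega>)\<^sup>2)" for j
    using aM a_bound by (intro integrable_const_bound[where B="K\<^sup>2"]) auto
  have saF: "(\<lambda>\<omega>. \<sigma> * a j \<omega>) \<in> borel_measurable (F (ennreal (t j)))" for j using aF by simp
  have saI: "integrable M (\<lambda>\<omega>. (\<sigma> * a j \<omega>)\<^sup>2)" for j using aI by (simp add: power_mult_distrib)
  note iso = ito_isometry[of t _ "\<lambda>i \<omega>. \<sigma> * a i \<omega>", folded Z_def]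
  have t': "0 \<le> t 0" "t i \<le> t (Suc i)" for i using g(3)[of i] g(1) by auto
  have ZM: "Z j \<in> borel_measurable M" "integrable M (\<lambda>\<omega>. (Z j \<omega>)\<^sup>2)" for j
    using iso(1,2)[of j] t' saF saI by auto
  have EZ: "expectation (\<lambda>\<omega>. (Z j \<omega>)\<^sup>2) = \<sigma>\<^sup>2 * T / n * (\<Sum>i<j. u i)" for j
  proof -
    have "expectation (\<lambda>\<omega>. (Z j \<omega>)\<^sup>2) = (\<Sum>i<j. expectation (\<lambda>\<omega>. (\<sigma> * a i \<omega>)\<^sup>2) * (t (Suc i) - t i))"
      using iso(3)[of j] t' saF saI by auto
    also have "\<dots> = \<sigma>\<^sup>2 * T / n * (\<Sum>i<j. u i)"
      unfolding g(4) by (simp add: power_mult_distrib u_def sum_distrib_left mult_ac)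
    finally show ?thesis .
  qed
  have eM: "e j \<in> borel_measurable M" for j
    unfolding e_def[abs_def] using DM
    by (intro borel_measurable_sum borel_measurable_times borel_measurable_diff borel_measurable_const B_measurable g(5)) auto
  have pw: "(a j \<omega>)\<^sup>2 \<le> 2 * (Z j \<omega>)\<^sup>2 + 2 * \<delta>\<^sup>2 + K\<^sup>2 * indicator {\<omega> \<in> space M. \<bar>e j \<omega>\<bar> > \<delta>} \<omega>" if \<omega>: "\<omega> \<in> space M" for j \<omega>
  proof (cases "\<forall>l\<le>j. \<bar>D l \<omega>\<bar> \<le> K")
    case False
    then show ?thesis by (auto simp: a_def)
  next
    case True
    show ?thesis
    proof (cases "\<bar>e j \<omega>\<bar> > \<delta>")
      case True
      have "0 \<le> 2 * (Z j \<omega>)\<^sup>2 + 2 * \<delta>\<^sup>2" by simp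
      moreover have "indicator {\<omega> \<in> space M. \<bar>e j \<omega>\<bar> > \<delta>} \<omega> = (1::real)" using True \<omega> by simp
      ultimately show ?thesis using a_bound[of j \<omega>] by (simp only: mult_1_right)
    next
      case e: False
      \<comment> \<open>Up to index \<open>j\<close> the truncation has not acted, so the scheme
        driven by \<open>a\<close> is the one driven by the deviation.\<close>
      have "a i \<omega> = D i \<omega>" if "i \<le> j" for i using True that by (auto simp: a_def)
      then have eq: "a j \<omega> = Z j \<omega> + e j \<omega>" by (simp add: Z_def e_def)
      have "(e j \<omega>)\<^sup>2 \<le> \<delta>\<^sup>2" using power_mono[of "\<bar>e j \<omega>\<bar>" \<delta> 2] e by simp
      moreover have "0 \<le> (Z j \<omega> - e j \<omega>)\<^sup>2" by simp
      ultimately have "(a j \<omega>)\<^sup>2 \<le> 2 * (Z j \<omega>)\<^sup>2 + 2 * \<delta>\<^sup>2"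
        unfolding eq power2_sum power2_diff by linarith
      then show ?thesis using e by simp
    qed
  qed
  have "u j \<le> c + 2 * \<sigma>\<^sup>2 * T / n * (\<Sum>i<j. u i)" if j: "j \<le> n" for j
  proof -
    have "u j \<le> expectation (\<lambda>\<omega>. 2 * (Z j \<omega>)\<^sup>2 + 2 * \<delta>\<^sup>2 + K\<^sup>2 * indicator {\<omega> \<in> space M. \<bar>e j \<omega>\<bar> > \<delta>} \<omega>)"
      unfolding u_def using aI ZM eM pw by (intro integral_mono) (auto simp: emeasure_eq_measure)
    also have "\<dots> = 2 * expectation (\<lambda>\<omega>. (Z j \<omega>)\<^sup>2) + 2 * \<delta>\<^sup>2 + K\<^sup>2 * prob {\<omega> \<in> space M. \<bar>e j \<omega>\<bar> > \<delta>}"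
    proof -
      have "has_bochner_integral M (\<lambda>\<omega>. 2 * (Z j \<omega>)\<^sup>2 + 2 * \<delta>\<^sup>2 + K\<^sup>2 * indicator {\<omega> \<in> space M. \<bar>e j \<omega>\<bar> > \<delta>} \<omega>)
        (2 * expectation (\<lambda>\<omega>. (Z j \<omega>)\<^sup>2) + 2 * \<delta>\<^sup>2 + K\<^sup>2 * prob {\<omega> \<in> space M. \<bar>e j \<omega>\<bar> > \<delta>})"
        using ZM eM by (intro has_bochner_integral_add has_bochner_integral_mult_right has_bochner_integral_real_indicator)
          (auto simp: has_bochner_integral_iff prob_space emeasure_eq_measure)
      then show ?thesis by (simp add: has_bochner_integral_iff)
    qed
    also have "prob {\<omega> \<in> space M. \<bar>e j \<omega>\<bar> > \<delta>} \<le> \<eta>"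
      using err j unfolding e_def D_def t_def by auto
    finally show ?thesis using \<delta>(2) \<eta>(2) K by (simp add: EZ mult_left_mono)
  qed
  then have "u n \<le> c * (1 + 2 * \<sigma>\<^sup>2 * T / n) ^ n"
    using T by (intro discrete_gronwall[of n u]) auto
  also have "\<dots> \<le> c * exp (2 * \<sigma>\<^sup>2 * T / n) ^ n"
    using T c by (intro mult_left_mono power_mono exp_ge_add_one_self) auto
  also have "\<dots> = \<epsilon>"
    using n by (simp add: exp_of_nat_mult[symmetric] c_def exp_minus field_simps)
  finally have "u n \<le> \<epsilon>" .
  moreover have "u n = expectation (\<lambda>\<omega>. (if \<forall>i\<le>n. \<bar>deviation (grid T n i) \<omega>\<bar> \<le> K then (deviation T \<omega>)\<^sup>2 else 0))"
    unfolding u_def by (intro Bochner_Integration.integral_cong refl) (auto simp: a_def D_def g(2) t_def[symmetric])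
  ultimately show ?thesis using that[OF n] by simp
qed

text \<open>On \<open>H K\<close> no truncation ever acts, so the second moment of the deviation
  restricted to it is below every positive number. A continuous path is bounded on
  \<open>{0..t}\<close> and hence belongs to some \<open>H K\<close>.\<close>

lemma deviation_eq_0:
  assumes t: "0 \<le> t"
  shows "AE \<omega> in M. deviation t \<omega> = 0"
proof (cases "t = 0")
  case True
  then show ?thesis using AE_X_0 exp_mart_0[of \<sigma>] by (auto simp: deviation_def)
next
  case False
  then have t: "t > 0" using t by simp
  \<comment> \<open>The grid supplied by \<open>truncated_deviation_small\<close> depends on
    \<epsilon>, so the event \<open>H K\<close> has to speak of the points of all grids at
    once.\<close>
  define Q where "Q = {grid t n i |n i. n > 0 \<and> i \<le> n}"
  have "Q \<subseteq> (\<lambda>(n, i). grid t n i) ` UNIV" by (auto simp: Q_def)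
  then have Qc: "countable Q" by (meson countable_image countable_subset countableI_type)
  have Q: "0 \<le> q" "q \<le> t" if "q \<in> Q" for q
    using that t by (auto simp: Q_def grid_def field_simps mult_left_mono)
  define H where "H K = {\<omega> \<in> space M. \<forall>q\<in>Q. \<bar>deviation q \<omega>\<bar> \<le> K}" for K
  have HM: "H K \<in> sets M" for K
    unfolding H_def
  proof (rule sets.sets_Collect_countable_All'[OF _ Qc])
    fix q assume "q \<in> Q"
    then have "deviation q \<in> borel_measurable M" using Q by (intro deviation_measurable)
    then show "{\<omega> \<in> space M. \<bar>deviation q \<omega>\<bar> \<le> K} \<in> sets M" by measurable
  qed
  have dM: "deviation t \<in> borel_measurable M" using t by (intro deviation_measurable) auto
  have *: "AE \<omega> in M. \<omega> \<in> H K \<longrightarrow> deviation t \<omega> = 0" if K: "K > 0" for K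
  proof -
    have tQ: "t \<in> Q" unfolding Q_def using grid_simps(2)[OF t, of 1] by (intro CollectI exI[of _ 1]) auto
    have int: "integrable M (\<lambda>\<omega>. indicator (H K) \<omega> * (deviation t \<omega>)\<^sup>2)"
    proof (rule integrable_const_bound[where B="K\<^sup>2"])
      show "AE \<omega> in M. norm (indicator (H K) \<omega> * (deviation t \<omega>)\<^sup>2) \<le> K\<^sup>2"
      proof (rule AE_I2)
        fix \<omega>
        have "(deviation t \<omega>)\<^sup>2 \<le> K\<^sup>2" if "\<omega> \<in> H K"
        proof -
          have "\<bar>deviation t \<omega>\<bar> \<le> K" using that tQ by (auto simp: H_def)
          from power_mono[OF this, of 2] show ?thesis by simp
        qed
        then show "norm (indicator (H K) \<omega> * (deviation t \<omega>)\<^sup>2) \<le> K\<^sup>2" by (auto simp: indicator_def)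
      qed
    qed (use HM dM in auto)
    have "expectation (\<lambda>\<omega>. indicator (H K) \<omega> * (deviation t \<omega>)\<^sup>2) \<le> \<epsilon>" if "\<epsilon> > 0" for \<epsilon>
    proof -
      obtain n where n: "n > 0" "expectation (\<lambda>\<omega>. (if \<forall>i\<le>n. \<bar>deviation (grid t n i) \<omega>\<bar> \<le> K then (deviation t \<omega>)\<^sup>2 else 0)) \<le> \<epsilon>"
        using truncated_deviation_small[OF t K \<open>\<epsilon> > 0\<close>] by blast
      define f where "f \<omega> = (if \<forall>i\<le>n. \<bar>deviation (grid t n i) \<omega>\<bar> \<le> K then (deviation t \<omega>)\<^sup>2 else 0)" for \<omega>
      have gt: "grid t n n = t" using grid_simps(2)[OF t n(1)] .
      have "{\<omega> \<in> space M. \<forall>i\<in>{..n}. \<bar>deviation (grid t n i) \<omega>\<bar> \<le> K} \<in> sets M"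
      proof (rule sets.sets_Collect_countable_All')
        fix i
        have "deviation (grid t n i) \<in> borel_measurable M" using t by (intro deviation_measurable) (simp add: grid_def)
        then show "{\<omega> \<in> space M. \<bar>deviation (grid t n i) \<omega>\<bar> \<le> K} \<in> sets M" by measurable
      qed simp
      then have S: "{\<omega> \<in> space M. \<forall>i\<le>n. \<bar>deviation (grid t n i) \<omega>\<bar> \<le> K} \<in> sets M"
        by (simp only: Ball_def atMost_iff)
      have fM: "f \<in> borel_measurable M"
        unfolding f_def[abs_def] by (rule measurable_If[OF borel_measurable_power[OF dM] measurable_const S]) simp
      have fb: "\<bar>f \<omega>\<bar> \<le> K\<^sup>2" for \<omega>
      proof -
        have "(deviation t \<omega>)\<^sup>2 \<le> K\<^sup>2" if "\<forall>i\<le>n. \<bar>deviation (grid t n i) \<omega>\<bar> \<le> K"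
        proof -
          have "\<bar>deviation t \<omega>\<bar> \<le> K" using that gt by auto
          from power_mono[OF this, of 2] show ?thesis by simp
        qed
        then show ?thesis by (auto simp: f_def)
      qed
      have "integrable M f"
        using fM fb by (intro integrable_const_bound[where B="K\<^sup>2"]) auto
      moreover have "indicator (H K) \<omega> * (deviation t \<omega>)\<^sup>2 \<le> f \<omega>" for \<omega>
      proof (cases "\<omega> \<in> H K")
        case True
        have "\<forall>i\<le>n. \<bar>deviation (grid t n i) \<omega>\<bar> \<le> K" using True n by (auto simp: H_def Q_def)
        then show ?thesis using True by (simp add: f_def)
      qed (simp add: f_def)
      ultimately have "expectation (\<lambda>\<omega>. indicator (H K) \<omega> * (deviation t \<omega>)\<^sup>2) \<le> expectation f"
        using int by (intro integral_mono)
      then show ?thesis using n(2) unfolding f_def by linarith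
    qed
    then have "expectation (\<lambda>\<omega>. indicator (H K) \<omega> * (deviation t \<omega>)\<^sup>2) \<le> 0"
      by (rule field_le_epsilon) simp
    moreover have "0 \<le> expectation (\<lambda>\<omega>. indicator (H K) \<omega> * (deviation t \<omega>)\<^sup>2)"
      by (intro integral_nonneg_AE) auto
    ultimately have "AE \<omega> in M. indicator (H K) \<omega> * (deviation t \<omega>)\<^sup>2 = 0"
      using integral_nonneg_eq_0_iff_AE[OF int] by auto
    then show ?thesis by eventually_elim (auto simp: indicator_def)
  qed
  then have "AE \<omega> in M. \<forall>K::nat. \<omega> \<in> H (real (Suc K)) \<longrightarrow> deviation t \<omega> = 0"
    by (subst AE_all_countable) (auto simp del: of_nat_Suc)
  then show ?thesis
    using AE_deviation_continuous AE_space
  proof eventually_elim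
    fix \<omega> assume H: "\<forall>K::nat. \<omega> \<in> H (real (Suc K)) \<longrightarrow> deviation t \<omega> = 0"
      and c: "continuous_on {0..} (\<lambda>t. deviation t \<omega>)" and \<omega>: "\<omega> \<in> space M"
    have "compact ((\<lambda>t. deviation t \<omega>) ` {0..t})"
      using continuous_on_subset[OF c, of "{0..t}"] by (intro compact_continuous_image) auto
    then have "bounded ((\<lambda>t. deviation t \<omega>) ` {0..t})" by (rule compact_imp_bounded)
    then obtain b where "\<forall>x\<in>(\<lambda>t. deviation t \<omega>) ` {0..t}. norm x \<le> b"
      unfolding bounded_iff by blast
    then have b: "\<bar>deviation s \<omega>\<bar> \<le> b" if "s \<in> {0..t}" for s
      using that by auto
    obtain K :: nat where K: "b \<le> real K" using real_arch_simple by blast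
    have "\<bar>deviation q \<omega>\<bar> \<le> real (Suc K)" if "q \<in> Q" for q
      using b[of q] Q[OF that] K by auto
    then have "\<omega> \<in> H (real (Suc K))" using \<omega> by (auto simp: H_def)
    then show "deviation t \<omega> = 0" using H by blast
  qed
qed

theorem X_eq_exp_mart: "AE \<omega> in M. \<forall>t\<ge>0. X t \<omega> = p * exp_mart \<sigma> t \<omega>"
proof -
  have "AE \<omega> in M. \<forall>q\<in>\<rat> \<inter> {0..}. deviation q \<omega> = 0"
    by (subst AE_ball_countable) (auto intro: deviation_eq_0 countable_rat countable_subset[of _ \<rat>])
  then show ?thesis
    using AE_deviation_continuous
  proof eventually_elim
    fix \<omega> assume q: "\<forall>q\<in>\<rat> \<inter> {0..}. deviation q \<omega> = 0" and c: "continuous_on {0..} (\<lambda>t. deviation t \<omega>)"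
    have "deviation t \<omega> = 0" if "t \<ge> 0" for t
    proof (cases "t = 0")
      case True then show ?thesis using q by auto
    next
      case False
      have "\<bar>deviation t \<omega> - 0\<bar> \<le> 0"
        by (rule continuous_approx_rational[OF c, of 0 t]) (use that q False in auto)
      then show ?thesis by simp
    qed
    then show "\<forall>t\<ge>0. X t \<omega> = p * exp_mart \<sigma> t \<omega>" by (auto simp: deviation_def)
  qed
qed

end

section \<open>Optional stopping\<close>

context brownian_space
begin

text \<open>On the event \<open>\<kappa> = i\<close>, known at time \<open>t i\<close>, the
  martingale property replaces \<open>t i\<close> by the last time \<open>t m\<close>; summing over
  \<open>i\<close> recovers the full expectation at \<open>t m\<close>.\<close>

lemma exp_mart_discrete_stopping:
  fixes t :: "nat \<Rightarrow> real" and \<kappa> :: "'a \<Rightarrow> nat"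
  assumes t: "0 \<le> t 0" "\<And>i. i < m \<Longrightarrow> t i \<le> t (Suc i)"
    and \<kappa>: "\<And>\<omega>. \<omega> \<in> space M \<Longrightarrow> \<kappa> \<omega> \<le> m"
      "\<And>i. i \<le> m \<Longrightarrow> {\<omega> \<in> space M. \<kappa> \<omega> \<le> i} \<in> sets (F (ennreal (t i)))"
  shows "has_bochner_integral M (\<lambda>\<omega>. exp_mart r (t (\<kappa> \<omega>)) \<omega>) 1"
proof -
  define A where "A i = {\<omega> \<in> space M. \<kappa> \<omega> = i}" for i
  have t0: "0 \<le> t i" "t i \<le> t j" if "i \<le> j" "j \<le> m" for i j
    using partition_mono[of m t 0 i, OF t(2)] partition_mono[of m t i j, OF t(2)] that t(1) by auto
  have A: "A i \<in> sets (F (ennreal (t i)))" if "i \<le> m" for i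
  proof -
    have "A i = {\<omega> \<in> space M. \<kappa> \<omega> \<le> i} - (\<Union>l<i. {\<omega> \<in> space M. \<kappa> \<omega> \<le> l})"
      by (force simp: A_def)
    moreover have "{\<omega> \<in> space M. \<kappa> \<omega> \<le> l} \<in> sets (F (ennreal (t i)))" if "l < i" for l
      using \<kappa>(2)[of l] sets_F_mono[of "ennreal (t l)" "ennreal (t i)"] t0[of l i] that \<open>i \<le> m\<close>
      by (auto simp: ennreal_leI)
    ultimately show ?thesis using \<kappa>(2)[OF that] by auto
  qed
  have AM: "A i \<in> sets M" if "i \<le> m" for i using A[OF that] sets_F_subset by auto
  have ind: "(\<Sum>i\<le>m. f i * indicator (A i) \<omega>) = f (\<kappa> \<omega>)" if "\<omega> \<in> space M" for f :: "nat \<Rightarrow> real" and \<omega>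
  proof -
    have "(\<Sum>i\<le>m. f i * indicator (A i) \<omega>) = (\<Sum>i\<le>m. if i = \<kappa> \<omega> then f i else 0)"
      using that by (intro sum.cong) (auto simp: A_def indicator_def)
    then show ?thesis using \<kappa>(1)[OF that] by simp
  qed
  have "has_bochner_integral M (\<lambda>\<omega>. \<Sum>i\<le>m. exp_mart r (t i) \<omega> * indicator (A i) \<omega>)
     (\<Sum>i\<le>m. expectation (\<lambda>\<omega>. exp_mart r (t m) \<omega> * indicator (A i) \<omega>))"
  proof (rule has_bochner_integral_sum)
    fix i assume "i \<in> {..m}"
    then have i: "i \<le> m" by simp
    show "has_bochner_integral M (\<lambda>\<omega>. exp_mart r (t i) \<omega> * indicator (A i) \<omega>) (expectation (\<lambda>\<omega>. exp_mart r (t m) \<omega> * indicator (A i) \<omega>))"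
      using exp_mart_indicator[of "t i" "t m" "A i" r] exp_mart_indicator(1)[of "t i" "t i" "A i" r] t0[of i m] i A[OF i]
      by (auto simp: has_bochner_integral_iff)
  qed
  also have "(\<Sum>i\<le>m. expectation (\<lambda>\<omega>. exp_mart r (t m) \<omega> * indicator (A i) \<omega>)) = expectation (\<lambda>\<omega>. \<Sum>i\<le>m. exp_mart r (t m) \<omega> * indicator (A i) \<omega>)"
  proof (rule Bochner_Integration.integral_sum[symmetric])
    fix i assume "i \<in> {..m}"
    then show "integrable M (\<lambda>\<omega>. exp_mart r (t m) \<omega> * indicator (A i) \<omega>)"
      using exp_mart_indicator(1)[of "t i" "t m" "A i" r] t0[of i m] A[of i] by simp
  qed
  also have "\<dots> = expectation (exp_mart r (t m))"
    using ind[of _ "\<lambda>_. exp_mart r (t m) _"] by (intro Bochner_Integration.integral_cong refl) (rule ind)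
  also have "\<dots> = 1"
    using exp_mart_expectation[of "t m" r] t0[of m m] by (simp add: has_bochner_integral_iff)
  finally have "has_bochner_integral M (\<lambda>\<omega>. \<Sum>i\<le>m. exp_mart r (t i) \<omega> * indicator (A i) \<omega>) 1" .
  moreover have "has_bochner_integral M (\<lambda>\<omega>. \<Sum>i\<le>m. exp_mart r (t i) \<omega> * indicator (A i) \<omega>) 1 \<longleftrightarrow>
      has_bochner_integral M (\<lambda>\<omega>. exp_mart r (t (\<kappa> \<omega>)) \<omega>) 1"
    by (intro has_bochner_integral_cong refl) (rule ind)
  ultimately show ?thesis by blast
qed

text \<open>Doob's maximal inequality: stopped on reaching the level \<open>a\<close>, the
  martingale still has mean one, and Markov's inequality applies to the stopped value.\<close>

lemma exp_mart_maximal_finite: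
  assumes A: "finite A" "A \<subseteq> {0..}" and a: "a > 0"
  shows "prob {\<omega> \<in> space M. \<exists>q\<in>A. exp_mart r q \<omega> \<ge> a} \<le> 1 / a"
proof (cases "A = {}")
  case True then show ?thesis using a by simp
next
  case False
  obtain t m where t: "t ` {..m} = A" "\<And>i. i < m \<Longrightarrow> t i < t (Suc i)" "t 0 = Min A" "t m = Max A"
    using finite_set_enumeration[OF A(1) False] by metis
  have t0: "0 \<le> t 0" using A False t(3) Min_in[OF A(1) False] by auto
  have tle: "t i \<le> t (Suc i)" if "i < m" for i using t(2)[OF that] by simp
  \<comment> \<open>The first index at which the level is reached, and the last index if there is
    none.\<close>
  define \<kappa> where "\<kappa> \<omega> = (LEAST i. i = m \<or> exp_mart r (t i) \<omega> \<ge> a)" for \<omega>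
  have \<kappa>m: "\<kappa> \<omega> \<le> m" for \<omega> unfolding \<kappa>_def by (rule Least_le) simp
  have \<kappa>P: "\<kappa> \<omega> = m \<or> exp_mart r (t (\<kappa> \<omega>)) \<omega> \<ge> a" for \<omega>
    unfolding \<kappa>_def by (rule LeastI[of _ m]) simp
  have \<kappa>le: "\<kappa> \<omega> \<le> i \<longleftrightarrow> i = m \<or> (\<exists>l\<in>{..i}. exp_mart r (t l) \<omega> \<ge> a)" if "i \<le> m" for i \<omega>
  proof
    assume "\<kappa> \<omega> \<le> i" then show "i = m \<or> (\<exists>l\<in>{..i}. exp_mart r (t l) \<omega> \<ge> a)"
      using \<kappa>P[of \<omega>] that by auto
  next
    assume "i = m \<or> (\<exists>l\<in>{..i}. exp_mart r (t l) \<omega> \<ge> a)"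
    then show "\<kappa> \<omega> \<le> i"
    proof
      assume "\<exists>l\<in>{..i}. exp_mart r (t l) \<omega> \<ge> a"
      then obtain l where l: "l \<le> i" "exp_mart r (t l) \<omega> \<ge> a" by auto
      have "\<kappa> \<omega> \<le> l" unfolding \<kappa>_def by (rule Least_le) (use l in simp)
      then show ?thesis using l by simp
    qed (use \<kappa>m in auto)
  qed
  have tm: "0 \<le> t i" "t i \<le> t j" if "i \<le> j" "j \<le> m" for i j
    using partition_mono[of m t 0 i, OF tle] partition_mono[of m t i j, OF tle] that t0 by auto
  have hb: "has_bochner_integral M (\<lambda>\<omega>. exp_mart r (t (\<kappa> \<omega>)) \<omega>) 1"
  proof (rule exp_mart_discrete_stopping[OF t0 tle \<kappa>m])
    fix i assume i: "i \<le> m"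
    have "{\<omega> \<in> space M. i = m \<or> (\<exists>l\<in>{..i}. exp_mart r (t l) \<omega> \<ge> a)} \<in> sets (F (ennreal (t i)))"
    proof -
      have "{\<omega> \<in> space M. a \<le> exp_mart r (t l) \<omega>} \<in> sets (F (ennreal (t i)))" if "l \<le> i" for l
      proof -
        have "exp_mart r (t l) \<in> borel_measurable (F (ennreal (t i)))"
          by (rule F_measurable_mono[OF exp_mart_F_measurable]) (use tm[of l i] that i in \<open>auto simp: ennreal_leI\<close>)
        then have "{\<omega> \<in> space (F (ennreal (t i))). a \<le> exp_mart r (t l) \<omega>} \<in> sets (F (ennreal (t i)))" by measurable
        then show ?thesis by (simp add: space_F)
      qed
      then have U: "(\<Union>l\<in>{..i}. {\<omega> \<in> space M. a \<le> exp_mart r (t l) \<omega>}) \<in> sets (F (ennreal (t i)))"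
        by (intro sets.finite_UN) auto
      show ?thesis
      proof (cases "i = m")
        case True
        then have "{\<omega> \<in> space M. i = m \<or> (\<exists>l\<in>{..i}. exp_mart r (t l) \<omega> \<ge> a)} = space (F (ennreal (t i)))"
          by (auto simp: space_F)
        then show ?thesis by (simp only: sets.top)
      next
        case False
        then have "{\<omega> \<in> space M. i = m \<or> (\<exists>l\<in>{..i}. exp_mart r (t l) \<omega> \<ge> a)} = (\<Union>l\<in>{..i}. {\<omega> \<in> space M. a \<le> exp_mart r (t l) \<omega>})"
          by auto
        then show ?thesis using U by (simp only:)
      qed
    qed
    then show "{\<omega> \<in> space M. \<kappa> \<omega> \<le> i} \<in> sets (F (ennreal (t i)))"
      by (simp only: \<kappa>le[OF i])
  qed auto
  have sub: "{\<omega> \<in> space M. \<exists>q\<in>A. exp_mart r q \<omega> \<ge> a} \<subseteq> {\<omega> \<in> space M. exp_mart r (t (\<kappa> \<omega>)) \<omega> \<ge> a}"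
  proof safe
    fix \<omega> q assume "q \<in> A" "a \<le> exp_mart r q \<omega>"
    then obtain l where l: "l \<le> m" "a \<le> exp_mart r (t l) \<omega>" using t(1) by auto
    have "\<kappa> \<omega> \<le> l" unfolding \<kappa>_def by (rule Least_le) (use l in simp)
    then show "a \<le> exp_mart r (t (\<kappa> \<omega>)) \<omega>" using \<kappa>P[of \<omega>] l by auto
  qed
  have "(\<lambda>\<omega>. exp_mart r (t (\<kappa> \<omega>)) \<omega>) \<in> borel_measurable M"
    using hb by (auto simp: has_bochner_integral_iff dest: borel_measurable_integrable)
  then have "{\<omega> \<in> space M. exp_mart r (t (\<kappa> \<omega>)) \<omega> \<ge> a} \<in> sets M" by measurable
  then have "prob {\<omega> \<in> space M. \<exists>q\<in>A. exp_mart r q \<omega> \<ge> a} \<le> prob {\<omega> \<in> space M. exp_mart r (t (\<kappa> \<omega>)) \<omega> \<ge> a}"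
    by (rule finite_measure_mono[OF sub])
  also have "\<dots> \<le> expectation (\<lambda>\<omega>. exp_mart r (t (\<kappa> \<omega>)) \<omega>) / a"
    using hb a exp_mart_pos by (intro integral_Markov_inequality_measure[where A="{}"]) (auto simp: has_bochner_integral_iff less_imp_le)
  finally show ?thesis using hb by (simp add: has_bochner_integral_iff)
qed

lemma exp_mart_maximal:
  assumes a: "a > 0"
  shows "prob {\<omega> \<in> space M. \<exists>q\<in>\<rat> \<inter> {0..}. exp_mart r q \<omega> \<ge> a} \<le> 1 / a"
proof -
  define Q :: "real set" where "Q = \<rat> \<inter> {0..}"
  have Q: "countable Q" "Q \<noteq> {}" unfolding Q_def using countable_rat by (auto intro: exI[of _ 0])
  define q where "q = from_nat_into Q"
  have qQ: "range q = Q" unfolding q_def using Q by (simp add: range_from_nat_into)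
  then have q0: "0 \<le> q i" for i by (auto simp: Q_def)
  define E where "E m = {\<omega> \<in> space M. \<exists>i\<in>q ` {..m}. exp_mart r i \<omega> \<ge> a}" for m
  have EM: "E m \<in> sets M" for m
  proof -
    have "{\<omega> \<in> space M. exp_mart r (q l) \<omega> \<ge> a} \<in> sets M" for l
      using exp_mart_measurable[OF q0[of l], of r] by measurable
    then have "(\<Union>l\<in>{..m}. {\<omega> \<in> space M. exp_mart r (q l) \<omega> \<ge> a}) \<in> sets M" by (intro sets.finite_UN) auto
    also have "(\<Union>l\<in>{..m}. {\<omega> \<in> space M. exp_mart r (q l) \<omega> \<ge> a}) = E m" by (auto simp: E_def)
    finally show ?thesis .
  qed
  have inc: "incseq E" by (auto simp: incseq_def E_def intro: order_trans)
  have "(\<lambda>m. prob (E m)) \<longlonglongrightarrow> prob (\<Union>m. E m)"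
    using EM inc by (intro finite_Lim_measure_incseq) auto
  moreover have "prob (E m) \<le> 1 / a" for m
    unfolding E_def using q0 by (intro exp_mart_maximal_finite a) auto
  ultimately have "prob (\<Union>m. E m) \<le> 1 / a"
    by (intro LIMSEQ_le_const2) auto
  also have "(\<Union>m. E m) = {\<omega> \<in> space M. \<exists>q\<in>Q. exp_mart r q \<omega> \<ge> a}"
    unfolding E_def qQ[symmetric] by auto
  finally show ?thesis by (simp add: Q_def)
qed

text \<open>Reaching the level \<open>a\<close> has probability at most \<open>1 / a\<close>, so an
  unbounded path lies in a null set. Applied at volatility \<open>\<sigma> / 2\<close>, this alone
  will give the limit of the price.\<close>

lemma AE_exp_mart_bounded: "AE \<omega> in M. \<exists>a>0. \<forall>t\<ge>0. exp_mart r t \<omega> \<le> a"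
proof -
  define N where "N a = {\<omega> \<in> space M. \<exists>q\<in>\<rat> \<inter> {0..}. exp_mart r q \<omega> \<ge> a}" for a :: real
  have NM: "N a \<in> sets M" for a
  proof -
    have "{\<omega> \<in> space M. exp_mart r q \<omega> \<ge> a} \<in> sets M" if "q \<in> \<rat> \<inter> {0..}" for q
    proof -
      have "exp_mart r q \<in> borel_measurable M" using that by (intro exp_mart_measurable) auto
      then show ?thesis by measurable
    qed
    then show ?thesis unfolding N_def
      by (rule sets.sets_Collect_countable_Ex') (use countable_rat countable_subset[of _ \<rat>] in auto)
  qed
  have "(\<Inter>i. N (real (Suc i))) \<in> null_sets M"
  proof (rule null_setsI)
    have le: "prob (\<Inter>i. N (real (Suc i))) \<le> 1 / real (Suc i)" for i
    proof -
      have "prob (\<Inter>i. N (real (Suc i))) \<le> prob (N (real (Suc i)))"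
        using NM by (intro finite_measure_mono) auto
      also have "\<dots> \<le> 1 / real (Suc i)" unfolding N_def by (rule exp_mart_maximal) simp
      finally show ?thesis .
    qed
    have "prob (\<Inter>i. N (real (Suc i))) \<le> 0"
      by (rule LIMSEQ_le_const[OF LIMSEQ_inverse_real_of_nat]) (use le in \<open>auto simp: inverse_eq_divide\<close>)
    then show "emeasure M (\<Inter>i. N (real (Suc i))) = 0"
      by (simp add: emeasure_eq_measure measure_le_0_iff)
  qed (use NM in auto)
  then have "AE \<omega> in M. \<omega> \<notin> (\<Inter>i. N (real (Suc i)))" by (rule AE_not_in)
  then show ?thesis
    using AE_B_continuous AE_space
  proof eventually_elim
    fix \<omega> assume "\<omega> \<notin> (\<Inter>i. N (real (Suc i)))" and c: "continuous_on {0..} (\<lambda>t. B t \<omega>)" and \<omega>: "\<omega> \<in> space M"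
    then obtain i where i: "\<omega> \<notin> N (real (Suc i))" by auto
    define a where "a = real (Suc i)"
    have q: "exp_mart r q \<omega> \<le> a" if "q \<in> \<rat>" "0 \<le> q" for q
      using i \<omega> that by (force simp: N_def a_def not_le simp del: of_nat_Suc)
    have c': "continuous_on {0..} (\<lambda>t. exp_mart r t \<omega>)"
      unfolding exp_mart_def using c by (intro continuous_intros) auto
    have "exp_mart r t \<omega> \<le> a" if t: "t \<ge> 0" for t
    proof (cases "t = 0")
      case False
      \<comment> \<open>Being between \<open>0\<close> and \<open>a\<close> is expressed as distance
        at most \<open>a / 2\<close> from the midpoint, the form that
        \<open>continuous_approx_rational\<close> accepts.\<close>
      have "\<bar>exp_mart r t \<omega> - a / 2\<bar> \<le> a / 2"
      proof (rule continuous_approx_rational[OF c', of 0 t])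
        fix u assume "u \<in> \<rat>" "0 < u" "u < t"
        then have "exp_mart r u \<omega> \<le> a" using q[of u] by simp
        then show "\<bar>exp_mart r u \<omega> - a / 2\<bar> \<le> a / 2"
          using exp_mart_pos[of r u \<omega>] by linarith
      qed (use False t in auto)
      then show ?thesis by linarith
    qed (use q in auto)
    then show "\<exists>a>0. \<forall>t\<ge>0. exp_mart r t \<omega> \<le> a" by (intro exI[of _ a]) (auto simp: a_def)
  qed
qed

end

context driftless_price
begin

text \<open>Gathers the properties shared by almost all paths, so that the arguments on stopping and
  hitting times can be carried out path by path.\<close>

definition regular_path :: "'a \<Rightarrow> bool" where
  "regular_path \<omega> \<longleftrightarrow> continuous_on {0..} (\<lambda>t. X t \<omega>) \<and> X 0 \<omega> = p \<and>
     (\<forall>t\<ge>0. X t \<omega> = p * exp_mart \<sigma> t \<omega>) \<and> ((\<lambda>t. X t \<omega>) \<longlongrightarrow> 0) at_top"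

text \<open>Squaring the bound for volatility \<open>\<sigma> / 2\<close> gives \<open>exp_mart
  \<sigma> t \<omega> * exp (\<sigma>\<^sup>2 * t / 4) \<le> a\<^sup>2\<close>, hence exponential
  decay.\<close>

lemma AE_regular_path: "AE \<omega> in M. regular_path \<omega>"
  using X_eq_exp_mart AE_X_continuous AE_X_0 AE_exp_mart_bounded[of "\<sigma> / 2"]
proof eventually_elim
  fix \<omega> assume eq: "\<forall>t\<ge>0. X t \<omega> = p * exp_mart \<sigma> t \<omega>" and "continuous_on {0..} (\<lambda>t. X t \<omega>)" "X 0 \<omega> = p"
    and "\<exists>a>0. \<forall>t\<ge>0. exp_mart (\<sigma> / 2) t \<omega> \<le> a"
  moreover from this obtain a where a: "a > 0" "\<And>t. t \<ge> 0 \<Longrightarrow> exp_mart (\<sigma> / 2) t \<omega> \<le> a" by blast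
  have le: "X t \<omega> \<le> p * a\<^sup>2 * exp (- (\<sigma>\<^sup>2 / 4) * t)" if t: "t \<ge> 0" for t
  proof -
    have "exp_mart \<sigma> t \<omega> * exp ((\<sigma> / 2)\<^sup>2 * t) \<le> a\<^sup>2"
      using exp_mart_square[of "\<sigma> / 2" t \<omega>] power_mono[OF a(2)[OF t], of 2] exp_mart_pos[of "\<sigma> / 2" t \<omega>] by simp
    then have "exp_mart \<sigma> t \<omega> \<le> a\<^sup>2 * exp (- (\<sigma>\<^sup>2 / 4) * t)"
      by (simp add: exp_minus field_simps power_divide)
    then show ?thesis using eq t p_pos by (simp add: mult.assoc)
  qed
  have "((\<lambda>t. p * a\<^sup>2 * exp (- (\<sigma>\<^sup>2 / 4) * t)) \<longlongrightarrow> p * a\<^sup>2 * 0) at_top"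
    using \<sigma>_pos by (intro tendsto_mult tendsto_const filterlim_compose[OF exp_at_bot]
        filterlim_tendsto_neg_mult_at_bot[OF tendsto_const _ filterlim_ident]) auto
  then have lim: "((\<lambda>t. p * a\<^sup>2 * exp (- (\<sigma>\<^sup>2 / 4) * t)) \<longlongrightarrow> 0) at_top" by simp
  have "((\<lambda>t. X t \<omega>) \<longlongrightarrow> 0) at_top"
  proof (rule tendsto_sandwich[OF _ _ tendsto_const lim])
    show "\<forall>\<^sub>F t in at_top. 0 \<le> X t \<omega>"
      using eventually_ge_at_top[of 0] by eventually_elim (use eq p_pos exp_mart_pos in \<open>auto simp: less_imp_le\<close>)
    show "\<forall>\<^sub>F t in at_top. X t \<omega> \<le> p * a\<^sup>2 * exp (- (\<sigma>\<^sup>2 / 4) * t)"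
      using eventually_ge_at_top[of 0] by eventually_elim (use le in auto)
  qed
  ultimately show "regular_path \<omega>" by (simp add: regular_path_def)
qed

end

text \<open>
  \<open>approx_time n \<tau>\<close> rounds \<open>\<tau>\<close> up to the grid of mesh \<open>1 / (n + 1)\<close> and truncates at the horizon \<open>n + 1\<close>.
\<close>

definition approx_index :: "nat \<Rightarrow> ('a \<Rightarrow> ennreal) \<Rightarrow> 'a \<Rightarrow> nat" where
  "approx_index n \<tau> \<omega> = (LEAST i. i = Suc n * Suc n \<or> \<tau> \<omega> \<le> ennreal (real i / real (Suc n)))"

definition approx_time :: "nat \<Rightarrow> ('a \<Rightarrow> ennreal) \<Rightarrow> 'a \<Rightarrow> real" where
  "approx_time n \<tau> \<omega> = real (approx_index n \<tau> \<omega>) / real (Suc n)"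

lemma approx_index_le: "approx_index n \<tau> \<omega> \<le> Suc n * Suc n"
  unfolding approx_index_def by (rule Least_le) simp

lemma approx_index_cases:
  "approx_index n \<tau> \<omega> = Suc n * Suc n \<or> \<tau> \<omega> \<le> ennreal (approx_time n \<tau> \<omega>)"
  unfolding approx_time_def approx_index_def by (rule LeastI[of _ "Suc n * Suc n"]) simp

text \<open>This makes the rounded time a stopping time on its grid: before the horizon, whether
  index \<open>i\<close> has been reached is decided by \<open>\<tau>\<close> at the time belonging
  to \<open>i\<close>.\<close>

lemma approx_index_le_iff:
  "approx_index n \<tau> \<omega> \<le> i \<longleftrightarrow> Suc n * Suc n \<le> i \<or> \<tau> \<omega> \<le> ennreal (real i / real (Suc n))"
proof
  assume i: "approx_index n \<tau> \<omega> \<le> i"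
  show "Suc n * Suc n \<le> i \<or> \<tau> \<omega> \<le> ennreal (real i / real (Suc n))"
    using approx_index_cases[of n \<tau> \<omega>]
  proof
    assume "\<tau> \<omega> \<le> ennreal (approx_time n \<tau> \<omega>)"
    also have "\<dots> \<le> ennreal (real i / real (Suc n))"
      unfolding approx_time_def using i by (intro ennreal_leI divide_right_mono) auto
    finally show ?thesis ..
  qed (use i in simp)
next
  assume "Suc n * Suc n \<le> i \<or> \<tau> \<omega> \<le> ennreal (real i / real (Suc n))"
  then show "approx_index n \<tau> \<omega> \<le> i"
  proof
    assume "\<tau> \<omega> \<le> ennreal (real i / real (Suc n))"
    then show ?thesis unfolding approx_index_def by (intro Least_le) simp
  qed (use approx_index_le[of n \<tau> \<omega>] in simp)
qed

lemma approx_horizon: "real (Suc n * Suc n) / real (Suc n) = real (Suc n)"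
  unfolding of_nat_mult by (rule nonzero_mult_div_cancel_right) simp

lemma approx_time_bounds: "0 \<le> approx_time n \<tau> \<omega>" "approx_time n \<tau> \<omega> \<le> real (Suc n)"
proof -
  have "real (approx_index n \<tau> \<omega>) \<le> real (Suc n) * real (Suc n)"
    using approx_index_le[of n \<tau> \<omega>] by (metis of_nat_le_iff of_nat_mult)
  then show "approx_time n \<tau> \<omega> \<le> real (Suc n)" unfolding approx_time_def
    by (simp only: pos_divide_le_eq of_nat_0_less_iff zero_less_Suc)
qed (simp add: approx_time_def)

lemma approx_time_infinite:
  assumes "\<tau> \<omega> = \<infinity>"
  shows "approx_time n \<tau> \<omega> = real (Suc n)"
proof -
  have "approx_index n \<tau> \<omega> = Suc n * Suc n"
    using approx_index_cases[of n \<tau> \<omega>] assms by (auto simp: top_unique)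
  then show ?thesis by (simp only: approx_time_def approx_horizon)
qed

lemma approx_time_finite:
  assumes \<tau>: "\<tau> \<omega> = ennreal s" "0 \<le> s" and s: "s \<le> real (Suc n)"
  shows "s \<le> approx_time n \<tau> \<omega>" "approx_time n \<tau> \<omega> \<le> s + 1 / real (Suc n)"
proof -
  show "s \<le> approx_time n \<tau> \<omega>"
    using approx_index_cases[of n \<tau> \<omega>]
  proof
    assume "approx_index n \<tau> \<omega> = Suc n * Suc n"
    then have "approx_time n \<tau> \<omega> = real (Suc n)" by (simp only: approx_time_def approx_horizon)
    then show ?thesis using s by simp
  next
    assume "\<tau> \<omega> \<le> ennreal (approx_time n \<tau> \<omega>)"
    then show ?thesis using \<tau> approx_time_bounds(1)[of n \<tau> \<omega>] by simp
  qed
  define i where "i = approx_index n \<tau> \<omega>"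
  show "approx_time n \<tau> \<omega> \<le> s + 1 / real (Suc n)"
  proof (cases i)
    case 0
    then show ?thesis using \<tau>(2) by (simp add: approx_time_def i_def)
  next
    \<comment> \<open>By minimality of the index the preceding grid point lies before
      \<open>s\<close>, so rounding up adds at most one mesh.\<close>
    case (Suc j)
    have "\<not> \<tau> \<omega> \<le> ennreal (real j / real (Suc n))"
      using approx_index_le_iff[of n \<tau> \<omega> j] Suc by (auto simp: i_def)
    then have "real j / real (Suc n) < s" using \<tau> by (metis ennreal_leI not_le)
    then show ?thesis using Suc by (simp add: approx_time_def i_def[symmetric] add_divide_distrib)
  qed
qed

section \<open>The price at an arbitrary stopping time\<close>

context driftless_price
begin

lemma approx_time_exp_mart:
  assumes "stopping_time F \<tau>"
  shows "has_bochner_integral M (\<lambda>\<omega>. exp_mart r (approx_time n \<tau> \<omega>) \<omega>) 1"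
  unfolding approx_time_def
proof (rule exp_mart_discrete_stopping[where t="\<lambda>i. real i / real (Suc n)" and m="Suc n * Suc n"])
  fix i assume "i \<le> Suc n * Suc n"
  have "Measurable.pred (F (ennreal (real i / real (Suc n)))) (\<lambda>\<omega>. \<tau> \<omega> \<le> ennreal (real i / real (Suc n)))"
    using assms by (rule stopping_timeD)
  then have "{\<omega> \<in> space (F (ennreal (real i / real (Suc n)))). Suc n * Suc n \<le> i \<or> \<tau> \<omega> \<le> ennreal (real i / real (Suc n))}
      \<in> sets (F (ennreal (real i / real (Suc n))))"
    by measurable
  then show "{\<omega> \<in> space M. approx_index n \<tau> \<omega> \<le> i} \<in> sets (F (ennreal (real i / real (Suc n))))"
    unfolding approx_index_le_iff space_F .
next
  show "approx_index n \<tau> \<omega> \<le> Suc n * Suc n" if "\<omega> \<in> space M" for \<omega> by (rule approx_index_le)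
qed (auto intro: divide_right_mono)

lemma regular_pathD:
  assumes "regular_path \<omega>"
  shows "continuous_on {0..} (\<lambda>t. X t \<omega>)" "X 0 \<omega> = p"
    "t \<ge> 0 \<Longrightarrow> X t \<omega> = p * exp_mart \<sigma> t \<omega>" "((\<lambda>t. X t \<omega>) \<longlongrightarrow> 0) at_top"
  using assms unfolding regular_path_def by blast+

lemma regular_path_pos: "regular_path \<omega> \<Longrightarrow> 0 \<le> t \<Longrightarrow> 0 < X t \<omega>"
  by (simp add: regular_pathD(3) p_pos exp_mart_pos)

lemma stopped_at_infinite: "regular_path \<omega> \<Longrightarrow> \<tau> \<omega> = \<infinity> \<Longrightarrow> stopped_at X \<tau> \<omega> = 0"
  unfolding stopped_at_def using tendsto_Lim[OF _ regular_pathD(4)] by simp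

lemma stopped_at_finite: "\<tau> \<omega> = ennreal s \<Longrightarrow> 0 \<le> s \<Longrightarrow> stopped_at X \<tau> \<omega> = X s \<omega>"
  by (simp add: stopped_at_def)

lemma stopped_at_nonneg:
  assumes "regular_path \<omega>" shows "0 \<le> stopped_at X \<tau> \<omega>"
proof (cases "\<tau> \<omega>")
  case (real s)
  then show ?thesis using stopped_at_finite[of \<tau> \<omega> s] regular_path_pos[OF assms, of s] by simp
next
  case top
  then show ?thesis using stopped_at_infinite[OF assms, of \<tau>] by simp
qed

text \<open>For finite \<open>\<tau>\<close> this is continuity of the path. For infinite
  \<open>\<tau>\<close> the rounded times are the horizons, along which the price tends to
  \<open>0\<close>, the value that \<open>stopped_at\<close> assigns.\<close>

lemma approx_stopped_limit:
  assumes g: "regular_path \<omega>"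
  shows "(\<lambda>n. p * exp_mart \<sigma> (approx_time n \<tau> \<omega>) \<omega>) \<longlonglongrightarrow> stopped_at X \<tau> \<omega>"
proof -
  have eq: "p * exp_mart \<sigma> (approx_time n \<tau> \<omega>) \<omega> = X (approx_time n \<tau> \<omega>) \<omega>" for n
    by (rule regular_pathD(3)[OF g approx_time_bounds(1), symmetric])
  show ?thesis
  proof (cases "\<tau> \<omega>")
    case (real s)
    have "(\<lambda>n. approx_time n \<tau> \<omega>) \<longlonglongrightarrow> s"
    proof (rule real_tendsto_sandwich)
      have ev: "\<forall>\<^sub>F n in sequentially. s \<le> real (Suc n)"
        using filterlim_real_sequentially[THEN filterlim_compose[OF _ filterlim_Suc]] by (simp add: filterlim_at_top)
      then show "\<forall>\<^sub>F n in sequentially. s \<le> approx_time n \<tau> \<omega>"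
        by eventually_elim (use real in \<open>auto intro: approx_time_finite\<close>)
      show "\<forall>\<^sub>F n in sequentially. approx_time n \<tau> \<omega> \<le> s + 1 / real (Suc n)"
        using ev by eventually_elim (use real in \<open>auto intro: approx_time_finite simp del: of_nat_Suc\<close>)
      have "(\<lambda>n. s + inverse (real (Suc n))) \<longlonglongrightarrow> s + 0"
        by (intro tendsto_add tendsto_const LIMSEQ_inverse_real_of_nat)
      then show "(\<lambda>n. s + 1 / real (Suc n)) \<longlonglongrightarrow> s" by (simp add: inverse_eq_divide)
    qed simp
    moreover note regular_pathD(1)[OF g]
    ultimately have "(\<lambda>n. X (approx_time n \<tau> \<omega>) \<omega>) \<longlonglongrightarrow> X s \<omega>"
      using real by (intro continuous_on_tendsto_compose[of "{0..}" "\<lambda>t. X t \<omega>"]) (auto simp: approx_time_bounds(1))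
    then show ?thesis unfolding eq using stopped_at_finite[of \<tau> \<omega> s] real by simp
  next
    case top
    then have *: "approx_time n \<tau> \<omega> = real (Suc n)" for n by (intro approx_time_infinite) simp
    have "filterlim (\<lambda>n. real (Suc n)) at_top sequentially"
      by (rule filterlim_compose[OF filterlim_real_sequentially filterlim_Suc])
    from filterlim_compose[OF regular_pathD(4)[OF g] this]
    have "(\<lambda>n. X (real (Suc n)) \<omega>) \<longlonglongrightarrow> 0" .
    then have "(\<lambda>n. X (approx_time n \<tau> \<omega>) \<omega>) \<longlonglongrightarrow> 0" unfolding * .
    then show ?thesis unfolding eq using stopped_at_infinite[OF g, of \<tau>] top by simp
  qed
qed

text \<open>An almost sure limit of the measurable prices at rounded times; completeness covers the
  remaining null set.\<close>

lemma stopped_at_measurable: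
  assumes "stopping_time F \<tau>"
  shows "stopped_at X \<tau> \<in> borel_measurable M"
proof (rule measurable_AE_cong)
  have [measurable]: "(\<lambda>\<omega>. p * exp_mart \<sigma> (approx_time n \<tau> \<omega>) \<omega>) \<in> borel_measurable M" for n
    using approx_time_exp_mart[OF assms, of \<sigma> n]
    by (auto simp: has_bochner_integral_iff dest: borel_measurable_integrable)
  show "(\<lambda>\<omega>. lim (\<lambda>n. p * exp_mart \<sigma> (approx_time n \<tau> \<omega>) \<omega>)) \<in> borel_measurable M"
    by (rule borel_measurable_lim_metric) measurable
  show "AE \<omega> in M. lim (\<lambda>n. p * exp_mart \<sigma> (approx_time n \<tau> \<omega>) \<omega>) = stopped_at X \<tau> \<omega>"
    using AE_regular_path by eventually_elim (auto intro!: limI approx_stopped_limit)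
qed

text \<open>Fatou's lemma along the rounded times, each of which has expectation exactly
  \<open>p\<close>. Equality can be lost in the limit: for infinite \<open>\<tau>\<close> the
  expectation is \<open>0\<close>.\<close>

lemma stopped_at_expectation_le:
  assumes \<tau>: "stopping_time F \<tau>"
  shows "integrable M (stopped_at X \<tau>)" "expectation (stopped_at X \<tau>) \<le> p"
proof -
  define Y where "Y n \<omega> = p * exp_mart \<sigma> (approx_time n \<tau> \<omega>) \<omega>" for n \<omega>
  have Y: "has_bochner_integral M (Y n) (p * 1)" for n
    unfolding Y_def[abs_def] by (intro has_bochner_integral_mult_right approx_time_exp_mart \<tau>)
  have Ypos: "0 \<le> Y n \<omega>" for n \<omega> using p_pos exp_mart_pos[of \<sigma>] by (simp add: Y_def less_imp_le)
  have nnY: "(\<integral>\<^sup>+\<omega>. ennreal (Y n \<omega>) \<partial>M) = ennreal p" for n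
    using Y[of n] Ypos by (subst nn_integral_eq_integral) (auto simp: has_bochner_integral_iff)
  have "(\<integral>\<^sup>+\<omega>. ennreal (stopped_at X \<tau> \<omega>) \<partial>M) = (\<integral>\<^sup>+\<omega>. liminf (\<lambda>n. ennreal (Y n \<omega>)) \<partial>M)"
  proof (rule nn_integral_cong_AE)
    show "AE \<omega> in M. ennreal (stopped_at X \<tau> \<omega>) = liminf (\<lambda>n. ennreal (Y n \<omega>))"
      using AE_regular_path
    proof eventually_elim
      fix \<omega> assume "regular_path \<omega>"
      then have "(\<lambda>n. ennreal (Y n \<omega>)) \<longlonglongrightarrow> ennreal (stopped_at X \<tau> \<omega>)"
        unfolding Y_def by (intro tendsto_ennrealI approx_stopped_limit)
      then show "ennreal (stopped_at X \<tau> \<omega>) = liminf (\<lambda>n. ennreal (Y n \<omega>))"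
        by (intro lim_imp_Liminf[symmetric]) auto
    qed
  qed
  also have "\<dots> \<le> liminf (\<lambda>n. \<integral>\<^sup>+\<omega>. ennreal (Y n \<omega>) \<partial>M)"
    using Y by (intro nn_integral_liminf) (auto simp: has_bochner_integral_iff intro!: measurable_compose[OF borel_measurable_integrable measurable_ennreal])
  also have "\<dots> = ennreal p" unfolding nnY by (simp add: Liminf_const)
  finally have le: "(\<integral>\<^sup>+\<omega>. ennreal (stopped_at X \<tau> \<omega>) \<partial>M) \<le> ennreal p" .
  have nonneg: "AE \<omega> in M. 0 \<le> stopped_at X \<tau> \<omega>"
    using AE_regular_path by eventually_elim (rule stopped_at_nonneg)
  show int: "integrable M (stopped_at X \<tau>)"
    using le by (intro integrableI_nonneg stopped_at_measurable \<tau> nonneg) (auto simp: le_less_trans[OF le])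
  have "ennreal (expectation (stopped_at X \<tau>)) \<le> ennreal p"
    using le nn_integral_eq_integral[OF int nonneg] by simp
  then show "expectation (stopped_at X \<tau>) \<le> p" using p_pos by simp
qed

text \<open>
  Truncating the approximations at level \<open>L\<close> costs at most \<open>p\<^sup>2 exp (\<sigma>\<^sup>2 (T + 1)) / L\<close>, by the second moment.
\<close>

lemma bounded_stopping_expectation_ge:
  assumes \<tau>: "stopping_time F \<tau>" and T: "\<And>\<omega>. \<tau> \<omega> \<le> ennreal T" "0 \<le> T"
    and b: "AE \<omega> in M. stopped_at X \<tau> \<omega> \<le> b"
  shows "p \<le> expectation (stopped_at X \<tau>)"
proof -
  define Y where "Y n \<omega> = p * exp_mart \<sigma> (approx_time n \<tau> \<omega>) \<omega>" for n \<omega>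
  have Y: "has_bochner_integral M (Y n) (p * 1)" for n
    unfolding Y_def[abs_def] by (intro has_bochner_integral_mult_right approx_time_exp_mart \<tau>)
  have YM: "Y n \<in> borel_measurable M" for n
    using Y[of n] by (simp add: has_bochner_integral_iff borel_measurable_integrable)
  have Ypos: "0 \<le> Y n \<omega>" for n \<omega> using p_pos exp_mart_pos[of \<sigma>] by (simp add: Y_def less_imp_le)
  \<comment> \<open>Eventually the rounded time is at most \<open>T + 1\<close>, so
    \<open>exp_mart_square\<close> bounds the second moment of \<open>Y n\<close> by this
    constant.\<close>
  define C where "C = p\<^sup>2 * exp (\<sigma>\<^sup>2 * (T + 1))"
  have C: "C \<ge> 0" by (simp add: C_def)
  have Y2: "(Y n \<omega>)\<^sup>2 \<le> C * exp_mart (2 * \<sigma>) (approx_time n \<tau> \<omega>) \<omega>" if n: "T \<le> real (Suc n)" for n \<omega>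
  proof -
    obtain s where s: "\<tau> \<omega> = ennreal s" "0 \<le> s" using T(1)[of \<omega>] by (cases "\<tau> \<omega>") (auto simp: top_unique)
    have "s \<le> T" using T(1)[of \<omega>] s T(2) by simp
    then have "approx_time n \<tau> \<omega> \<le> s + 1 / real (Suc n)" using n by (intro approx_time_finite(2)[where \<tau>=\<tau> and \<omega>=\<omega>, OF s]) auto
    also have "\<dots> \<le> T + 1" using \<open>s \<le> T\<close> by (intro add_mono) (auto simp: field_simps)
    finally have "exp (\<sigma>\<^sup>2 * approx_time n \<tau> \<omega>) \<le> exp (\<sigma>\<^sup>2 * (T + 1))" by (simp add: mult_left_mono)
    then show ?thesis
      unfolding Y_def C_def power_mult_distrib exp_mart_square using exp_mart_pos[of "2 * \<sigma>"] p_pos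
      by (simp add: mult_ac mult_left_mono less_imp_le)
  qed
  have S: "integrable M (stopped_at X \<tau>)" by (rule stopped_at_expectation_le[OF \<tau>])
  have main: "p - C / L \<le> expectation (stopped_at X \<tau>)" if L: "L > 0" for L
  proof -
    have lim: "(\<lambda>n. expectation (\<lambda>\<omega>. min (Y n \<omega>) L)) \<longlonglongrightarrow> expectation (\<lambda>\<omega>. min (stopped_at X \<tau> \<omega>) L)"
    proof (rule integral_dominated_convergence[where w="\<lambda>_. L"])
      show "AE \<omega> in M. (\<lambda>n. min (Y n \<omega>) L) \<longlonglongrightarrow> min (stopped_at X \<tau> \<omega>) L"
        using AE_regular_path by eventually_elim (auto simp: Y_def intro!: tendsto_min approx_stopped_limit)
      show "AE \<omega> in M. norm (min (Y n \<omega>) L) \<le> L" for n using Ypos L by (auto simp: min_def)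
    qed (use YM stopped_at_measurable[OF \<tau>] in auto)
    have "\<forall>\<^sub>F n in sequentially. T \<le> real (Suc n)"
      using filterlim_real_sequentially[THEN filterlim_compose[OF _ filterlim_Suc]] by (simp add: filterlim_at_top)
    then have ev: "\<forall>\<^sub>F n in sequentially. p - C / L \<le> expectation (\<lambda>\<omega>. min (Y n \<omega>) L)"
    proof eventually_elim
      fix n assume n: "T \<le> real (Suc n)"
      have E: "has_bochner_integral M (\<lambda>\<omega>. Y n \<omega> - C * exp_mart (2 * \<sigma>) (approx_time n \<tau> \<omega>) \<omega> / L) (p * 1 - C * 1 / L)"
        by (intro has_bochner_integral_diff Y has_bochner_integral_divide has_bochner_integral_mult_right approx_time_exp_mart \<tau>)
      have "p - C / L = expectation (\<lambda>\<omega>. Y n \<omega> - C * exp_mart (2 * \<sigma>) (approx_time n \<tau> \<omega>) \<omega> / L)"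
        using E by (simp add: has_bochner_integral_iff)
      also have "\<dots> \<le> expectation (\<lambda>\<omega>. min (Y n \<omega>) L)"
      proof (rule integral_mono)
        show "integrable M (\<lambda>\<omega>. Y n \<omega> - C * exp_mart (2 * \<sigma>) (approx_time n \<tau> \<omega>) \<omega> / L)"
          using E by (simp add: has_bochner_integral_iff)
        show "integrable M (\<lambda>\<omega>. min (Y n \<omega>) L)"
          using Y[of n] YM by (intro integrable_min) (auto simp: has_bochner_integral_iff)
        fix \<omega>
        \<comment> \<open>Cutting at \<open>L\<close> only loses something where \<open>Y n\<close>
          exceeds \<open>L\<close>, and there \<open>Y n\<close> is at most its square divided by
          \<open>L\<close>.\<close>
        have "Y n \<omega> - (Y n \<omega>)\<^sup>2 / L \<le> min (Y n \<omega>) L"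
        proof (cases "Y n \<omega> \<le> L")
          case True
          have "0 \<le> (Y n \<omega>)\<^sup>2 / L" using L by simp
          then show ?thesis using True by (simp add: min_def)
        next
          case False
          have "Y n \<omega> * L \<le> Y n \<omega> * Y n \<omega>" using False Ypos[of n \<omega>] by (intro mult_left_mono) auto
          then have "Y n \<omega> \<le> (Y n \<omega>)\<^sup>2 / L" using L by (simp add: field_simps power2_eq_square)
          then show ?thesis using False L by (simp add: min_def)
        qed
        moreover have "(Y n \<omega>)\<^sup>2 / L \<le> C * exp_mart (2 * \<sigma>) (approx_time n \<tau> \<omega>) \<omega> / L"
          using L by (intro divide_right_mono Y2 n) auto
        ultimately show "Y n \<omega> - C * exp_mart (2 * \<sigma>) (approx_time n \<tau> \<omega>) \<omega> / L \<le> min (Y n \<omega>) L" by linarith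
      qed
      finally show "p - C / L \<le> expectation (\<lambda>\<omega>. min (Y n \<omega>) L)" .
    qed
    have "p - C / L \<le> expectation (\<lambda>\<omega>. min (stopped_at X \<tau> \<omega>) L)"
      by (rule tendsto_lowerbound[OF lim ev]) simp
    also have "\<dots> \<le> expectation (stopped_at X \<tau>)"
      using S by (intro integral_mono integrable_min) auto
    finally show ?thesis .
  qed
  have "(\<lambda>n. p - C * inverse (real (Suc n))) \<longlonglongrightarrow> p - C * 0"
    by (intro tendsto_intros LIMSEQ_inverse_real_of_nat)
  moreover have "p - C * inverse (real (Suc n)) \<le> expectation (stopped_at X \<tau>)" for n
    using main[of "real (Suc n)"] by (simp add: divide_inverse del: of_nat_Suc)
  ultimately have "p - C * 0 \<le> expectation (stopped_at X \<tau>)"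
    by (intro LIMSEQ_le_const2) auto
  then show ?thesis by simp
qed

text \<open>The equality holds for \<open>\<tau>\<close> truncated at \<open>n\<close>; since the
  price is bounded by \<open>b\<close> up to \<open>\<tau>\<close>, dominated convergence carries it
  to the limit. Where \<open>\<tau>\<close> is infinite, the truncated prices tend to
  \<open>0\<close>.\<close>

lemma stopped_at_expectation_eq:
  assumes \<tau>: "stopping_time F \<tau>" and b: "AE \<omega> in M. \<forall>t\<ge>0. ennreal t \<le> \<tau> \<omega> \<longrightarrow> X t \<omega> \<le> b"
  shows "expectation (stopped_at X \<tau>) = p"
proof -
  define \<nu> where "\<nu> n \<omega> = min (\<tau> \<omega>) (ennreal (real n))" for n \<omega>
  have \<nu>: "stopping_time F (\<nu> n)" for n
    unfolding \<nu>_def[abs_def] by (intro stopping_time_min \<tau> stopping_time_const)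
  have le: "AE \<omega> in M. 0 \<le> stopped_at X (\<nu> n) \<omega> \<and> stopped_at X (\<nu> n) \<omega> \<le> b" for n
    using b AE_regular_path
  proof eventually_elim
    fix \<omega> assume b: "\<forall>t\<ge>0. ennreal t \<le> \<tau> \<omega> \<longrightarrow> X t \<omega> \<le> b" and g: "regular_path \<omega>"
    obtain s where s: "\<nu> n \<omega> = ennreal s" "0 \<le> s"
      by (cases "\<nu> n \<omega>") (auto simp: \<nu>_def top_unique min_def split: if_splits)
    moreover have "ennreal s \<le> \<tau> \<omega>" unfolding s(1)[symmetric] \<nu>_def by simp
    ultimately show "0 \<le> stopped_at X (\<nu> n) \<omega> \<and> stopped_at X (\<nu> n) \<omega> \<le> b"
      using b stopped_at_finite[of "\<nu> n" \<omega> s] stopped_at_nonneg[OF g, of "\<nu> n"] by auto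
  qed
  have "p \<le> expectation (stopped_at X (\<nu> n))" for n
    by (rule bounded_stopping_expectation_ge[OF \<nu>, of _ "real n" b]) (use le in \<open>auto simp: \<nu>_def\<close>)
  moreover have "(\<lambda>n. expectation (stopped_at X (\<nu> n))) \<longlonglongrightarrow> expectation (stopped_at X \<tau>)"
  proof (rule integral_dominated_convergence[where w="\<lambda>_. b"])
    show "AE \<omega> in M. (\<lambda>n. stopped_at X (\<nu> n) \<omega>) \<longlonglongrightarrow> stopped_at X \<tau> \<omega>"
      using AE_regular_path
    proof eventually_elim
      fix \<omega> assume g: "regular_path \<omega>"
      show "(\<lambda>n. stopped_at X (\<nu> n) \<omega>) \<longlonglongrightarrow> stopped_at X \<tau> \<omega>"
      proof (cases "\<tau> \<omega>")
        case (real s)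
        have "\<forall>\<^sub>F n in sequentially. s \<le> real n"
          using filterlim_real_sequentially by (simp add: filterlim_at_top)
        then have "\<forall>\<^sub>F n in sequentially. stopped_at X (\<nu> n) \<omega> = stopped_at X \<tau> \<omega>"
        proof eventually_elim
          fix n assume "s \<le> real n"
          then have "\<nu> n \<omega> = \<tau> \<omega>" using real by (simp add: \<nu>_def min_def)
          then show "stopped_at X (\<nu> n) \<omega> = stopped_at X \<tau> \<omega>" by (simp add: stopped_at_def)
        qed
        then show ?thesis by (rule tendsto_eventually)
      next
        case top
        then have "\<nu> n \<omega> = ennreal (real n)" for n by (simp add: \<nu>_def)
        then have "stopped_at X (\<nu> n) \<omega> = X (real n) \<omega>" for n by (simp add: stopped_at_finite)
        moreover have "(\<lambda>n. X (real n) \<omega>) \<longlonglongrightarrow> 0"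
          by (rule filterlim_compose[OF regular_pathD(4)[OF g] filterlim_real_sequentially])
        ultimately show ?thesis using stopped_at_infinite[OF g, of \<tau>] top by simp
      qed
    qed
    show "AE \<omega> in M. norm (stopped_at X (\<nu> n) \<omega>) \<le> b" for n using le[of n] by eventually_elim auto
  qed (use stopped_at_measurable \<nu> \<tau> in auto)
  ultimately have "p \<le> expectation (stopped_at X \<tau>)"
    by (intro LIMSEQ_le_const) auto
  then show ?thesis using stopped_at_expectation_le(2)[OF \<tau>] by simp
qed

section \<open>Hitting times and verification\<close>

lemma hitting_time_le: "0 \<le> t \<Longrightarrow> X t \<omega> \<in> A \<Longrightarrow> hitting_time X A \<omega> \<le> ennreal t"
  unfolding hitting_time_def by (intro Inf_lower) auto

lemma hitting_time_infinite: "(\<And>t. 0 \<le> t \<Longrightarrow> X t \<omega> \<notin> A) \<Longrightarrow> hitting_time X A \<omega> = \<infinity>"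
proof -
  assume "\<And>t. 0 \<le> t \<Longrightarrow> X t \<omega> \<notin> A"
  then have "{t. 0 \<le> t \<and> X t \<omega> \<in> A} = {}" by auto
  then show ?thesis by (simp add: hitting_time_def)
qed

lemma hitting_time_attained:
  assumes g: "regular_path \<omega>" and A: "closed A" and t: "0 \<le> t" "X t \<omega> \<in> A"
  obtains s where "0 \<le> s" "s \<le> t" "hitting_time X A \<omega> = ennreal s" "X s \<omega> \<in> A"
proof -
  define S where "S = {0..} \<inter> (\<lambda>t. X t \<omega>) -` A"
  have S: "closed S"
    unfolding S_def by (rule continuous_closed_preimage[OF regular_pathD(1)[OF g] _ A]) simp
  have tS: "t \<in> S" using t by (simp add: S_def)
  have bdd: "bdd_below S" unfolding S_def by (rule bdd_belowI[of _ 0]) auto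
  have s: "Inf S \<in> S" using closed_contains_Inf[OF _ bdd S] tS by auto
  have "hitting_time X A \<omega> = ennreal (Inf S)"
  proof (rule antisym)
    show "hitting_time X A \<omega> \<le> ennreal (Inf S)" using s by (intro hitting_time_le) (auto simp: S_def)
    show "ennreal (Inf S) \<le> hitting_time X A \<omega>"
      unfolding hitting_time_def
    proof (rule Inf_greatest)
      fix x assume "x \<in> ennreal ` {t. 0 \<le> t \<and> X t \<omega> \<in> A}"
      then obtain u where u: "x = ennreal u" "u \<in> S" by (auto simp: S_def)
      then show "ennreal (Inf S) \<le> x" using cInf_lower[OF u(2) bdd] by (simp add: ennreal_leI)
    qed
  qed
  then show ?thesis using that[of "Inf S"] s cInf_lower[OF tS bdd] by (auto simp: S_def)
qed

lemma hitting_time_le_iff: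
  assumes g: "regular_path \<omega>" and A: "closed A" and s: "0 \<le> s"
  shows "hitting_time X A \<omega> \<le> ennreal s \<longleftrightarrow> (\<exists>u\<in>{0..s}. X u \<omega> \<in> A)"
proof
  assume le: "hitting_time X A \<omega> \<le> ennreal s"
  then have "hitting_time X A \<omega> \<noteq> \<infinity>" by (auto simp: top_unique)
  then obtain t where t: "0 \<le> t" "X t \<omega> \<in> A" using hitting_time_infinite[of \<omega> A] by blast
  obtain u where u: "0 \<le> u" "hitting_time X A \<omega> = ennreal u" "X u \<omega> \<in> A"
    using hitting_time_attained[OF g A t] by blast
  then have "u \<le> s" using le s by simp
  then show "\<exists>u\<in>{0..s}. X u \<omega> \<in> A" using u by auto
next
  assume "\<exists>u\<in>{0..s}. X u \<omega> \<in> A"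
  then obtain u where u: "0 \<le> u" "u \<le> s" "X u \<omega> \<in> A" by auto
  have "hitting_time X A \<omega> \<le> ennreal u" using u by (intro hitting_time_le)
  also have "\<dots> \<le> ennreal s" using u by (intro ennreal_leI)
  finally show "hitting_time X A \<omega> \<le> ennreal s" .
qed

text \<open>The distance of the path to \<open>A\<close> is continuous and attains its minimum over
  \<open>{0..s}\<close>, so visiting the closed set by time \<open>s\<close> amounts to coming
  arbitrarily close at rational times. This is a countable condition on the path up to
  \<open>s\<close>.\<close>

lemma visit_iff_rational_approach:
  assumes g: "regular_path \<omega>" and A: "closed A" "A \<noteq> {}" and s: "0 \<le> s"
  shows "(\<exists>u\<in>{0..s}. X u \<omega> \<in> A) \<longleftrightarrow>
    (\<forall>n::nat. \<exists>q\<in>\<rat> \<inter> {0..s}. infdist (X q \<omega>) A < 1 / real (Suc n))"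
proof -
  define f where "f t = infdist (X t \<omega>) A" for t
  have f: "continuous_on {0..} f"
    unfolding f_def by (intro continuous_on_infdist regular_pathD(1)[OF g])
  have f0: "f t = 0 \<longleftrightarrow> X t \<omega> \<in> A" for t
    unfolding f_def using in_closed_iff_infdist_zero[OF A] by simp
  have fpos: "0 \<le> f t" for t unfolding f_def by (rule infdist_nonneg)
  have "(\<exists>u\<in>{0..s}. f u = 0) \<longleftrightarrow> (\<forall>n::nat. \<exists>q\<in>\<rat> \<inter> {0..s}. f q < 1 / real (Suc n))"
  proof
    assume "\<exists>u\<in>{0..s}. f u = 0"
    then obtain u where u: "0 \<le> u" "u \<le> s" "f u = 0" by auto
    show "\<forall>n::nat. \<exists>q\<in>\<rat> \<inter> {0..s}. f q < 1 / real (Suc n)"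
    proof
      fix n :: nat
      show "\<exists>q\<in>\<rat> \<inter> {0..s}. f q < 1 / real (Suc n)"
      \<comment> \<open>There is no admissible time to the left of \<open>0\<close>, but
        \<open>0\<close> itself is rational.\<close>
      proof (cases "u = 0")
        case True
        then show ?thesis using u by (intro bexI[of _ 0]) auto
      next
        case False
        have e: "0 < 1 / real (Suc n)" by simp
        have "u \<in> {0..}" using u by simp
        from f[unfolded continuous_on_iff, rule_format, OF this e]
        obtain d where d: "d > 0" "\<And>v. v \<in> {0..} \<Longrightarrow> dist v u < d \<Longrightarrow> dist (f v) (f u) < 1 / real (Suc n)" by blast
        obtain q where q: "q \<in> \<rat>" "max 0 (u - d) < q" "q < u"
          using Rats_dense_in_real[of "max 0 (u - d)" u] u d False by auto
        have "dist (f q) (f u) < 1 / real (Suc n)" using q by (intro d(2)) (auto simp: dist_real_def)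
        then show ?thesis using q u fpos[of q] by (intro bexI[of _ q]) (auto simp: dist_real_def)
      qed
    qed
  next
    assume *: "\<forall>n::nat. \<exists>q\<in>\<rat> \<inter> {0..s}. f q < 1 / real (Suc n)"
    have "continuous_on {0..s} f" using f by (rule continuous_on_subset) auto
    then obtain u where u: "u \<in> {0..s}" "\<And>v. v \<in> {0..s} \<Longrightarrow> f u \<le> f v"
      using continuous_attains_inf[of "{0..s}" f] s by auto
    have "f u = 0"
    proof (rule ccontr)
      assume "f u \<noteq> 0"
      then have "0 < f u" using fpos[of u] by simp
      then obtain n where n: "inverse (real (Suc n)) < f u" using reals_Archimedean by blast
      obtain q where q: "q \<in> {0..s}" "f q < 1 / real (Suc n)" using * by blast
      show False using u(2)[OF q(1)] q(2) n by (simp add: inverse_eq_divide)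
    qed
    then show "\<exists>u\<in>{0..s}. f u = 0" using u(1) by blast
  qed
  then show ?thesis by (simp only: f0) (simp only: f_def)
qed

text \<open>The rational description of a visit by time \<open>s\<close> is an event of
  \<open>F s\<close>. It agrees with the hitting event only almost surely, and
  \<open>sets_F_AE_cong\<close> bridges the difference.\<close>

lemma hitting_time_stopping_time:
  assumes A: "closed A" "A \<noteq> {}"
  shows "stopping_time F (hitting_time X A)"
proof (rule stopping_timeI)
  fix t
  show "Measurable.pred (F t) (\<lambda>\<omega>. hitting_time X A \<omega> \<le> t)"
  proof (cases t)
    case top
    then show ?thesis by simp
  next
    case (real s)
    define C where "C = {\<omega> \<in> space M. \<forall>n\<in>(UNIV :: nat set). \<exists>q\<in>\<rat> \<inter> {0..s}. infdist (X q \<omega>) A < 1 / real (Suc n)}"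
    have dist: "(\<lambda>x. infdist x A) \<in> borel_measurable (borel :: real measure)"
      by (intro borel_measurable_continuous_onI continuous_on_infdist continuous_on_id)
    have single: "{\<omega> \<in> space M. infdist (X q \<omega>) A < 1 / real (Suc n)} \<in> sets (F t)" if q: "q \<in> \<rat> \<inter> {0..s}" for q n
    proof -
      have "X q \<in> borel_measurable (F t)"
        by (rule F_measurable_mono[OF X_F_measurable]) (use q real in \<open>auto simp: ennreal_leI\<close>)
      from measurable_compose[OF this dist]
      have "(\<lambda>\<omega>. infdist (X q \<omega>) A) \<in> borel_measurable (F t)" .
      then have "{\<omega> \<in> space (F t). infdist (X q \<omega>) A < 1 / real (Suc n)} \<in> sets (F t)" by measurable
      then show ?thesis by (simp only: space_F)
    qed
    have cnt: "countable (\<rat> \<inter> {0..s} :: real set)" using countable_rat by (rule countable_subset[rotated]) auto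
    have "{\<omega> \<in> space (F t). \<forall>n\<in>(UNIV :: nat set). \<exists>q\<in>\<rat> \<inter> {0..s}. infdist (X q \<omega>) A < 1 / real (Suc n)} \<in> sets (F t)"
      by (rule sets.sets_Collect_countable_All', rule sets.sets_Collect_countable_Ex'[OF _ cnt])
        (use single in \<open>simp_all add: space_F\<close>)
    then have C: "C \<in> sets (F t)" by (simp only: C_def space_F)
    have "{\<omega> \<in> space M. hitting_time X A \<omega> \<le> t} \<in> sets (F t)"
    proof (rule sets_F_AE_cong[OF C])
      show "AE \<omega> in M. \<omega> \<in> C \<longleftrightarrow> \<omega> \<in> {\<omega> \<in> space M. hitting_time X A \<omega> \<le> t}"
        using AE_regular_path AE_space
      proof eventually_elim
        fix \<omega> assume g: "regular_path \<omega>" and \<omega>: "\<omega> \<in> space M"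
        have "hitting_time X A \<omega> \<le> t \<longleftrightarrow> (\<forall>n::nat. \<exists>q\<in>\<rat> \<inter> {0..s}. infdist (X q \<omega>) A < 1 / real (Suc n))"
          unfolding real(2) hitting_time_le_iff[OF g A(1) real(1)] by (rule visit_iff_rational_approach[OF g A real(1)])
        then show "\<omega> \<in> C \<longleftrightarrow> \<omega> \<in> {\<omega> \<in> space M. hitting_time X A \<omega> \<le> t}"
          using \<omega> unfolding C_def by blast
      qed
    qed auto
    then show ?thesis by (simp only: pred_def space_F)
  qed
qed

lemma stopped_at_hitting_now:
  assumes A: "closed A" "p \<in> A"
  shows "AE \<omega> in M. stopped_at X (hitting_time X A) \<omega> = p"
  using AE_regular_path
proof eventually_elim
  fix \<omega> assume g: "regular_path \<omega>"
  have p: "X 0 \<omega> = p" by (rule regular_pathD(2)[OF g])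
  obtain s where "0 \<le> s" "s \<le> 0" "hitting_time X A \<omega> = ennreal s"
    using hitting_time_attained[OF g A(1), of 0] A(2) p by auto
  then show "stopped_at X (hitting_time X A) \<omega> = p"
    using stopped_at_finite[of "hitting_time X A" \<omega> 0] p by simp
qed

text \<open>The path tends to \<open>0\<close> and so must come down to \<open>b\<close>. If the
  first visit to \<open>A\<close> were strictly below \<open>b\<close>, the path would have passed
  through \<open>b\<close>, itself a point of \<open>A\<close>, even earlier.\<close>

lemma stopped_at_hitting_below:
  assumes A: "closed A" "A \<subseteq> {..b}" "b \<in> A" and b: "0 < b" "b < p"
  shows "AE \<omega> in M. stopped_at X (hitting_time X A) \<omega> = b"
  using AE_regular_path
proof eventually_elim
  fix \<omega> assume g: "regular_path \<omega>"
  have cont: "continuous_on {u..v} (\<lambda>t. X t \<omega>)" if "0 \<le> u" for u v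
    using regular_pathD(1)[OF g] by (rule continuous_on_subset) (use that in auto)
  have visit: "\<exists>u\<ge>0. u \<le> t \<and> X u \<omega> = b" if "0 \<le> t" "X t \<omega> \<le> b" for t
    using IVT2'[of "\<lambda>t. X t \<omega>" t b 0] that cont[of 0 t] regular_pathD(2)[OF g] b by auto
  have "\<forall>\<^sub>F t in at_top. X t \<omega> < b"
    using regular_pathD(4)[OF g] b by (intro order_tendstoD) auto
  then obtain t where t: "0 \<le> t" "X t \<omega> \<le> b"
    unfolding eventually_at_top_linorder by (metis less_imp_le linear max.cobounded1 max.cobounded2)
  then obtain v where v: "0 \<le> v" "X v \<omega> = b" using visit by blast
  obtain s where s: "0 \<le> s" "hitting_time X A \<omega> = ennreal s" "X s \<omega> \<in> A"
    using hitting_time_attained[OF g A(1), of v] v A(3) by auto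
  obtain u where u: "0 \<le> u" "u \<le> s" "X u \<omega> = b" using visit[of s] s A(2) by auto
  have "ennreal s \<le> ennreal u" unfolding s(2)[symmetric] using u A(3) by (intro hitting_time_le) auto
  then have "u = s" using u s by simp
  then show "stopped_at X (hitting_time X A) \<omega> = b"
    using stopped_at_finite[of "hitting_time X A" \<omega> s] s u by simp
qed

text \<open>Up to the visit the path cannot exceed \<open>a\<close> without first passing through
  \<open>a\<close>, a point of \<open>A\<close>. So the price is bounded until then, which preserves
  the mean, and it ends at \<open>a\<close> or, without a visit, at \<open>0\<close>.\<close>

lemma stopped_at_hitting_above:
  assumes A: "closed A" "A \<subseteq> {a..}" "a \<in> A" and a: "p < a"
  shows "AE \<omega> in M. stopped_at X (hitting_time X A) \<omega> \<in> {0, a}"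
    and "expectation (stopped_at X (hitting_time X A)) = p"
proof -
  have bound: "X t \<omega> \<le> a" if g: "regular_path \<omega>" and t: "0 \<le> t" "ennreal t \<le> hitting_time X A \<omega>" for t \<omega>
  proof (rule ccontr)
    assume "\<not> X t \<omega> \<le> a"
    moreover have "continuous_on {0..t} (\<lambda>t. X t \<omega>)"
      using regular_pathD(1)[OF g] by (rule continuous_on_subset) auto
    ultimately obtain u where u: "0 \<le> u" "u \<le> t" "X u \<omega> = a"
      using IVT'[of "\<lambda>t. X t \<omega>" 0 a t] regular_pathD(2)[OF g] a t by auto
    have "ennreal t \<le> ennreal u"
      using t(2) hitting_time_le[of u \<omega> A] u(1) A(3) unfolding u(3) by (metis order_trans)
    then have "u = t" using u by simp
    then show False using u \<open>\<not> X t \<omega> \<le> a\<close> by simp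
  qed
  show "AE \<omega> in M. stopped_at X (hitting_time X A) \<omega> \<in> {0, a}"
    using AE_regular_path
  proof eventually_elim
    fix \<omega> assume g: "regular_path \<omega>"
    show "stopped_at X (hitting_time X A) \<omega> \<in> {0, a}"
    proof (cases "\<exists>t\<ge>0. X t \<omega> \<in> A")
      case True
      then obtain s where s: "0 \<le> s" "hitting_time X A \<omega> = ennreal s" "X s \<omega> \<in> A"
        using hitting_time_attained[OF g A(1)] by metis
      then have "X s \<omega> = a" using bound[OF g, of s] A(2) by force
      then show ?thesis using stopped_at_finite[of "hitting_time X A" \<omega> s] s by simp
    next
      case False
      then have "hitting_time X A \<omega> = \<infinity>" by (intro hitting_time_infinite) auto
      then show ?thesis using stopped_at_infinite[OF g] by simp
    qed
  qed
  show "expectation (stopped_at X (hitting_time X A)) = p"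
  proof (rule stopped_at_expectation_eq)
    show "stopping_time F (hitting_time X A)" using A by (intro hitting_time_stopping_time) auto
    show "AE \<omega> in M. \<forall>t\<ge>0. ennreal t \<le> hitting_time X A \<omega> \<longrightarrow> X t \<omega> \<le> a"
      using AE_regular_path by eventually_elim (use bound in blast)
  qed
qed

text \<open>Prices are nonnegative, so \<open>g\<close> matters on \<open>{0..}\<close> only, and
  \<open>gh\<close> is a Borel function agreeing with it there: the entry payoff is defined through
  suprema, but has an explicit formula on that range. The slope is nonnegative because the expected
  price at a general stopping time is merely bounded above by \<open>p\<close>.\<close>

lemma payoff_integrable:
  assumes gh: "gh \<in> borel_measurable borel" "\<And>x. 0 \<le> x \<Longrightarrow> g x = gh x"
    and b: "\<And>x. 0 \<le> x \<Longrightarrow> c \<le> g x" "\<And>x. 0 \<le> x \<Longrightarrow> g x \<le> a + b * x" "0 \<le> b"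
    and \<nu>: "stopping_time F \<nu>"
  shows "integrable M (\<lambda>\<omega>. g (stopped_at X \<nu> \<omega>))"
    and "expectation (\<lambda>\<omega>. g (stopped_at X \<nu> \<omega>)) \<le> a + b * p"
proof -
  have nonneg: "AE \<omega> in M. 0 \<le> stopped_at X \<nu> \<omega>"
    using AE_regular_path by eventually_elim (rule stopped_at_nonneg)
  note S = stopped_at_expectation_le[OF \<nu>]
  have maj: "integrable M (\<lambda>\<omega>. a + b * stopped_at X \<nu> \<omega>)"
    using S(1) by auto
  have "integrable M (\<lambda>\<omega>. gh (stopped_at X \<nu> \<omega>))"
  proof (rule Bochner_Integration.integrable_bound)
    show "integrable M (\<lambda>\<omega>. \<bar>c\<bar> + \<bar>a + b * stopped_at X \<nu> \<omega>\<bar>)"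
      using integrable_abs[OF maj] by auto
    show "(\<lambda>\<omega>. gh (stopped_at X \<nu> \<omega>)) \<in> borel_measurable M"
      by (rule measurable_compose[OF stopped_at_measurable[OF \<nu>] gh(1)])
    show "AE \<omega> in M. norm (gh (stopped_at X \<nu> \<omega>)) \<le> norm (\<bar>c\<bar> + \<bar>a + b * stopped_at X \<nu> \<omega>\<bar>)"
      using nonneg
    proof eventually_elim
      fix \<omega> assume "0 \<le> stopped_at X \<nu> \<omega>"
      then have "c \<le> gh (stopped_at X \<nu> \<omega>)" "gh (stopped_at X \<nu> \<omega>) \<le> a + b * stopped_at X \<nu> \<omega>"
        using b(1,2) gh(2) by (metis, metis)
      then show "norm (gh (stopped_at X \<nu> \<omega>)) \<le> norm (\<bar>c\<bar> + \<bar>a + b * stopped_at X \<nu> \<omega>\<bar>)"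
        unfolding real_norm_def by linarith
    qed
  qed
  then show int: "integrable M (\<lambda>\<omega>. g (stopped_at X \<nu> \<omega>))"
    by (rule integrable_AE_cong) (use nonneg gh(2) in auto)
  have "expectation (\<lambda>\<omega>. g (stopped_at X \<nu> \<omega>)) \<le> expectation (\<lambda>\<omega>. a + b * stopped_at X \<nu> \<omega>)"
    using nonneg by (intro integral_mono_AE int maj) (use b(2) in auto)
  also have "\<dots> = a + b * expectation (stopped_at X \<nu>)"
    using S(1) by (simp add: prob_space)
  also have "\<dots> \<le> a + b * p" using S(2) b(3) by (simp add: mult_left_mono)
  finally show "expectation (\<lambda>\<omega>. g (stopped_at X \<nu> \<omega>)) \<le> a + b * p" .
qed

lemma optimal_stopping_affine:
  assumes gh: "gh \<in> borel_measurable borel" "\<And>x. 0 \<le> x \<Longrightarrow> g x = gh x"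
    and b: "\<And>x. 0 \<le> x \<Longrightarrow> c \<le> g x" "\<And>x. 0 \<le> x \<Longrightarrow> g x \<le> a + b * x" "0 \<le> b"
    and \<tau>: "stopping_time F \<tau>" "expectation (\<lambda>\<omega>. g (stopped_at X \<tau> \<omega>)) = a + b * p"
  shows "optimal_stopping_time M F X g \<tau> \<and> stopping_value M F X g = a + b * p"
proof -
  note pay = payoff_integrable[OF gh b]
  have "stopping_value M F X g = a + b * p"
    unfolding stopping_value_def
  proof (rule cSup_eq_maximum)
    show "a + b * p \<in> (\<lambda>\<tau>. expectation (\<lambda>\<omega>. g (stopped_at X \<tau> \<omega>))) ` {\<tau>. stopping_time F \<tau>}"
      using \<tau> by (intro image_eqI[of _ _ \<tau>]) auto
  qed (use pay(2) in auto)
  then show ?thesis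
    unfolding optimal_stopping_time_def using \<tau> pay by auto
qed

text \<open>\<open>g\<close> may be any function: on a complete space an almost surely constant
  random variable is measurable.\<close>

lemma payoff_AE_const:
  fixes g :: "real \<Rightarrow> real"
  assumes "AE \<omega> in M. stopped_at X \<tau> \<omega> = b"
  shows "expectation (\<lambda>\<omega>. g (stopped_at X \<tau> \<omega>)) = g b"
proof -
  have *: "AE \<omega> in M. g b = g (stopped_at X \<tau> \<omega>)"
    using assms by eventually_elim simp
  have "expectation (\<lambda>\<omega>. g (stopped_at X \<tau> \<omega>)) = expectation (\<lambda>\<omega>. g b)"
  proof (rule integral_cong_AE)
    show "(\<lambda>\<omega>. g (stopped_at X \<tau> \<omega>)) \<in> borel_measurable M"
      by (rule measurable_AE_cong[OF borel_measurable_const *])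
    show "AE \<omega> in M. g (stopped_at X \<tau> \<omega>) = g b"
      using * by eventually_elim simp
  qed simp
  then show ?thesis by (simp add: prob_space)
qed

lemmas payoff_hitting_now = payoff_AE_const[OF stopped_at_hitting_now]

lemmas payoff_hitting_below = payoff_AE_const[OF stopped_at_hitting_below]

text \<open>On the two possible values \<open>0\<close> and \<open>a\<close> every payoff coincides
  with its chord, and the mean of an affine function of the price is determined by the mean
  \<open>p\<close>.\<close>

lemma payoff_hitting_above:
  assumes A: "closed A" "A \<subseteq> {a..}" "a \<in> A" and a: "p < a"
  shows "expectation (\<lambda>\<omega>. g (stopped_at X (hitting_time X A) \<omega>)) = g 0 + (g a - g 0) / a * p"
proof -
  define \<tau> where "\<tau> = hitting_time X A"
  have st: "stopping_time F \<tau>" unfolding \<tau>_def using A by (intro hitting_time_stopping_time) auto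
  note S = stopped_at_expectation_le(1)[OF st]
  have *: "AE \<omega> in M. g 0 + (g a - g 0) / a * stopped_at X \<tau> \<omega> = g (stopped_at X \<tau> \<omega>)"
    using stopped_at_hitting_above(1)[OF A a] unfolding \<tau>_def
    by eventually_elim (use a p_pos in auto)
  have int: "integrable M (\<lambda>\<omega>. g 0 + (g a - g 0) / a * stopped_at X \<tau> \<omega>)"
    using S by auto
  have "expectation (\<lambda>\<omega>. g (stopped_at X \<tau> \<omega>)) = expectation (\<lambda>\<omega>. g 0 + (g a - g 0) / a * stopped_at X \<tau> \<omega>)"
    using * by (intro integral_cong_AE borel_measurable_integrable[OF int]
        borel_measurable_integrable[OF integrable_AE_cong[OF int *]]) auto
  also have "\<dots> = g 0 + (g a - g 0) / a * expectation (stopped_at X \<tau>)"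
    using S by (simp add: prob_space)
  also have "expectation (stopped_at X \<tau>) = p"
    unfolding \<tau>_def by (rule stopped_at_hitting_above(2)[OF A a])
  finally show ?thesis by (simp add: \<tau>_def)
qed

lemma payoff_never:
  fixes g :: "real \<Rightarrow> real"
  shows "expectation (\<lambda>\<omega>. g (stopped_at X (\<lambda>_. \<infinity>) \<omega>)) = g 0"
proof (rule payoff_AE_const)
  show "AE \<omega> in M. stopped_at X (\<lambda>_. \<infinity>) \<omega> = 0"
    using AE_regular_path by eventually_elim (simp add: stopped_at_infinite)
qed

end

section \<open>The payoff profile of the entry problem\<close>

lemma tangent_above_antimono_deriv:
  fixes f d :: "real \<Rightarrow> real"
  assumes I: "is_interval I" and f: "\<And>z. z \<in> I \<Longrightarrow> (f has_real_derivative d z) (at z)"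
    and d: "\<And>x y. x \<in> I \<Longrightarrow> y \<in> I \<Longrightarrow> x < y \<Longrightarrow> d y < d x"
    and xy: "x \<in> I" "y \<in> I" "x \<noteq> y"
  shows "f y < f x + d x * (y - x)"
proof -
  have I': "z \<in> I" if "u \<in> I" "v \<in> I" "u \<le> z" "z \<le> v" for u v z
    using mem_is_interval_1_I[OF I] that by blast
  show ?thesis
  proof (cases "x < y")
    case True
    obtain z where z: "x < z" "z < y" "f y - f x = (y - x) * d z"
      using MVT2[OF True, of f d] f I'[OF xy(1,2)] by auto
    have "d z < d x" using d[OF xy(1) I'[OF xy(1,2)]] z by auto
    then have "(y - x) * d z < (y - x) * d x" using True by simp
    then show ?thesis using z(3) by (simp add: algebra_simps)
  next
    case False
    then have yx: "y < x" using xy(3) by simp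
    obtain z where z: "y < z" "z < x" "f x - f y = (x - y) * d z"
      using MVT2[OF yx, of f d] f I'[OF xy(2,1)] by auto
    have "d x < d z" using d[OF I'[OF xy(2,1)] xy(1)] z by auto
    then have "(x - y) * d x < (x - y) * d z" using yx by simp
    then show ?thesis using z(3) by (simp add: algebra_simps)
  qed
qed

text \<open>Separates the calculus from the probability. \<open>D\<close> is a parameter of its own
  so that the instance \<open>D = 1\<close> can serve as the unit of scaling.\<close>

locale trade_profile =
  fixes \<alpha> k \<gamma> l A D :: real
  assumes \<alpha>: "0 < \<alpha>" "\<alpha> < 1" and k: "0 < k" and \<gamma>: "0 < \<gamma>" and l: "0 < l" and A: "0 < A" and D: "0 < D"
begin

text \<open>
  \<open>f\<close> is \<open>W\<close> with \<open>A = \<alpha> (c - 1)\<^sup>\<alpha>\<^sup>-\<^sup>1\<close> and \<open>D = \<Psi> + R\<close>. Its derivative \<open>f'\<close> has the sign of the affine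
  function \<open>bracket\<close>, and \<open>h p\<close> is the intercept of the tangent of \<open>f\<close> at \<open>p\<close>.
\<close>

definition f :: "real \<Rightarrow> real" where
  "f p = A * (l * p + D) powr (\<alpha> - 1) * \<gamma> * p - k * (l * p + D) powr \<alpha>"

definition bracket :: "real \<Rightarrow> real" where
  "bracket p = (1 - \<alpha>) * A * D - \<alpha> * (k * l / \<gamma> - A) * (l * p + D)"

definition f' :: "real \<Rightarrow> real" where
  "f' p = \<gamma> * (l * p + D) powr (\<alpha> - 2) * bracket p"

definition h :: "real \<Rightarrow> real" where
  "h p = f p - f' p * p"

lemma H_pos: "0 \<le> p \<Longrightarrow> 0 < l * p + D"
  using l D by (simp add: add_nonneg_pos)

lemma f_deriv: assumes p: "0 \<le> p" shows "(f has_real_derivative f' p) (at p)"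
proof -
  define H where "H = l * p + D"
  have H: "H > 0" using H_pos[OF p] by (simp add: H_def)
  have e1: "H powr (\<alpha> - 1) = H * H powr (\<alpha> - 2)"
    using powr_add[of H 1 "\<alpha> - 2"] H by (simp add: algebra_simps)
  have "(f has_real_derivative
     (A * ((\<alpha> - 1) * H powr (\<alpha> - 1 - 1) * l) * \<gamma> * p + A * H powr (\<alpha> - 1) * \<gamma> - k * (\<alpha> * H powr (\<alpha> - 1) * l))) (at p)"
    unfolding f_def[abs_def] H_def using H[unfolded H_def]
    by (auto intro!: derivative_eq_intros simp: algebra_simps)
  also have "\<alpha> - 1 - 1 = \<alpha> - 2" by simp
  also have "A * ((\<alpha> - 1) * H powr (\<alpha> - 2) * l) * \<gamma> * p + A * H powr (\<alpha> - 1) * \<gamma> - k * (\<alpha> * H powr (\<alpha> - 1) * l) = f' p"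
  proof -
    define \<kappa> where "\<kappa> = k * l / \<gamma>"
    have "k * (\<alpha> * (H * H powr (\<alpha> - 2)) * l) = \<kappa> * \<gamma> * \<alpha> * H * H powr (\<alpha> - 2)"
      using \<gamma> by (simp add: \<kappa>_def)
    then show ?thesis
      unfolding f'_def bracket_def H_def[symmetric] \<kappa>_def[symmetric] e1
      by (simp only:) (simp add: H_def algebra_simps)
  qed
  finally show ?thesis .
qed

lemma f_continuous: "continuous_on {0..} f"
  by (rule continuous_at_imp_continuous_on) (use f_deriv DERIV_isCont in blast)

lemma f'_continuous: "continuous_on {0..} f'"
  unfolding f'_def bracket_def
  by (intro continuous_intros) (use H_pos in force)

lemma h_continuous: "continuous_on {0..} h"
  unfolding h_def by (intro continuous_intros f_continuous f'_continuous)

lemma f_0: "f 0 = - k * D powr \<alpha>"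
  by (simp add: f_def)

lemma powr_strict_antimono: "0 \<le> x \<Longrightarrow> x < y \<Longrightarrow> e < 0 \<Longrightarrow> (l * y + D) powr e < (l * x + D) powr e"
  using H_pos[of x] l by (intro powr_less_mono2_neg) auto

text \<open>In this regime \<open>f'\<close> is a positive multiple of
  \<open>(l * p + D) powr (\<alpha> - 2)\<close> plus a nonnegative multiple of
  \<open>(l * p + D) powr (\<alpha> - 1)\<close>, both decreasing, so \<open>f\<close> is concave on
  the whole half-line.\<close>

lemma f'_strict_antimono_small:
  assumes le: "k * l / \<gamma> \<le> A" and xy: "0 \<le> x" "x < y"
  shows "f' y < f' x"
proof -
  define \<kappa> where "\<kappa> = k * l / \<gamma>"
  have *: "f' p = \<gamma> * ((1 - \<alpha>) * A * D * (l * p + D) powr (\<alpha> - 2) + \<alpha> * (A - k * l / \<gamma>) * (l * p + D) powr (\<alpha> - 1))" if "0 \<le> p" for p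
  proof -
    have "(l * p + D) powr (\<alpha> - 1) = (l * p + D) * (l * p + D) powr (\<alpha> - 2)"
      using powr_add[of "l * p + D" 1 "\<alpha> - 2"] H_pos[OF that] by (simp add: algebra_simps)
    then show ?thesis unfolding f'_def bracket_def \<kappa>_def[symmetric] by (simp only:) (simp add: algebra_simps)
  qed
  have "(1 - \<alpha>) * A * D * (l * y + D) powr (\<alpha> - 2) < (1 - \<alpha>) * A * D * (l * x + D) powr (\<alpha> - 2)"
    using \<alpha> A D xy by (intro mult_strict_left_mono powr_strict_antimono) auto
  moreover have "\<alpha> * (A - k * l / \<gamma>) * (l * y + D) powr (\<alpha> - 1) \<le> \<alpha> * (A - k * l / \<gamma>) * (l * x + D) powr (\<alpha> - 1)"
    using \<alpha> le xy less_imp_le[OF powr_strict_antimono[OF xy, of "\<alpha> - 1"]] by (intro mult_left_mono) auto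
  ultimately show ?thesis using xy \<gamma> unfolding *[OF xy(1)] *[OF less_imp_le[OF le_less_trans[OF xy]]] by simp
qed

text \<open>Both factors, the power and \<open>bracket\<close>, decrease, but this makes the product
  decrease only while \<open>bracket\<close> is nonnegative; that range ends at
  \<open>peak\<close>.\<close>

lemma f'_strict_antimono_large:
  assumes gt: "A < k * l / \<gamma>" and xy: "0 \<le> x" "x < y" and br: "0 \<le> bracket y"
  shows "f' y < f' x"
proof -
  have "\<alpha> * (k * l / \<gamma> - A) * (l * x + D) < \<alpha> * (k * l / \<gamma> - A) * (l * y + D)"
    using gt \<alpha> xy l by (intro mult_strict_left_mono) auto
  then have b: "bracket y < bracket x" unfolding bracket_def by simp
  have "(l * y + D) powr (\<alpha> - 2) * bracket y \<le> (l * x + D) powr (\<alpha> - 2) * bracket y"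
    using \<alpha> br xy less_imp_le[OF powr_strict_antimono[OF xy, of "\<alpha> - 2"]] by (intro mult_right_mono) auto
  also have "\<dots> < (l * x + D) powr (\<alpha> - 2) * bracket x"
    using b H_pos[OF xy(1)] by (intro mult_strict_left_mono) auto
  finally show ?thesis unfolding f'_def using \<gamma> by (simp add: mult.assoc)
qed

lemma tangent_h: "f y \<le> f x + f' x * (y - x) \<Longrightarrow> f y \<le> h x + f' x * y"
  by (simp add: h_def algebra_simps)

text \<open>By concavity the tangent at \<open>y\<close> passes strictly above the graph at
  \<open>x\<close>. From \<open>x\<close> back to the axis, the steeper tangent at \<open>x\<close>
  descends at least as much as the tangent at \<open>y\<close>.\<close>

lemma h_strict_mono:
  assumes I: "is_interval I" "I \<subseteq> {0..}" and d: "\<And>x y. x \<in> I \<Longrightarrow> y \<in> I \<Longrightarrow> x < y \<Longrightarrow> f' y < f' x"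
    and xy: "x \<in> I" "y \<in> I" "x < y"
  shows "h x < h y"
proof -
  have "f x < f y + f' y * (x - y)"
    by (rule tangent_above_antimono_deriv[OF I(1) f_deriv d xy(2,1)]) (use I xy in auto)
  moreover have "f' y * x \<le> f' x * x"
    using d[OF xy] xy I by (intro mult_right_mono) auto
  ultimately show ?thesis by (simp add: h_def algebra_simps)
qed

text \<open>In the variable \<open>x = \<gamma> * p / D\<close> the factor
  \<open>D powr \<alpha>\<close> splits off from the intercept, and what remains is the fraction of
  the threshold equation. All powers are first reduced to the exponent
  \<open>\<alpha> - 2\<close>.\<close>

lemma h_scaled:
  assumes x: "0 \<le> x"
  shows "- h (D / \<gamma> * x) = D powr \<alpha> *
    ((k * (l / \<gamma> * x + 1) * (l / \<gamma> * (1 - \<alpha>) * x + 1) - A * (l / \<gamma>) * (1 - \<alpha>) * x\<^sup>2)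
       / (l / \<gamma> * x + 1) powr (2 - \<alpha>))"
proof -
  define q where "q = l / \<gamma>"
  define s where "s = q * x + 1"
  have q: "q > 0" using l \<gamma> by (simp add: q_def)
  have s: "s > 0" using q x by (simp add: s_def add_nonneg_pos)
  have H: "l * (D / \<gamma> * x) + D = D * s" by (simp add: s_def q_def algebra_simps)
  have p1: "(D * s) powr (\<alpha> - 1) = (D * s) * (D * s) powr (\<alpha> - 2)"
    using powr_add[of "D * s" 1 "\<alpha> - 2"] s D by (simp add: algebra_simps)
  have p2: "(D * s) powr \<alpha> = (D * s)\<^sup>2 * (D * s) powr (\<alpha> - 2)"
    using powr_add[of "D * s" 2 "\<alpha> - 2"] s D by (simp add: algebra_simps)
  have p3: "D powr \<alpha> = D\<^sup>2 * D powr (\<alpha> - 2)"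
    using powr_add[of D 2 "\<alpha> - 2"] D by (simp add: algebra_simps)
  have p4: "1 / s powr (2 - \<alpha>) = s powr (\<alpha> - 2)"
    using powr_minus_divide[of s "2 - \<alpha>"] by simp
  have p5: "(D * s) powr (\<alpha> - 2) = D powr (\<alpha> - 2) * s powr (\<alpha> - 2)"
    using D s by (simp add: powr_mult)
  have gp: "\<gamma> * (D / \<gamma> * x) = D * x" using \<gamma> by simp
  have kl: "k * l / \<gamma> = k * q" by (simp add: q_def)
  have "- h (D / \<gamma> * x) = D powr (\<alpha> - 2) * s powr (\<alpha> - 2) *
    ((\<gamma> * (D / \<gamma> * x)) * ((1 - \<alpha>) * A * D - \<alpha> * (k * q - A) * (D * s)) - A * (D * s) * (\<gamma> * (D / \<gamma> * x)) + k * (D * s)\<^sup>2)"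
    unfolding h_def f_def f'_def bracket_def H p1 p2 p5 kl by (simp add: algebra_simps)
  also have "\<dots> = D powr (\<alpha> - 2) * s powr (\<alpha> - 2) * (D\<^sup>2 * (k * s * (q * (1 - \<alpha>) * x + 1) - A * q * (1 - \<alpha>) * x\<^sup>2))"
    unfolding gp s_def by (simp add: power2_eq_square algebra_simps)
  also have "\<dots> = D powr \<alpha> * ((k * s * (q * (1 - \<alpha>) * x + 1) - A * q * (1 - \<alpha>) * x\<^sup>2) * (1 / s powr (2 - \<alpha>)))"
    unfolding p3 p4 by (simp add: mult_ac)
  finally show ?thesis unfolding s_def q_def by simp
qed

text \<open>Put \<open>q = l / \<gamma>\<close> and \<open>s = q * x + 1\<close>. Once
  \<open>A\<close> is replaced by the smaller \<open>k * q\<close>, the terms quadratic in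
  \<open>s\<close> cancel in the numerator of \<open>h_scaled\<close> and at most
  \<open>2 * k * s\<close> is left. Hence \<open>- h\<close> is of order
  \<open>s powr (\<alpha> - 1)\<close>, which tends to \<open>0\<close>.\<close>

lemma h_near_0_small:
  assumes le: "k * l / \<gamma> \<le> A" and K: "K > 0"
  obtains p where "0 \<le> p" "- K \<le> h p"
proof -
  have "((\<lambda>s. s powr (\<alpha> - 1)) \<longlongrightarrow> 0) at_top"
    using \<alpha> by (intro tendsto_neg_powr filterlim_ident) auto
  then have "\<forall>\<^sub>F s in at_top. s powr (\<alpha> - 1) < K / (2 * k * D powr \<alpha>)"
    using K k D by (intro order_tendstoD) auto
  moreover have "\<forall>\<^sub>F s in at_top. s \<ge> (1::real)" by (rule eventually_ge_at_top)
  ultimately have "\<forall>\<^sub>F s in at_top. s powr (\<alpha> - 1) < K / (2 * k * D powr \<alpha>) \<and> s \<ge> 1"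
    by eventually_elim auto
  then obtain s where s: "s powr (\<alpha> - 1) < K / (2 * k * D powr \<alpha>)" "s \<ge> 1"
    using eventually_happens'[OF trivial_limit_at_top_linorder] by blast
  define q where "q = l / \<gamma>"
  have q: "q > 0" using l \<gamma> by (simp add: q_def)
  define x where "x = (s - 1) / q"
  have x: "0 \<le> x" "q * x + 1 = s" using s q by (auto simp: x_def)
  have qx: "q * x = s - 1" using x(2) by simp
  have kq: "k * q \<le> A" using le by (simp add: q_def)
  have b: "k * s * (q * (1 - \<alpha>) * x + 1) - A * q * (1 - \<alpha>) * x\<^sup>2 \<le> 2 * k * s"
  proof -
    have "k * q * (q * (1 - \<alpha>) * x\<^sup>2) \<le> A * (q * (1 - \<alpha>) * x\<^sup>2)"
      using kq q \<alpha> by (intro mult_right_mono) auto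
    moreover have "k * q * (q * (1 - \<alpha>) * x\<^sup>2) = k * (1 - \<alpha>) * (s - 1)\<^sup>2"
      unfolding qx[symmetric] by (simp add: power2_eq_square algebra_simps)
    moreover have "A * q * (1 - \<alpha>) * x\<^sup>2 = A * (q * (1 - \<alpha>) * x\<^sup>2)" by (simp only: mult.assoc)
    moreover have "k * s * (q * (1 - \<alpha>) * x + 1) = k * s * ((1 - \<alpha>) * (s - 1) + 1)"
      unfolding qx[symmetric] by (simp add: algebra_simps)
    ultimately have "k * s * (q * (1 - \<alpha>) * x + 1) - A * q * (1 - \<alpha>) * x\<^sup>2 \<le> k * s * ((1 - \<alpha>) * (s - 1) + 1) - k * (1 - \<alpha>) * (s - 1)\<^sup>2"
      by linarith
    also have "\<dots> = k * ((1 - \<alpha>) * (s - 1) + s)" by (simp add: power2_eq_square algebra_simps)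
    also have "\<dots> \<le> k * (2 * s)"
    proof (intro mult_left_mono)
      have "(1 - \<alpha>) * (s - 1) \<le> 1 * (s - 1)" using \<alpha> s by (intro mult_right_mono) auto
      then show "(1 - \<alpha>) * (s - 1) + s \<le> 2 * s" by simp
    qed (use k in simp)
    finally show ?thesis by simp
  qed
  have sp: "s powr (2 - \<alpha>) > 0" using s by simp
  have "- h (D / \<gamma> * x) \<le> D powr \<alpha> * (2 * k * s / s powr (2 - \<alpha>))"
    unfolding h_scaled[OF x(1)] q_def[symmetric] x(2) using b sp by (intro mult_left_mono divide_right_mono) auto
  also have "s / s powr (2 - \<alpha>) = s powr (\<alpha> - 1)"
    using powr_diff[of s 1 "2 - \<alpha>"] s by simp
  then have "D powr \<alpha> * (2 * k * s / s powr (2 - \<alpha>)) = 2 * k * D powr \<alpha> * s powr (\<alpha> - 1)"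
    by (metis (no_types, lifting) mult.assoc mult.commute times_divide_eq_right)
  also have "\<dots> \<le> K" using s(1) k D by (simp add: field_simps)
  finally show ?thesis using that[of "D / \<gamma> * x"] x D \<gamma> by simp
qed

text \<open>The intermediate value theorem gives a root. Minimality holds among all nonnegative
  roots although \<open>h\<close> is monotone on \<open>I\<close> only, since a smaller root would
  lie between \<open>0\<close> and \<open>z\<close> and therefore in \<open>I\<close>.\<close>

lemma threshold_exists:
  assumes I: "is_interval I" "I \<subseteq> {0..}" "0 \<in> I" "P \<in> I"
    and d: "\<And>x y. x \<in> I \<Longrightarrow> y \<in> I \<Longrightarrow> x < y \<Longrightarrow> f' y < f' x"
    and K: "h 0 \<le> - K" "- K \<le> h P"
  obtains z where "0 \<le> z" "z \<le> P" "h z = - K" "\<And>y. 0 \<le> y \<Longrightarrow> h y = - K \<Longrightarrow> z \<le> y"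
    "\<And>y. y \<in> I \<Longrightarrow> z \<le> y \<Longrightarrow> - K \<le> h y"
proof -
  have P: "0 \<le> P" using I by auto
  have "continuous_on {0..P} h" using h_continuous by (rule continuous_on_subset) auto
  then obtain z where z: "0 \<le> z" "z \<le> P" "h z = - K"
    using IVT'[of h 0 "- K" P] K P by blast
  have zI: "z \<in> I" using mem_is_interval_1_I[OF I(1,3,4)] z by simp
  show ?thesis
  proof (rule that[OF z])
    fix y assume y: "0 \<le> y" "h y = - K"
    show "z \<le> y"
    proof (rule ccontr)
      assume "\<not> z \<le> y"
      then have "y < z" by simp
      moreover have "y \<in> I" using mem_is_interval_1_I[OF I(1,3) zI] y \<open>y < z\<close> by simp
      ultimately have "h y < h z" using h_strict_mono[OF I(1,2) d] zI by blast
      then show False using y z by simp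
    qed
  next
    fix y assume y: "y \<in> I" "z \<le> y"
    have "z = y \<or> h z < h y" using h_strict_mono[OF I(1,2) d zI y(1)] y(2) by linarith
    then show "- K \<le> h y" using z by auto
  qed
qed

section \<open>Majorising tangents and the maximum of the profile\<close>

lemma tangent_small:
  assumes le: "k * l / \<gamma> \<le> A" and x: "0 \<le> x" and y: "0 \<le> y"
  shows "f y \<le> h x + f' x * y"
proof (rule tangent_h, cases "x = y")
  case False
  have "f y < f x + f' x * (y - x)"
    by (rule tangent_above_antimono_deriv[of "{0..}" f f'])
      (use f_deriv f'_strict_antimono_small[OF le] x y False in \<open>auto simp: is_interval_1\<close>)
  then show "f y \<le> f x + f' x * (y - x)" by simp
qed simp

lemma f'_nonneg_small: "k * l / \<gamma> \<le> A \<Longrightarrow> 0 \<le> x \<Longrightarrow> 0 \<le> f' x"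
  unfolding f'_def bracket_def using \<alpha> \<gamma> A D H_pos[of x]
  by (intro mult_nonneg_nonneg) (auto simp: mult_nonneg_nonpos mult_nonpos_nonneg intro: order_trans[of _ 0])

text \<open>The zero of \<open>bracket\<close>, hence the maximum point of \<open>f\<close> if \<open>A < k l / \<gamma>\<close>.\<close>

definition peak :: real where
  "peak = ((1 - \<alpha>) * A * D / (\<alpha> * (k * l / \<gamma> - A)) - D) / l"

lemma bracket_peak:
  assumes gt: "A < k * l / \<gamma>"
  shows "bracket x = \<alpha> * (k * l / \<gamma> - A) * l * (peak - x)"
proof -
  define e where "e = k * l / \<gamma> - A"
  have e: "e \<noteq> 0" using gt by (simp add: e_def)
  have "l * peak + D = (1 - \<alpha>) * A * D / (\<alpha> * e)" using l by (simp add: peak_def e_def)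
  then have "(1 - \<alpha>) * A * D = \<alpha> * e * (l * peak + D)" using e \<alpha> by (simp add: field_simps)
  then show ?thesis unfolding bracket_def e_def[symmetric] by (simp add: algebra_simps)
qed

lemma f'_sign:
  assumes gt: "A < k * l / \<gamma>" and x: "0 \<le> x"
  shows "0 \<le> f' x \<longleftrightarrow> x \<le> peak" "0 < f' x \<longleftrightarrow> x < peak"
proof -
  define C where "C = \<gamma> * (l * x + D) powr (\<alpha> - 2) * (\<alpha> * (k * l / \<gamma> - A) * l)"
  have C: "0 < C"
    using gt \<alpha> \<gamma> l H_pos[OF x] by (simp add: C_def)
  have eq: "f' x = C * (peak - x)"
    unfolding f'_def bracket_peak[OF gt] C_def by (simp only: mult.assoc)
  show "0 \<le> f' x \<longleftrightarrow> x \<le> peak" "0 < f' x \<longleftrightarrow> x < peak"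
    unfolding eq using C by (simp_all add: zero_le_mult_iff zero_less_mult_iff)
qed

lemma f_antimono_after_peak:
  assumes gt: "A < k * l / \<gamma>" and x: "0 \<le> x" "peak \<le> x" "x \<le> y"
  shows "f y \<le> f x"
proof (rule DERIV_nonpos_imp_nonincreasing[OF x(3)])
  fix z assume z: "x \<le> z" "z \<le> y"
  have "\<not> 0 < f' z" using f'_sign(2)[OF gt, of z] z x by simp
  then show "\<exists>w. (f has_real_derivative w) (at z) \<and> w \<le> 0" using f_deriv[of z] z x by (intro exI[of _ "f' z"]) auto
qed

lemma f_mono_before_peak:
  assumes gt: "A < k * l / \<gamma>" and x: "0 \<le> x" "x \<le> y" "y \<le> peak"
  shows "f x \<le> f y"
proof (rule DERIV_nonneg_imp_nondecreasing[OF x(2)])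
  fix z assume z: "x \<le> z" "z \<le> y"
  have "0 \<le> f' z" using f'_sign(1)[OF gt, of z] z x by simp
  then show "\<exists>w. (f has_real_derivative w) (at z) \<and> 0 \<le> w" using f_deriv[of z] z x by (intro exI[of _ "f' z"]) auto
qed

lemma f_le_peak:
  assumes gt: "A < k * l / \<gamma>" and pk: "0 \<le> peak" and y: "0 \<le> y"
  shows "f y \<le> f peak"
  using f_antimono_after_peak[OF gt pk, of y] f_mono_before_peak[OF gt y, of peak] by linarith

lemma f'_peak: "A < k * l / \<gamma> \<Longrightarrow> 0 \<le> peak \<Longrightarrow> f' peak = 0"
  using f'_sign[of peak] by fastforce

lemma h_peak: "A < k * l / \<gamma> \<Longrightarrow> 0 \<le> peak \<Longrightarrow> h peak = f peak"
  by (simp add: h_def f'_peak)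

lemma f'_strict_antimono_peak:
  assumes gt: "A < k * l / \<gamma>" and xy: "0 \<le> x" "x < y" "y \<le> peak"
  shows "f' y < f' x"
proof (rule f'_strict_antimono_large[OF gt xy(1,2)])
  show "0 \<le> bracket y"
    unfolding bracket_peak[OF gt] using gt \<alpha> l xy by (intro mult_nonneg_nonneg) auto
qed

text \<open>Up to \<open>peak\<close> concavity suffices. Beyond it concavity is replaced by
  monotonicity: \<open>f\<close> stays below its maximum, while a tangent of nonnegative slope does
  not fall.\<close>

lemma tangent_large:
  assumes gt: "A < k * l / \<gamma>" and x: "0 \<le> x" "x \<le> peak" and y: "0 \<le> y"
  shows "f y \<le> h x + f' x * y"
proof -
  have *: "f y \<le> h x + f' x * y" if y: "0 \<le> y" "y \<le> peak" for y
  proof (rule tangent_h, cases "x = y")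
    case False
    have "f y < f x + f' x * (y - x)"
      by (rule tangent_above_antimono_deriv[of "{0..peak}" f f'])
        (use f_deriv f'_strict_antimono_peak[OF gt] x y False in \<open>auto simp: is_interval_1\<close>)
    then show "f y \<le> f x + f' x * (y - x)" by simp
  qed simp
  show ?thesis
  proof (cases "y \<le> peak")
    case False
    have "f y \<le> f peak" using x y by (intro f_le_peak gt) auto
    also have "\<dots> \<le> h x + f' x * peak" using x by (intro *) auto
    also have "\<dots> \<le> h x + f' x * y" using f'_sign(1)[OF gt x(1)] x False by (simp add: mult_left_mono)
    finally show ?thesis .
  qed (use * y in auto)
qed

text \<open>\<open>f\<close> is homogeneous of degree \<open>\<alpha>\<close> in price and
  \<open>D\<close> jointly. This makes the constant \<open>C\<close> independent of \<Psi> and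
  \<open>R\<close>.\<close>

lemma f_peak_scaled:
  assumes gt: "A < k * l / \<gamma>" and pk: "0 \<le> peak"
  shows "f peak = D powr \<alpha> * (A * (l * (peak / D) + 1) powr (\<alpha> - 1) * \<gamma> * (peak / D) - k * (l * (peak / D) + 1) powr \<alpha>)"
proof -
  define y where "y = peak / D"
  have y: "0 \<le> y" "peak = D * y" using pk D by (auto simp: y_def)
  define s where "s = l * y + 1"
  have s: "s > 0" using y l by (simp add: s_def add_nonneg_pos)
  have H: "l * (D * y) + D = D * s" by (simp add: s_def algebra_simps)
  have Da: "D powr \<alpha> = D * D powr (\<alpha> - 1)"
    using powr_add[of D 1 "\<alpha> - 1"] D by simp
  have "f (D * y) = A * (D powr (\<alpha> - 1) * s powr (\<alpha> - 1)) * \<gamma> * (D * y) - k * (D powr \<alpha> * s powr \<alpha>)"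
    unfolding f_def H using D s by (simp add: powr_mult)
  also have "\<dots> = D powr \<alpha> * (A * s powr (\<alpha> - 1) * \<gamma> * y - k * s powr \<alpha>)"
    unfolding Da by (simp add: algebra_simps)
  finally show ?thesis
    unfolding y_def[symmetric] s_def using y(2) by simp
qed

text \<open>With \<open>H = l * p + D\<close> one has
  \<open>A * \<gamma> * p \<le> k * l * p < k * H\<close>, so \<open>f\<close> is negative at every
  nonnegative price. At \<open>D = 1\<close> this sign makes the quotient defining \<open>C\<close>
  meaningful.\<close>

lemma f_peak_negative:
  assumes gt: "A < k * l / \<gamma>" and pk: "0 \<le> peak"
  shows "f peak < 0"
proof -
  define H where "H = l * peak + D"
  have H: "H > 0" using H_pos[OF pk] by (simp add: H_def)
  have e1: "H powr \<alpha> = H * H powr (\<alpha> - 1)"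
    using powr_add[of H 1 "\<alpha> - 1"] H by simp
  have "A * \<gamma> \<le> k * l" using gt \<gamma> by (simp add: field_simps)
  then have "A * \<gamma> * peak \<le> k * l * peak" using pk by (rule mult_right_mono)
  also have "\<dots> < k * H" using k D by (simp add: H_def algebra_simps)
  finally have "H powr (\<alpha> - 1) * (A * \<gamma> * peak - k * H) < 0"
    using H by (intro mult_pos_neg) auto
  also have "H powr (\<alpha> - 1) * (A * \<gamma> * peak - k * H) = f peak"
    unfolding f_def H_def[symmetric] e1 by (simp add: algebra_simps)
  finally show ?thesis .
qed

text \<open>At \<open>D = 1\<close> this reads \<open>- k < f peak\<close>, which is the reason why
  \<open>C\<close> is positive.\<close>

lemma f_0_less_peak:
  assumes gt: "A < k * l / \<gamma>" and pk: "0 < peak"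
  shows "f 0 < f peak"
proof (rule DERIV_pos_imp_increasing_open[OF pk])
  fix z assume z: "0 < z" "z < peak"
  show "\<exists>w. (f has_real_derivative w) (at z) \<and> 0 < w"
    using f_deriv[of z] f'_sign(2)[OF gt, of z] z by (intro exI[of _ "f' z"]) auto
next
  show "continuous_on {0..peak} f" using f_continuous by (rule continuous_on_subset) auto
qed

end

section \<open>The exit and the entry problem\<close>

lemma powr_le_tangent:
  fixes x y :: real
  assumes "0 < \<alpha>" "\<alpha> < 1" "0 < x" "0 < y"
  shows "x powr \<alpha> \<le> y powr \<alpha> + \<alpha> * y powr (\<alpha> - 1) * (x - y)"
proof -
  \<comment> \<open>Weighted inequality of arithmetic and geometric means; divided by
    \<open>y powr (1 - \<alpha>)\<close> it is the tangent of the concave power at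
    \<open>y\<close>.\<close>
  have "x powr \<alpha> * y powr (1 - \<alpha>) \<le> \<alpha> * x + (1 - \<alpha>) * y"
    using assms by (intro Youngs_inequality_0) auto
  then have "x powr \<alpha> * y powr (1 - \<alpha>) * y powr (\<alpha> - 1) \<le> (\<alpha> * x + (1 - \<alpha>) * y) * y powr (\<alpha> - 1)"
    by (rule mult_right_mono) simp
  moreover have "y powr (1 - \<alpha>) * y powr (\<alpha> - 1) = 1"
    using assms by (simp add: powr_add[symmetric])
  moreover have "y powr \<alpha> = y * y powr (\<alpha> - 1)"
    using powr_add[of y 1 "\<alpha> - 1"] assms by simp
  ultimately show ?thesis by (simp add: algebra_simps)
qed

lemma utility_measurable: "utility \<alpha> k \<in> borel_measurable borel"
  unfolding utility_def[abs_def] by measurable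

text \<open>The case \<open>H = 1\<close>. By the equation for \<open>c\<close> the line is the
  tangent of the gain branch at \<open>z = c\<close>, so it dominates that concave branch; on losses
  it starts at the same point \<open>(0, - k)\<close> as the utility.\<close>

lemma utility_le_line:
  assumes \<alpha>: "0 < \<alpha>" "\<alpha> < 1" and k: "0 < k" and c: "1 < c" "\<alpha> * c * (c - 1) powr (\<alpha> - 1) - (c - 1) powr \<alpha> - k = 0"
    and z: "0 \<le> z"
  shows "- k \<le> utility \<alpha> k (z - 1)" "utility \<alpha> k (z - 1) \<le> - k + \<alpha> * (c - 1) powr (\<alpha> - 1) * z"
proof -
  \<comment> \<open>The slope of the line exceeds \<open>k\<close> by
    \<open>(1 - \<alpha>) * (c - 1) powr \<alpha>\<close>, again by the equation for
    \<open>c\<close>.\<close>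
  have kA: "k \<le> \<alpha> * (c - 1) powr (\<alpha> - 1)"
  proof -
    have "(c - 1) powr \<alpha> = (c - 1) * (c - 1) powr (\<alpha> - 1)"
      using powr_add[of "c - 1" 1 "\<alpha> - 1"] c by simp
    then have "\<alpha> * (c - 1) powr (\<alpha> - 1) - k = (1 - \<alpha>) * (c - 1) * (c - 1) powr (\<alpha> - 1)"
      using c(2) by (simp add: algebra_simps)
    also have "\<dots> \<ge> 0" using \<alpha> c by simp
    finally show ?thesis by simp
  qed
  show "- k \<le> utility \<alpha> k (z - 1)"
  proof (cases "z > 1")
    case True
    have "- k \<le> (z - 1) powr \<alpha>" using k powr_ge_zero[of "z - 1" \<alpha>] by linarith
    then show ?thesis using True unfolding utility_def by simp
  next
    case False
    have "(1 - z) powr \<alpha> \<le> 1 powr \<alpha>" using False z \<alpha> by (intro powr_mono2) auto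
    then show ?thesis using False k unfolding utility_def by (simp add: abs_if)
  qed
  show "utility \<alpha> k (z - 1) \<le> - k + \<alpha> * (c - 1) powr (\<alpha> - 1) * z"
  proof (cases "z > 1")
    case True
    have "(z - 1) powr \<alpha> \<le> (c - 1) powr \<alpha> + \<alpha> * (c - 1) powr (\<alpha> - 1) * ((z - 1) - (c - 1))"
      using True c \<alpha> by (intro powr_le_tangent) auto
    then show ?thesis using True c(2) unfolding utility_def by (simp add: algebra_simps)
  next
    case False
    \<comment> \<open>The loss branch is convex and lies below its chord from
      \<open>(0, - k)\<close> to \<open>(1, 0)\<close>, whose slope \<open>k\<close> does not exceed
      that of the line.\<close>
    have "1 - z \<le> (1 - z) powr \<alpha>"
    proof (cases "z = 1")
      case False
      then have "(1 - z) powr 1 \<le> (1 - z) powr \<alpha>"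
        using \<open>\<not> z > 1\<close> z \<alpha> by (intro powr_mono') auto
      then show ?thesis using False \<open>\<not> z > 1\<close> by simp
    qed simp
    then have "k * (1 - z) \<le> k * (1 - z) powr \<alpha>" using k by simp
    moreover have "k * z \<le> \<alpha> * (c - 1) powr (\<alpha> - 1) * z" using kA z by (rule mult_right_mono)
    moreover have "utility \<alpha> k (z - 1) = - (k * (1 - z) powr \<alpha>)"
      using False unfolding utility_def by (simp add: abs_if)
    ultimately show ?thesis by (simp add: algebra_simps)
  qed
qed

text \<open>Reduces the exit problem with reference level \<open>H\<close> to the case
  \<open>H = 1\<close>.\<close>

lemma utility_scale:
  assumes H: "0 < H"
  shows "utility \<alpha> k (H * y) = H powr \<alpha> * utility \<alpha> k y"
proof (cases "0 < y")
  case True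
  then show ?thesis using H by (simp add: utility_def powr_mult)
next
  case False
  have "\<bar>H * y\<bar> powr \<alpha> = H powr \<alpha> * \<bar>y\<bar> powr \<alpha>"
    unfolding abs_mult using H by (subst powr_mult) auto
  moreover have "\<not> 0 < H * y" using False H by (simp add: zero_less_mult_iff)
  ultimately show ?thesis
    unfolding utility_def using False by (simp only: if_False mult_ac)
qed

text \<open>The optimal exit is the first time at the contact point
  \<open>a = c * H / \<gamma>\<close>. From below, the price ends at \<open>0\<close> or at
  \<open>a\<close>, and at both points the utility touches its affine majorant.\<close>

lemma (in driftless_price) stopping_value_utility:
  assumes \<alpha>: "0 < \<alpha>" "\<alpha> < 1" and k: "0 < k" and c: "1 < c" "\<alpha> * c * (c - 1) powr (\<alpha> - 1) - (c - 1) powr \<alpha> - k = 0"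
    and \<gamma>: "0 < \<gamma>" and H: "0 < H" and p: "\<gamma> * p < c * H"
  shows "stopping_value M F X (\<lambda>x. utility \<alpha> k (\<gamma> * x - H))
     = \<alpha> * (c - 1) powr (\<alpha> - 1) * H powr (\<alpha> - 1) * \<gamma> * p - k * H powr \<alpha>"
proof -
  define g where "g x = utility \<alpha> k (\<gamma> * x - H)" for x
  define s where "s = \<alpha> * (c - 1) powr (\<alpha> - 1) * H powr (\<alpha> - 1) * \<gamma>"
  define a where "a = c * H / \<gamma>"
  have H\<alpha>: "H powr \<alpha> = H * H powr (\<alpha> - 1)"
    using powr_add[of H 1 "\<alpha> - 1"] H by simp
  have gz: "g x = H powr \<alpha> * utility \<alpha> k (\<gamma> * x / H - 1)" for x
  proof -
    have "\<gamma> * x - H = H * (\<gamma> * x / H - 1)" using H by (simp add: field_simps)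
    then show ?thesis unfolding g_def using utility_scale[OF H] by metis
  qed
  have pa: "p < a" using p \<gamma> by (simp add: a_def field_simps)
  have g0: "g 0 = - k * H powr \<alpha>"
    using H by (simp add: g_def utility_def)
  have ga: "g a = H powr \<alpha> * (c - 1) powr \<alpha>"
    unfolding gz using H \<gamma> c by (simp add: a_def utility_def)
  \<comment> \<open>The chord from \<open>0\<close> to the contact point is the tangent; this is the
    defining equation of \<open>c\<close>.\<close>
  have slope: "(g a - g 0) / a = s"
  proof -
    have "g a - g 0 = H powr \<alpha> * (\<alpha> * c * (c - 1) powr (\<alpha> - 1))"
      unfolding ga g0 using c(2) by (simp add: algebra_simps)
    then show ?thesis using c H \<gamma> by (simp add: a_def s_def H\<alpha>)
  qed
  have "optimal_stopping_time M F X g (hitting_time X {a..}) \<and> stopping_value M F X g = - k * H powr \<alpha> + s * p"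
  proof (rule optimal_stopping_affine[where gh = g and c = "- k * H powr \<alpha>"])
    show "g \<in> borel_measurable borel"
      unfolding g_def[abs_def] by (rule measurable_compose[OF _ utility_measurable]) simp
    fix x :: real assume x: "0 \<le> x"
    have z: "0 \<le> \<gamma> * x / H" using x \<gamma> H by simp
    note u = utility_le_line[OF \<alpha> k c z]
    have "H powr \<alpha> * (- k) \<le> g x" unfolding gz by (rule mult_left_mono[OF u(1)]) simp
    then show "- k * H powr \<alpha> \<le> g x" by (simp add: mult.commute)
    have "g x \<le> H powr \<alpha> * (- k + \<alpha> * (c - 1) powr (\<alpha> - 1) * (\<gamma> * x / H))"
      unfolding gz by (rule mult_left_mono[OF u(2)]) simp
    also have "\<dots> = - k * H powr \<alpha> + s * x"
      using H by (simp add: s_def H\<alpha> field_simps)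
    finally show "g x \<le> - k * H powr \<alpha> + s * x" .
  next
    show "0 \<le> s" using \<alpha> \<gamma> by (simp add: s_def)
    show "stopping_time F (hitting_time X {a..})" by (intro hitting_time_stopping_time) auto
    show "expectation (\<lambda>\<omega>. g (stopped_at X (hitting_time X {a..}) \<omega>)) = - k * H powr \<alpha> + s * p"
    proof -
      have "expectation (\<lambda>\<omega>. g (stopped_at X (hitting_time X {a..}) \<omega>)) = g 0 + (g a - g 0) / a * p"
        using pa by (intro payoff_hitting_above) auto
      then show ?thesis unfolding slope by (simp only: g0)
    qed
  qed auto
  then show ?thesis by (simp add: g_def[abs_def] s_def)
qed

section \<open>The entry problem\<close>

locale entry_problem = brownian_space M F B + trade_profile \<alpha> k \<gamma> l A "\<Psi> + R"
  for M :: "'a measure" and F B \<alpha> k \<gamma> l A \<Psi> R +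
  fixes \<sigma> c :: real and P :: "real \<Rightarrow> real \<Rightarrow> 'a \<Rightarrow> real"
  assumes price: "\<And>p. 0 < p \<Longrightarrow> driftless_price M F B \<sigma> p (P p)"
    and A_eq: "A = \<alpha> * (c - 1) powr (\<alpha> - 1)"
    and c: "1 < c" "\<alpha> * c * (c - 1) powr (\<alpha> - 1) - (c - 1) powr \<alpha> - k = 0"
    and \<gamma>_le: "\<gamma> \<le> 1" and l_ge: "1 \<le> l" and \<Psi>: "0 \<le> \<Psi>" and R: "0 < R"
begin

abbreviation payoff :: "real \<Rightarrow> real" where
  "payoff \<equiv> entry_payoff M F P \<alpha> k \<gamma> l \<Psi> R"

lemma W_eq_f: "W \<alpha> k \<gamma> c l \<Psi> R x = f x"
  by (simp add: W_def f_def A_eq[symmetric] add.assoc)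

lemma payoff_eq:
  assumes x: "0 \<le> x"
  shows "payoff x = max (f x) (- k * R powr \<alpha>)"
proof -
  define H where "H = l * x + \<Psi> + R"
  have "exit_value M F P \<alpha> k \<gamma> x H = f x"
  proof (cases "x > 0")
    case True
    interpret driftless_price M F B \<sigma> x "P x" by (rule price[OF True])
    have H: "H > 0" using H_pos[OF x] by (simp add: H_def add.assoc)
    have "\<gamma> * x \<le> l * x" using \<gamma>_le l_ge x by (intro mult_right_mono) auto
    also have "\<dots> < H" using \<Psi> R by (simp add: H_def)
    also have "\<dots> < c * H" using c H by simp
    finally have "\<gamma> * x < c * H" .
    from stopping_value_utility[OF \<alpha> k c \<gamma> H this] show ?thesis
      using True by (simp add: exit_value_def H_def f_def A_eq[symmetric] add.assoc)
  next
    case False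
    then have "x = 0" using x by simp
    moreover have "utility \<alpha> k (- (\<Psi> + R)) = - k * (\<Psi> + R) powr \<alpha>"
      using \<Psi> R by (simp add: utility_def add.commute)
    ultimately show ?thesis by (simp add: exit_value_def H_def f_def)
  qed
  moreover have "utility \<alpha> k (- R) = - k * R powr \<alpha>" using R by (simp add: utility_def)
  ultimately show ?thesis by (simp add: entry_payoff_def H_def)
qed

text \<open>The payoff is the maximum of \<open>f\<close> and a constant. A line of nonnegative
  slope dominates the constant as soon as its intercept does.\<close>

lemma entry_affine:
  assumes p: "0 < p" and b: "0 \<le> b" and maj: "\<And>x. 0 \<le> x \<Longrightarrow> f x \<le> a + b * x" "- k * R powr \<alpha> \<le> a"
    and \<tau>: "stopping_time F \<tau>" "expectation (\<lambda>\<omega>. payoff (stopped_at (P p) \<tau> \<omega>)) = a + b * p"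
  shows "optimal_entry_time M F P \<alpha> k \<gamma> l \<Psi> R p \<tau> \<and> entry_value M F P \<alpha> k \<gamma> l \<Psi> R p = a + b * p"
proof -
  interpret driftless_price M F B \<sigma> p "P p" by (rule price[OF p])
  show ?thesis
    unfolding optimal_entry_time_def entry_value_def
  proof (rule optimal_stopping_affine[where gh = "\<lambda>x. max (f x) (- k * R powr \<alpha>)" and c = "- k * R powr \<alpha>"])
    show "(\<lambda>x. max (f x) (- k * R powr \<alpha>)) \<in> borel_measurable borel"
      unfolding f_def[abs_def] by measurable
    fix x :: real assume x: "0 \<le> x"
    show "payoff x = max (f x) (- k * R powr \<alpha>)" by (rule payoff_eq[OF x])
    show "- k * R powr \<alpha> \<le> payoff x" unfolding payoff_eq[OF x] by simp
    have "0 \<le> b * x" using b x by simp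
    then show "payoff x \<le> a + b * x" unfolding payoff_eq[OF x] using maj(1)[OF x] maj(2) by simp
  qed (use b \<tau> in auto)
qed

text \<open>\<open>\<Psi> \<ge> 0\<close> makes staying out at least as good as entering at price
  \<open>0\<close>. As \<open>h 0 = f 0\<close>, this is also the left end of the intermediate value
  argument for the threshold.\<close>

lemma f_0_le: "f 0 \<le> - k * R powr \<alpha>"
proof -
  have "R powr \<alpha> \<le> (\<Psi> + R) powr \<alpha>" using \<Psi> R \<alpha> by (intro powr_mono2) auto
  then show ?thesis unfolding f_0 using k by simp
qed

lemma payoff_0: "payoff 0 = - k * R powr \<alpha>"
  using payoff_eq[of 0] f_0_le by simp

text \<open>The majorant is the tangent at \<open>p\<close>; the condition on \<open>h p\<close>
  keeps it above the payoff of staying out, already at price \<open>0\<close>.\<close>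

lemma enter_now:
  assumes p: "0 < p" "p \<in> S" "closed S" and tan: "\<And>y. 0 \<le> y \<Longrightarrow> f y \<le> h p + f' p * y"
    and "0 \<le> f' p" "- k * R powr \<alpha> \<le> h p"
  shows "optimal_entry_time M F P \<alpha> k \<gamma> l \<Psi> R p (hitting_time (P p) S) \<and>
    entry_value M F P \<alpha> k \<gamma> l \<Psi> R p = W \<alpha> k \<gamma> c l \<Psi> R p"
proof -
  interpret driftless_price M F B \<sigma> p "P p" by (rule price[OF p(1)])
  have fp: "f p = h p + f' p * p" by (simp add: h_def)
  have "0 \<le> f' p * p" using assms by simp
  then have "- k * R powr \<alpha> \<le> f p" using assms(6) fp by linarith
  then have "payoff p = f p" using payoff_eq[of p] p(1) by simp
  then have "expectation (\<lambda>\<omega>. payoff (stopped_at (P p) (hitting_time (P p) S) \<omega>)) = h p + f' p * p"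
    using payoff_hitting_now[OF p(3,2), of payoff] fp by simp
  moreover have "stopping_time F (hitting_time (P p) S)" using p by (intro hitting_time_stopping_time) auto
  ultimately show ?thesis
    using entry_affine[OF p(1) assms(5) tan assms(6)] fp by (simp add: W_eq_f)
qed

text \<open>Here the tangent at \<open>q\<close> starts exactly at the payoff of staying out. From
  below, the price ends at \<open>0\<close> or at \<open>q\<close>, the two points where the line
  meets the payoff.\<close>

lemma wait_for_rise:
  assumes p: "0 < p" "p < q" and S: "closed S" "S \<subseteq> {q..}" "q \<in> S"
    and tan: "\<And>y. 0 \<le> y \<Longrightarrow> f y \<le> h q + f' q * y" and "0 \<le> f' q" "h q = - k * R powr \<alpha>"
  shows "optimal_entry_time M F P \<alpha> k \<gamma> l \<Psi> R p (hitting_time (P p) S) \<and>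
    entry_value M F P \<alpha> k \<gamma> l \<Psi> R p = (W \<alpha> k \<gamma> c l \<Psi> R q + k * R powr \<alpha>) * (p / q) - k * R powr \<alpha>"
proof -
  interpret driftless_price M F B \<sigma> p "P p" by (rule price[OF p(1)])
  have q: "0 < q" using p by simp
  have fq: "f q = - k * R powr \<alpha> + f' q * q" using assms by (simp add: h_def)
  have "0 \<le> f' q * q" using assms q by simp
  then have "- k * R powr \<alpha> \<le> f q" using fq by linarith
  then have "payoff q = f q" using payoff_eq[of q] q by simp
  then have "expectation (\<lambda>\<omega>. payoff (stopped_at (P p) (hitting_time (P p) S) \<omega>)) = h q + f' q * p"
    using payoff_hitting_above[OF S p(2), of payoff] fq q assms(8) by (simp add: payoff_0)
  moreover have "stopping_time F (hitting_time (P p) S)" using S by (intro hitting_time_stopping_time) auto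
  ultimately show ?thesis
    using entry_affine[OF p(1) assms(7) tan] fq q assms(8) by (simp add: W_eq_f)
qed

text \<open>Starting above \<open>q\<close>, the price almost surely comes down to \<open>q\<close>,
  so waiting collects the maximum; the majorant is constant.\<close>

lemma wait_for_fall:
  assumes p: "0 < q" "q < p" and S: "closed S" "S \<subseteq> {..q}" "q \<in> S"
    and maj: "\<And>y. 0 \<le> y \<Longrightarrow> f y \<le> f q" "- k * R powr \<alpha> \<le> f q"
  shows "optimal_entry_time M F P \<alpha> k \<gamma> l \<Psi> R p (hitting_time (P p) S) \<and>
    entry_value M F P \<alpha> k \<gamma> l \<Psi> R p = W \<alpha> k \<gamma> c l \<Psi> R q"
proof -
  have p0: "0 < p" using p by simp
  interpret driftless_price M F B \<sigma> p "P p" by (rule price[OF p0])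
  have "payoff q = f q" using payoff_eq[of q] p maj by simp
  then have "expectation (\<lambda>\<omega>. payoff (stopped_at (P p) (hitting_time (P p) S) \<omega>)) = f q + 0 * p"
    using payoff_hitting_below[OF S p, of payoff] by simp
  moreover have "stopping_time F (hitting_time (P p) S)" using S by (intro hitting_time_stopping_time) auto
  ultimately show ?thesis
    using entry_affine[OF p0, of 0 "f q"] maj by (simp add: W_eq_f)
qed

lemma never_enter:
  assumes p: "0 < p" and maj: "\<And>y. 0 \<le> y \<Longrightarrow> f y \<le> - k * R powr \<alpha>"
  shows "optimal_entry_time M F P \<alpha> k \<gamma> l \<Psi> R p (\<lambda>\<omega>. \<infinity>) \<and>
    entry_value M F P \<alpha> k \<gamma> l \<Psi> R p = - k * R powr \<alpha>"
proof -
  interpret driftless_price M F B \<sigma> p "P p" by (rule price[OF p])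
  have "expectation (\<lambda>\<omega>. payoff (stopped_at (P p) (\<lambda>\<omega>. \<infinity>) \<omega>)) = - k * R powr \<alpha> + 0 * p"
    using payoff_never[of payoff] by (simp add: payoff_0)
  then show ?thesis
    using entry_affine[OF p, of 0 "- k * R powr \<alpha>"] maj stopping_time_const[of F \<infinity>] by simp
qed

text \<open>Multiplying the equation by \<open>R powr \<alpha>\<close> gives \<open>h_scaled\<close>
  at \<open>D = \<Psi> + R\<close>.\<close>

lemma threshold_equation_iff:
  assumes x: "0 \<le> x"
  shows "threshold_equation \<alpha> k \<gamma> c l \<Psi> R x \<longleftrightarrow> h ((\<Psi> + R) / \<gamma> * x) = - k * R powr \<alpha>"
proof -
  define T where "T = (k * (l / \<gamma> * x + 1) * (l / \<gamma> * (1 - \<alpha>) * x + 1) - A * (l / \<gamma>) * (1 - \<alpha>) * x\<^sup>2)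
       / (l / \<gamma> * x + 1) powr (2 - \<alpha>)"
  have "1 + \<Psi> / R = (\<Psi> + R) / R" using R by (simp add: field_simps)
  then have "(1 + \<Psi> / R) powr \<alpha> = (\<Psi> + R) powr \<alpha> / R powr \<alpha>"
    using R \<Psi> by (simp add: powr_divide)
  then have "threshold_equation \<alpha> k \<gamma> c l \<Psi> R x \<longleftrightarrow> k = (\<Psi> + R) powr \<alpha> / R powr \<alpha> * T"
    unfolding threshold_equation_def T_def A_eq by simp
  also have "\<dots> \<longleftrightarrow> k * R powr \<alpha> = (\<Psi> + R) powr \<alpha> * T"
    using R by (simp add: field_simps)
  also have "(\<Psi> + R) powr \<alpha> * T = - h ((\<Psi> + R) / \<gamma> * x)"
    unfolding h_scaled[OF x] T_def ..
  finally show ?thesis by auto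
qed

lemma smallest_threshold_rootI:
  assumes z: "0 \<le> z" "h z = - k * R powr \<alpha>" "\<And>y. 0 \<le> y \<Longrightarrow> h y = - k * R powr \<alpha> \<Longrightarrow> z \<le> y"
  obtains x where "smallest_threshold_root \<alpha> k \<gamma> c l \<Psi> R x" "z = (R + \<Psi>) / \<gamma> * x"
proof (rule that)
  define r where "r = (\<Psi> + R) / \<gamma>"
  have r: "r > 0" using \<Psi> R \<gamma> by (simp add: r_def)
  have "(R + \<Psi>) / \<gamma> = r" by (simp add: r_def add.commute)
  then show "z = (R + \<Psi>) / \<gamma> * (z / r)" using r by simp
  show "smallest_threshold_root \<alpha> k \<gamma> c l \<Psi> R (z / r)"
    unfolding smallest_threshold_root_def
  proof (intro conjI allI impI)
    show zr: "0 \<le> z / r" using z r by simp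
    have "r * (z / r) = z" using r by simp
    then show "threshold_equation \<alpha> k \<gamma> c l \<Psi> R (z / r)"
      using z(2) unfolding threshold_equation_iff[OF zr] r_def[symmetric] by (simp only:)
    fix y assume y: "0 \<le> y" "threshold_equation \<alpha> k \<gamma> c l \<Psi> R y"
    have "h (r * y) = - k * R powr \<alpha>" using y threshold_equation_iff by (simp add: r_def)
    then have "z \<le> r * y" using y r by (intro z(3)) auto
    then show "z / r \<le> y" using r by (simp add: field_simps)
  qed
qed

text \<open>There is no maximum point to bound the search for the threshold;
  \<open>h_near_0_small\<close> supplies the right end. For \<open>\<Psi> = 0\<close> the threshold
  is \<open>0\<close>, and the clause with \<open>p / p1\<close> is then vacuous.\<close>

lemma case_small:
  assumes le: "k * l / \<gamma> \<le> A"
  shows "\<exists>p1 x1. 0 \<le> p1 \<and> smallest_threshold_root \<alpha> k \<gamma> c l \<Psi> R x1 \<and> p1 = (R + \<Psi>) / \<gamma> * x1 \<and>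
    (\<forall>p>0. optimal_entry_time M F P \<alpha> k \<gamma> l \<Psi> R p (hitting_time (P p) {p1..}) \<and>
      (p1 \<le> p \<longrightarrow> entry_value M F P \<alpha> k \<gamma> l \<Psi> R p = W \<alpha> k \<gamma> c l \<Psi> R p) \<and>
      (p < p1 \<longrightarrow> entry_value M F P \<alpha> k \<gamma> l \<Psi> R p =
         (W \<alpha> k \<gamma> c l \<Psi> R p1 + k * R powr \<alpha>) * (p / p1) - k * R powr \<alpha>))"
proof -
  have "0 < k * R powr \<alpha>" using k R by simp
  then obtain q where q: "0 \<le> q" "- (k * R powr \<alpha>) \<le> h q"
    using h_near_0_small[OF le] by blast
  have h0: "h 0 \<le> - (k * R powr \<alpha>)" using f_0_le by (simp add: h_def)
  have d: "f' y < f' x" if "x \<in> {0..}" "y \<in> {0..}" "x < y" for x y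
    using f'_strict_antimono_small[OF le] that by simp
  have I: "is_interval {0::real..}" by (simp add: is_interval_1)
  obtain z where z: "0 \<le> z" "h z = - (k * R powr \<alpha>)"
      "\<And>y. 0 \<le> y \<Longrightarrow> h y = - (k * R powr \<alpha>) \<Longrightarrow> z \<le> y"
      "\<And>y. y \<in> {0..} \<Longrightarrow> z \<le> y \<Longrightarrow> - (k * R powr \<alpha>) \<le> h y"
    by (rule threshold_exists[OF I _ _ _ d h0 q(2)]) (use q(1) in auto)
  obtain x where x: "smallest_threshold_root \<alpha> k \<gamma> c l \<Psi> R x" "z = (R + \<Psi>) / \<gamma> * x"
    using smallest_threshold_rootI[of z] z by auto
  have now: "optimal_entry_time M F P \<alpha> k \<gamma> l \<Psi> R p (hitting_time (P p) {z..}) \<and>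
    entry_value M F P \<alpha> k \<gamma> l \<Psi> R p = W \<alpha> k \<gamma> c l \<Psi> R p" if "0 < p" "z \<le> p" for p
    using that z(4)[of p] by (intro enter_now tangent_small[OF le] f'_nonneg_small[OF le]) auto
  have wait: "optimal_entry_time M F P \<alpha> k \<gamma> l \<Psi> R p (hitting_time (P p) {z..}) \<and>
    entry_value M F P \<alpha> k \<gamma> l \<Psi> R p = (W \<alpha> k \<gamma> c l \<Psi> R z + k * R powr \<alpha>) * (p / z) - k * R powr \<alpha>" if "0 < p" "p < z" for p
    using that z(1,2) by (intro wait_for_rise tangent_small[OF le] f'_nonneg_small[OF le]) auto
  have "optimal_entry_time M F P \<alpha> k \<gamma> l \<Psi> R p (hitting_time (P p) {z..}) \<and>
      (z \<le> p \<longrightarrow> entry_value M F P \<alpha> k \<gamma> l \<Psi> R p = W \<alpha> k \<gamma> c l \<Psi> R p) \<and>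
      (p < z \<longrightarrow> entry_value M F P \<alpha> k \<gamma> l \<Psi> R p =
         (W \<alpha> k \<gamma> c l \<Psi> R z + k * R powr \<alpha>) * (p / z) - k * R powr \<alpha>)" if "0 < p" for p
    using now[OF that] wait[OF that] by (cases "z \<le> p") auto
  then show ?thesis using z(1) x by blast
qed

text \<open>At \<open>peak\<close> the tangent is horizontal, so its intercept is the maximum
  itself. The strict inequality \<open>pos\<close> therefore closes the search at
  \<open>peak\<close> and keeps the lower threshold strictly below it.\<close>

lemma case_medium:
  assumes gt: "A < k * l / \<gamma>" and pk: "0 < peak" and pos: "- (k * R powr \<alpha>) < f peak"
  shows "\<exists>p1 x1. 0 \<le> p1 \<and> p1 < peak \<and>
    smallest_threshold_root \<alpha> k \<gamma> c l \<Psi> R x1 \<and> p1 = (R + \<Psi>) / \<gamma> * x1 \<and>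
    (\<forall>p>0. optimal_entry_time M F P \<alpha> k \<gamma> l \<Psi> R p (hitting_time (P p) {p1..peak}) \<and>
      (peak < p \<longrightarrow> entry_value M F P \<alpha> k \<gamma> l \<Psi> R p = W \<alpha> k \<gamma> c l \<Psi> R peak) \<and>
      (p1 \<le> p \<and> p \<le> peak \<longrightarrow> entry_value M F P \<alpha> k \<gamma> l \<Psi> R p = W \<alpha> k \<gamma> c l \<Psi> R p) \<and>
      (p < p1 \<longrightarrow> entry_value M F P \<alpha> k \<gamma> l \<Psi> R p =
         (W \<alpha> k \<gamma> c l \<Psi> R p1 + k * R powr \<alpha>) * (p / p1) - k * R powr \<alpha>))"
proof -
  have pk0: "0 \<le> peak" using pk by simp
  have hp: "- (k * R powr \<alpha>) \<le> h peak" using pos h_peak[OF gt pk0] by simp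
  have h0: "h 0 \<le> - (k * R powr \<alpha>)" using f_0_le by (simp add: h_def)
  have d: "f' y < f' x" if "x \<in> {0..peak}" "y \<in> {0..peak}" "x < y" for x y
    using f'_strict_antimono_peak[OF gt] that by simp
  have I: "is_interval {0..peak}" by (simp add: is_interval_1)
  obtain z where z: "0 \<le> z" "z \<le> peak" "h z = - (k * R powr \<alpha>)"
      "\<And>y. 0 \<le> y \<Longrightarrow> h y = - (k * R powr \<alpha>) \<Longrightarrow> z \<le> y"
      "\<And>y. y \<in> {0..peak} \<Longrightarrow> z \<le> y \<Longrightarrow> - (k * R powr \<alpha>) \<le> h y"
    by (rule threshold_exists[OF I _ _ _ d h0 hp]) (use pk0 in auto)
  have "z \<noteq> peak" using z(3) pos h_peak[OF gt pk0] by auto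
  then have zp: "z < peak" using z(2) by simp
  obtain x where x: "smallest_threshold_root \<alpha> k \<gamma> c l \<Psi> R x" "z = (R + \<Psi>) / \<gamma> * x"
    using smallest_threshold_rootI[of z] z by auto
  have d0: "0 \<le> f' p" if "0 \<le> p" "p \<le> peak" for p using f'_sign(1)[OF gt] that by simp
  have now: "optimal_entry_time M F P \<alpha> k \<gamma> l \<Psi> R p (hitting_time (P p) {z..peak}) \<and>
    entry_value M F P \<alpha> k \<gamma> l \<Psi> R p = W \<alpha> k \<gamma> c l \<Psi> R p" if "0 < p" "z \<le> p" "p \<le> peak" for p
    using that z(5)[of p] by (intro enter_now tangent_large[OF gt] d0) auto
  have wait: "optimal_entry_time M F P \<alpha> k \<gamma> l \<Psi> R p (hitting_time (P p) {z..peak}) \<and>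
    entry_value M F P \<alpha> k \<gamma> l \<Psi> R p = (W \<alpha> k \<gamma> c l \<Psi> R z + k * R powr \<alpha>) * (p / z) - k * R powr \<alpha>" if "0 < p" "p < z" for p
    using that z(1-3) by (intro wait_for_rise tangent_large[OF gt] d0) auto
  have fall: "optimal_entry_time M F P \<alpha> k \<gamma> l \<Psi> R p (hitting_time (P p) {z..peak}) \<and>
    entry_value M F P \<alpha> k \<gamma> l \<Psi> R p = W \<alpha> k \<gamma> c l \<Psi> R peak" if "peak < p" for p
    using that z(1,2) pk pos by (intro wait_for_fall f_le_peak[OF gt]) auto
  have "optimal_entry_time M F P \<alpha> k \<gamma> l \<Psi> R p (hitting_time (P p) {z..peak}) \<and>
      (peak < p \<longrightarrow> entry_value M F P \<alpha> k \<gamma> l \<Psi> R p = W \<alpha> k \<gamma> c l \<Psi> R peak) \<and>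
      (z \<le> p \<and> p \<le> peak \<longrightarrow> entry_value M F P \<alpha> k \<gamma> l \<Psi> R p = W \<alpha> k \<gamma> c l \<Psi> R p) \<and>
      (p < z \<longrightarrow> entry_value M F P \<alpha> k \<gamma> l \<Psi> R p =
         (W \<alpha> k \<gamma> c l \<Psi> R z + k * R powr \<alpha>) * (p / z) - k * R powr \<alpha>)" if "0 < p" for p
    using now[OF that] wait[OF that] fall[of p] z(2) by (cases "p < z"; cases "peak < p") auto
  then show ?thesis using z(1) zp x by blast
qed

end

section \<open>Explicit constants and the three cases\<close>

lemma (in trade_profile) peak_eq:
  assumes "A < k * l / \<gamma>"
  shows "peak = D * (A / \<alpha> - k * l / \<gamma>) / (l * (k * l / \<gamma> - A))"
proof -
  define e where "e = k * l / \<gamma> - A"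
  have e: "e > 0" using assms by (simp add: e_def)
  have "k * l / \<gamma> = e + A" by (simp add: e_def)
  then show ?thesis
    unfolding peak_def e_def[symmetric] using e \<alpha> l by (simp add: field_simps)
qed

text \<open>Division by \<open>R powr \<alpha>\<close> turns the right side into
  \<open>(1 + \<Psi> / R) powr \<alpha> < k / - \<phi>\<close>, which is then solved for
  \<open>\<Psi>\<close>. In the application \<open>\<phi>\<close> is the maximum of the profile at
  \<open>D = 1\<close>.\<close>

lemma less_powr_threshold_iff:
  fixes \<phi> :: real
  assumes \<alpha>: "0 < \<alpha>" and k: "0 < k" and \<phi>: "\<phi> < 0" and R: "0 < R" and \<Psi>: "0 \<le> \<Psi>"
  shows "\<Psi> < ((k / - \<phi>) powr (1 / \<alpha>) - 1) * R \<longleftrightarrow> - (k * R powr \<alpha>) < (\<Psi> + R) powr \<alpha> * \<phi>"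
proof -
  define x where "x = (\<Psi> + R) / R"
  define y where "y = (k / - \<phi>) powr (1 / \<alpha>)"
  have pos: "0 \<le> x" "0 \<le> y" using R \<Psi> by (auto simp: x_def y_def)
  have y: "y powr \<alpha> = k / - \<phi>"
    using k \<phi> \<alpha> by (simp add: y_def powr_powr divide_pos_neg)
  have "\<Psi> < (y - 1) * R \<longleftrightarrow> x < y" using R by (simp add: x_def field_simps)
  also have "\<dots> \<longleftrightarrow> x powr \<alpha> < y powr \<alpha>"
    using powr_less_mono2[OF \<alpha> pos(1), of y] powr_mono2[of \<alpha> y x] \<alpha> pos by (meson less_imp_le not_le)
  also have "\<dots> \<longleftrightarrow> (\<Psi> + R) powr \<alpha> / R powr \<alpha> < k / - \<phi>"
    unfolding y using R \<Psi> by (simp add: x_def powr_divide)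
  also have "\<dots> \<longleftrightarrow> (\<Psi> + R) powr \<alpha> * - \<phi> < k * R powr \<alpha>"
  proof -
    have "(\<Psi> + R) powr \<alpha> / R powr \<alpha> < k / - \<phi> \<longleftrightarrow> (\<Psi> + R) powr \<alpha> < k * R powr \<alpha> / - \<phi>"
      using R by (subst pos_divide_less_eq) auto
    also have "\<dots> \<longleftrightarrow> (\<Psi> + R) powr \<alpha> * - \<phi> < k * R powr \<alpha>"
      using \<phi> by (intro pos_less_divide_eq) simp
    finally show ?thesis .
  qed
  also have "\<dots> \<longleftrightarrow> - (k * R powr \<alpha>) < (\<Psi> + R) powr \<alpha> * \<phi>" by auto
  finally show ?thesis unfolding y_def .
qed

theorem proposition4p8:
  fixes M :: "'a measure" and F :: "ennreal \<Rightarrow> 'a measure"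
    and B :: "real \<Rightarrow> 'a \<Rightarrow> real" and P :: "real \<Rightarrow> real \<Rightarrow> 'a \<Rightarrow> real"
    and \<mu> \<sigma> \<beta> \<alpha> k \<gamma> l c :: real
  assumes space: "usual_filtered_space M F"
    and bm: "brownian_motion M F B"
    and price: "\<And>p. p > 0 \<Longrightarrow> geometric_brownian_motion M F B \<mu> \<sigma> p (P p)"
    and \<sigma>: "\<sigma> > 0" and \<beta>_def: "\<beta> = 1 - 2 * \<mu> / \<sigma>\<^sup>2" and \<alpha>_\<beta>: "\<alpha> < \<beta>" and \<beta>_one: "\<beta> = 1"
    and \<alpha>: "0 < \<alpha>" "\<alpha> < 1" and k: "k > 1"
    and l: "l \<ge> 1" and \<gamma>: "0 < \<gamma>" "\<gamma> \<le> 1"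
    and c: "c > 1" "\<alpha> * c * (c - 1) powr (\<alpha> - 1) - (c - 1) powr \<alpha> - k = 0"
  shows
    "(l / \<gamma> \<le> \<alpha> / k * (c - 1) powr (\<alpha> - 1) \<longrightarrow>
        (\<forall>\<Psi>\<ge>0. \<forall>R>0. \<exists>p1 x1. 0 \<le> p1 \<and>
           smallest_threshold_root \<alpha> k \<gamma> c l \<Psi> R x1 \<and> p1 = (R + \<Psi>) / \<gamma> * x1 \<and>
           (\<forall>p>0. optimal_entry_time M F P \<alpha> k \<gamma> l \<Psi> R p (hitting_time (P p) {p1..}) \<and>
              (p1 \<le> p \<longrightarrow>
                 entry_value M F P \<alpha> k \<gamma> l \<Psi> R p = W \<alpha> k \<gamma> c l \<Psi> R p) \<and>
              (p < p1 \<longrightarrow>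
                 entry_value M F P \<alpha> k \<gamma> l \<Psi> R p =
                   (W \<alpha> k \<gamma> c l \<Psi> R p1 + k * R powr \<alpha>) * (p / p1) - k * R powr \<alpha>))))
     \<and>
     (\<alpha> / k * (c - 1) powr (\<alpha> - 1) < l / \<gamma> \<and> l / \<gamma> < (c - 1) powr (\<alpha> - 1) / k \<longrightarrow>
        (\<exists>C>0. \<forall>\<Psi>\<ge>0. \<forall>R>0.
           (\<Psi> < C * R \<longrightarrow>
              (\<exists>p1 p2 x1. 0 \<le> p1 \<and> p1 < p2 \<and>
                 smallest_threshold_root \<alpha> k \<gamma> c l \<Psi> R x1 \<and> p1 = (R + \<Psi>) / \<gamma> * x1 \<and>
                 p2 = (R + \<Psi>) * ((c - 1) powr (\<alpha> - 1) - k * l / \<gamma>)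
                        / (l * (k * l / \<gamma> - \<alpha> * (c - 1) powr (\<alpha> - 1))) \<and>
                 (\<forall>p>0. optimal_entry_time M F P \<alpha> k \<gamma> l \<Psi> R p (hitting_time (P p) {p1..p2}) \<and>
                    (p2 < p \<longrightarrow>
                       entry_value M F P \<alpha> k \<gamma> l \<Psi> R p = W \<alpha> k \<gamma> c l \<Psi> R p2) \<and>
                    (p1 \<le> p \<and> p \<le> p2 \<longrightarrow>
                       entry_value M F P \<alpha> k \<gamma> l \<Psi> R p = W \<alpha> k \<gamma> c l \<Psi> R p) \<and>
                    (p < p1 \<longrightarrow>
                       entry_value M F P \<alpha> k \<gamma> l \<Psi> R p =
                         (W \<alpha> k \<gamma> c l \<Psi> R p1 + k * R powr \<alpha>) * (p / p1) - k * R powr \<alpha>)))) \<and>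
           (\<Psi> \<ge> C * R \<longrightarrow>
              (\<forall>p>0. optimal_entry_time M F P \<alpha> k \<gamma> l \<Psi> R p (\<lambda>\<omega>. \<infinity>) \<and>
                 entry_value M F P \<alpha> k \<gamma> l \<Psi> R p = - k * R powr \<alpha>))))
     \<and>
     (l / \<gamma> \<ge> (c - 1) powr (\<alpha> - 1) / k \<longrightarrow>
        (\<forall>\<Psi>\<ge>0. \<forall>R>0. \<forall>p>0.
           optimal_entry_time M F P \<alpha> k \<gamma> l \<Psi> R p (\<lambda>\<omega>. \<infinity>) \<and>
           entry_value M F P \<alpha> k \<gamma> l \<Psi> R p = - k * R powr \<alpha>))"
proof -
  define A where "A = \<alpha> * (c - 1) powr (\<alpha> - 1)"
  define q where "q = k * l / \<gamma>"
  have A: "0 < A" using \<alpha> c(1) by (simp add: A_def)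
  have u: "(c - 1) powr (\<alpha> - 1) = A / \<alpha>" using \<alpha> by (simp add: A_def)
  have k0: "0 < k" and l0: "0 < l" using k l by auto
  have \<mu>: "\<mu> = 0" using \<beta>_def \<beta>_one \<sigma> by simp
  interpret brownian_space M F B by unfold_locales (rule space, rule bm)
  have entry: "entry_problem M F B \<alpha> k \<gamma> l A \<Psi> R \<sigma> c P" if "0 \<le> \<Psi>" "0 < R" for \<Psi> R
    by unfold_locales (use that \<alpha> k0 l0 l \<gamma> c A price \<sigma> \<mu> in \<open>auto simp: A_def\<close>)
  \<comment> \<open>The profile with \<open>D = 1\<close>, from which the constant \<open>C\<close>
    is built before \<open>\<Psi>\<close> and \<open>R\<close> are chosen.\<close>
  interpret unit: trade_profile \<alpha> k \<gamma> l A 1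
    by unfold_locales (use \<alpha> k0 l0 \<gamma> A in auto)
  have small: "l / \<gamma> \<le> \<alpha> / k * (c - 1) powr (\<alpha> - 1) \<longleftrightarrow> q \<le> A"
    and large: "l / \<gamma> < (c - 1) powr (\<alpha> - 1) / k \<longleftrightarrow> q < A / \<alpha>"
    using k0 \<alpha> unfolding u q_def by (auto simp: field_simps)
  have never: "optimal_entry_time M F P \<alpha> k \<gamma> l \<Psi> R p (\<lambda>\<omega>. \<infinity>) \<and>
      entry_value M F P \<alpha> k \<gamma> l \<Psi> R p = - k * R powr \<alpha>"
    if ge: "(c - 1) powr (\<alpha> - 1) / k \<le> l / \<gamma>" and \<Psi>R: "0 \<le> \<Psi>" "0 < R" and p: "0 < p" for \<Psi> R p
  proof -
    have ge': "A / \<alpha> \<le> k * l / \<gamma>" using large ge unfolding q_def by auto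
    have "A < A / \<alpha>" using A \<alpha> by (simp add: field_simps)
    then have gt: "A < k * l / \<gamma>" using ge' by simp
    interpret entry_problem M F B \<alpha> k \<gamma> l A \<Psi> R \<sigma> c P by (rule entry[OF \<Psi>R])
    \<comment> \<open>Hence \<open>f\<close> decreases on the whole half-line, starting from
      \<open>f 0\<close>, which is already no better than staying out.\<close>
    have "peak \<le> 0"
      unfolding peak_eq[OF gt] using ge' gt l0 \<Psi>R by (intro divide_nonpos_nonneg mult_nonneg_nonpos) auto
    then have "f y \<le> - k * R powr \<alpha>" if "0 \<le> y" for y
      using f_antimono_after_peak[OF gt order_refl _ that] f_0_le by simp
    then show ?thesis by (rule never_enter[OF p])
  qed
  show ?thesis
  proof (intro conjI impI allI, goal_cases)
    case (1 \<Psi> R)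
    then show ?case
      unfolding small q_def by (intro entry_problem.case_small[OF entry])
  next
    case 2
    then have gt: "A < k * l / \<gamma>" and lt: "k * l / \<gamma> < A / \<alpha>"
      using small large unfolding q_def by auto
    have unit_peak: "0 < unit.peak"
      unfolding unit.peak_eq[OF gt] using gt lt l0 by simp
    define \<phi> where "\<phi> = unit.f unit.peak"
    have \<phi>: "\<phi> < 0" "- k < \<phi>"
      using unit.f_peak_negative[OF gt] unit.f_0_less_peak[OF gt unit_peak] unit_peak
      by (auto simp: \<phi>_def unit.f_0)
    \<comment> \<open>The solution of \<open>(1 + C) powr \<alpha> = k / - \<phi>\<close>, that is,
      the ratio \<open>\<Psi> / R\<close> at which the maximum of \<open>f\<close> equals the payoff
      of staying out.\<close>
    define C where "C = (k / - \<phi>) powr (1 / \<alpha>) - 1"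
    have "1 < k / - \<phi>" using \<phi> by (subst pos_less_divide_eq) auto
    then have C: "0 < C" unfolding C_def using \<alpha> gr_one_powr[of "k / - \<phi>" "1 / \<alpha>"] by simp
    show ?case
    proof (intro exI[of _ C] conjI[OF C] allI impI, goal_cases)
      case (1 \<Psi> R)
      interpret entry_problem M F B \<alpha> k \<gamma> l A \<Psi> R \<sigma> c P by (rule entry[OF 1])
      have D0: "0 < \<Psi> + R" using 1 by simp
      \<comment> \<open>The maximum point is proportional to \<open>\<Psi> + R\<close>, so rescaling
        leads back to the unit profile.\<close>
      have scale: "peak = (\<Psi> + R) * unit.peak"
        unfolding peak_eq[OF gt] unit.peak_eq[OF gt] by simp
      then have pk: "0 < peak" using D0 unit_peak by simp
      have "peak / (\<Psi> + R) = unit.peak" using scale D0 by simp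
      then have f_peak: "f peak = (\<Psi> + R) powr \<alpha> * \<phi>"
        using f_peak_scaled[OF gt less_imp_le[OF pk]] by (simp add: \<phi>_def unit.f_def)
      have iff: "\<Psi> < C * R \<longleftrightarrow> - (k * R powr \<alpha>) < f peak"
        unfolding f_peak C_def using \<alpha>(1) k0 \<phi>(1) 1(2,1) by (rule less_powr_threshold_iff)
      have p2: "peak = (R + \<Psi>) * ((c - 1) powr (\<alpha> - 1) - k * l / \<gamma>)
                        / (l * (k * l / \<gamma> - \<alpha> * (c - 1) powr (\<alpha> - 1)))"
        using \<alpha> unfolding peak_eq[OF gt] u by (simp add: add.commute)
      show ?case
      proof (intro conjI impI, goal_cases)
        case 1
        then have "- (k * R powr \<alpha>) < f peak" using iff by simp
        from case_medium[OF gt pk this] p2 show ?case by blast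
      next
        case 2
        then have "f peak \<le> - k * R powr \<alpha>" using iff by simp
        then have "f y \<le> - k * R powr \<alpha>" if "0 \<le> y" for y
          using f_le_peak[OF gt less_imp_le[OF pk] that] by simp
        then show ?case using never_enter by blast
      qed
    qed
  next
    case (3 \<Psi> R p)
    then show ?case using never by blast
  next
    case (4 \<Psi> R p)
    then show ?case using never by blast
  qed
qed

end
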